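(* Let $K$ be a totally real number field (possibly of infinite degree over $\mathbb{Q}$), regarded as a subfield of $\mathbb{R}$ via a fixed embedding, with ring of integers $\mathcal{O}$. For any root lattice $L$ over $\mathcal{O}$ of rank $2$, let $\mu(L)$ denote the subgroup of $\mu_\infty$ generated by $\{\zeta\in\mu_\infty : \zeta+\zeta^{-1}=\alpha\cdot\beta \text{ for some } \alpha,\beta\in\Phi(L)\}$. Then $\mu(L)=\mu(C)$ for some $C\in\mathcal{P}_K\cup\mathcal{R}_K$, and the map $$\{\text{root lattices over } \mathcal{O} \text{ of rank } 2\}/\!\simeq\ \longrightarrow\ \{\mu(C) : C\in\mathcal{P}_K\cup\mathcal{R}_K\},\qquad L\mapsto\mu(L),$$ is a bijection. In particular, when $[K:\mathbb{Q}]<\infty$, for an integer $m\ge3$ there exists an irreducible root lattice over $\mathcal{O}$ of type $I_2(m)$ if and only if both of the following hold: (i) $2\cos(\pi/m)\in K$, i.e. $m\in Q_K$; (ii) $m$ is a prime power or a maximal element of $Q_K$ with respect to $\preceq$.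
   Context: A totally real number field is an algebraic (possibly infinite) extension $K$ of $\mathbb{Q}$ all of whose embeddings into $\mathbb{C}$ have image in $\mathbb{R}$; $\mathcal{O}$ is the set of its elements integral over $\mathbb{Z}$. An $\mathcal{O}$-lattice is a nonzero finitely generated free $\mathcal{O}$-module $L$ with a symmetric $\mathcal{O}$-bilinear form $L\times L\to\mathcal{O}$, $(x,y)\mapsto x\cdot y$, with $\sigma(x\cdot x)>0$ for every embedding $\sigma:K\hookrightarrow\mathbb{R}$ and every $x\in L\setminus\{0\}$. Put $\Phi(L)=\{x\in L:x\cdot x=2\}$; $L$ is a root lattice if $\Phi(L)$ generates $L$ over $\mathcal{O}$. Isomorphisms of root lattices are $\mathcal{O}$-linear bijections preserving the bilinear forms. $L$ is reducible if it is an orthogonal direct sum of two nonzero $\mathcal{O}$-lattices, and irreducible otherwise (rank $2$ root lattices are not assumed irreducible in the first part). $\mu_\infty\subset\bar K^\times$ is the group of all roots of unity, and $\zeta_n$ is a primitive $n$-th root of unity. $Q_K=\{n>1: \zeta_{2n}+\zeta_{2n}^{-1}\in K\}$ is the vertex set of a directed graph (also denoted $Q_K$) with an edge from $x$ to $y$ iff $x\mid y$ and $y/x$ is a prime number. Write $x\preceq y$ if there is a directed path (possibly of length $0$) from $x$ to $y$; this is a partial order. $\pi_0(Q_K)$ is the set of connected components of the (underlying undirected) graph, viewed as subsets of $Q_K$. Define $\mathcal{P}_K=\{\{q\}: q\in Q_K \text{ a prime power}\}$ and $\mathcal{R}_K=\{C\in\pi_0(Q_K): C \text{ contains an integer that is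 not a prime power}\}$. For a subset $C\subset Q_K$, $\mu(C)$ is the subgroup of $\mu_\infty$ generated by $\{\zeta_{2n}:n\in C\}$. Type $I_2(m)$: suppose $[K:\mathbb{Q}]<\infty$; then $\Phi(L)$ is finite. Order $K$ via the fixed embedding into $\mathbb{R}$ and let $\mathcal{O}_{\ge1}=\{c\in\mathcal{O}:c\ge1\}$. A fundamental system of roots is a subset $\Delta\subset\Phi(L)$ which is a $K$-basis of $L\otimes_{\mathcal{O}}K$ such that every root is $\sum_{\beta\in\Delta}c_\beta\beta$ with all $c_\beta\in\mathcal{O}_{\ge1}\sqcup\{0\}$ or all $-c_\beta\in\mathcal{O}_{\ge1}\sqcup\{0\}$; it exists. A rank $2$ root lattice is of type $I_2(m)$ ($m\ge3$) if a (equivalently any) fundamental system $\Delta=\{\alpha,\beta\}$ satisfies $\alpha\cdot\beta=-2\cos(\pi/m)$ (so $I_2(3)=A_2$ and $I_2(4)=B_2$). *)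

theory Defs
  imports
    "HOL-Analysis.Analysis"
    "HOL-Algebra.Algebra"
    "HOL-Algebra.Algebraic_Closure_Type"
    "HOL-Number_Theory.Prime_Powers"
begin

section \<open>Totally real fields\<close>

text \<open>The field \<open>K\<close> is given as a subset of the reals (through its fixed embedding). Subrings are
  turned into structures of HOL-Algebra by restricting the carrier.\<close>

abbreviation ring_on :: "'f::field set \<Rightarrow> 'f ring"
  where "ring_on S \<equiv> ring_of_type_algebra\<lparr>carrier := S\<rparr>"

definition embeddings :: "real set \<Rightarrow> (real \<Rightarrow> 'f::field) set"
  where "embeddings K = ring_hom (ring_on K) ring_of_type_algebra"

definition totally_real_field :: "real set \<Rightarrow> bool"
  where "totally_real_field K \<longleftrightarrow>
    subfield K ring_of_type_algebra \<and>
    (\<forall>x\<in>K. Polynomial.algebraic x) \<and>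
    (\<forall>\<sigma>\<in>embeddings K. \<forall>x\<in>K. \<sigma> x \<in> (\<real> :: complex set))"

definition finite_degree :: "real set \<Rightarrow> bool"
  where "finite_degree K \<longleftrightarrow> ring.finite_dimension ring_of_type_algebra \<rat> K"

definition integers_of :: "real set \<Rightarrow> real set"
  where "integers_of K = {x \<in> K. algebraic_int x}"


section \<open>Lattices\<close>

definition generates :: "('r, 'm) ring_scheme \<Rightarrow> ('r, 'a, 'n) module_scheme \<Rightarrow> 'a set \<Rightarrow> bool"
  where "generates R M S \<longleftrightarrow> S \<subseteq> carrier M \<and>
    (\<forall>x\<in>carrier M. \<exists>F c. finite F \<and> F \<subseteq> S \<and> c \<in> F \<rightarrow> carrier R \<and>
       x = finsum M (\<lambda>v. c v \<odot>\<^bsub>M\<^esub> v) F)"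

definition finite_basis :: "('r, 'm) ring_scheme \<Rightarrow> ('r, 'a, 'n) module_scheme \<Rightarrow> 'a set \<Rightarrow> bool"
  where "finite_basis R M B \<longleftrightarrow> finite B \<and> B \<subseteq> carrier M \<and>
    (\<forall>x\<in>carrier M. \<exists>!c. c \<in> B \<rightarrow>\<^sub>E carrier R \<and> x = finsum M (\<lambda>b. c b \<odot>\<^bsub>M\<^esub> b) B)"

text \<open>The fields \<open>mult\<close> and \<open>one\<close> that modules inherit from rings carry no meaning.\<close>

record 'a form_module = "(real, 'a) module" +
  form :: "'a \<Rightarrow> 'a \<Rightarrow> real"

definition O_lattice :: "real set \<Rightarrow> 'a form_module \<Rightarrow> bool"
  where "O_lattice K L \<longleftrightarrow>
    module (ring_on (integers_of K)) L \<and>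
    (\<exists>B. finite_basis (ring_on (integers_of K)) L B) \<and>
    carrier L \<noteq> {\<zero>\<^bsub>L\<^esub>} \<and>
    (\<forall>x\<in>carrier L. \<forall>y\<in>carrier L. form L x y \<in> integers_of K \<and> form L x y = form L y x) \<and>
    (\<forall>x\<in>carrier L. \<forall>y\<in>carrier L. \<forall>z\<in>carrier L.
       form L (x \<oplus>\<^bsub>L\<^esub> y) z = form L x z + form L y z) \<and>
    (\<forall>a\<in>integers_of K. \<forall>x\<in>carrier L. \<forall>z\<in>carrier L.
       form L (a \<odot>\<^bsub>L\<^esub> x) z = a * form L x z) \<and>
    (\<forall>\<sigma>\<in>embeddings K. \<forall>x\<in>carrier L - {\<zero>\<^bsub>L\<^esub>}. \<sigma> (form L x x) > (0::real))"

definition has_rank :: "real set \<Rightarrow> 'a form_module \<Rightarrow> nat \<Rightarrow> bool"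
  where "has_rank K L n \<longleftrightarrow> (\<exists>B. finite_basis (ring_on (integers_of K)) L B \<and> card B = n)"

definition roots :: "'a form_module \<Rightarrow> 'a set"
  where "roots L = {x \<in> carrier L. form L x x = 2}"

definition root_lattice :: "real set \<Rightarrow> 'a form_module \<Rightarrow> bool"
  where "root_lattice K L \<longleftrightarrow>
    O_lattice K L \<and> generates (ring_on (integers_of K)) L (roots L)"

definition rank2_root_lattices :: "real set \<Rightarrow> 'a form_module set"
  where "rank2_root_lattices K = {L. root_lattice K L \<and> has_rank K L 2}"

definition lattice_iso :: "real set \<Rightarrow> 'a form_module \<Rightarrow> 'b form_module \<Rightarrow> ('a \<Rightarrow> 'b) \<Rightarrow> bool"
  where "lattice_iso K L M f \<longleftrightarrow>
    bij_betw f (carrier L) (carrier M) \<and>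
    (\<forall>x\<in>carrier L. \<forall>y\<in>carrier L. f (x \<oplus>\<^bsub>L\<^esub> y) = f x \<oplus>\<^bsub>M\<^esub> f y) \<and>
    (\<forall>a\<in>integers_of K. \<forall>x\<in>carrier L. f (a \<odot>\<^bsub>L\<^esub> x) = a \<odot>\<^bsub>M\<^esub> f x) \<and>
    (\<forall>x\<in>carrier L. \<forall>y\<in>carrier L. form M (f x) (f y) = form L x y)"

definition lattice_iso_rel :: "real set \<Rightarrow> ('a form_module \<times> 'a form_module) set"
  where "lattice_iso_rel K = {(L, M). L \<in> rank2_root_lattices K \<and> M \<in> rank2_root_lattices K \<and>
    (\<exists>f. lattice_iso K L M f)}"

lemma equiv_lattice_iso_rel: "equiv (rank2_root_lattices K) (lattice_iso_rel K)"
proof (rule equivI)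
  show "lattice_iso_rel K \<subseteq> rank2_root_lattices K \<times> rank2_root_lattices K"
    by (auto simp: lattice_iso_rel_def)
  show "refl_on (rank2_root_lattices K) (lattice_iso_rel K)"
    by (auto simp: refl_on_def lattice_iso_rel_def lattice_iso_def intro!: exI[of _ id])
  show "sym (lattice_iso_rel K)"
  proof (rule symI)
    fix L M assume "(L, M) \<in> lattice_iso_rel K"
    then obtain f where LM: "L \<in> rank2_root_lattices K" "M \<in> rank2_root_lattices K"
      and f: "lattice_iso K L M f" by (auto simp: lattice_iso_rel_def)
    define g where "g = inv_into (carrier L) f"
    have bij: "bij_betw f (carrier L) (carrier M)" using f by (simp add: lattice_iso_def)
    have gc: "g y \<in> carrier L" "f (g y) = y" if "y \<in> carrier M" for y
      using bij that by (auto simp: g_def bij_betw_def inv_into_into f_inv_into_f)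
    have gf: "g (f x) = x" if "x \<in> carrier L" for x
      using bij that by (auto simp: g_def bij_betw_def)
    from LM(1) interpret L: module "ring_on (integers_of K)" L
      by (simp add: rank2_root_lattices_def root_lattice_def O_lattice_def)
    have "lattice_iso K M L g"
      unfolding lattice_iso_def
    proof (intro conjI ballI)
      show "bij_betw g (carrier M) (carrier L)" unfolding g_def by (rule bij_betw_inv_into[OF bij])
    next
      fix x y assume "x \<in> carrier M" "y \<in> carrier M"
      with gc[of x] gc[of y] gf[of "g x \<oplus>\<^bsub>L\<^esub> g y"] f
      show "g (x \<oplus>\<^bsub>M\<^esub> y) = g x \<oplus>\<^bsub>L\<^esub> g y"
        by (simp add: lattice_iso_def)
    next
      fix a x assume "a \<in> integers_of K" "x \<in> carrier M"
      with gc[of x] gf[of "a \<odot>\<^bsub>L\<^esub> g x"] f L.smult_closed[of a "g x"]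
      show "g (a \<odot>\<^bsub>M\<^esub> x) = a \<odot>\<^bsub>L\<^esub> g x"
        by (simp add: lattice_iso_def)
    next
      fix x y assume "x \<in> carrier M" "y \<in> carrier M"
      with gc[of x] gc[of y] f show "form L (g x) (g y) = form M x y"
        unfolding lattice_iso_def by metis
    qed
    with LM show "(M, L) \<in> lattice_iso_rel K" unfolding lattice_iso_rel_def by blast
  qed
  show "trans (lattice_iso_rel K)"
  proof (rule transI)
    fix L M N assume "(L, M) \<in> lattice_iso_rel K" "(M, N) \<in> lattice_iso_rel K"
    then obtain f g where *: "L \<in> rank2_root_lattices K" "N \<in> rank2_root_lattices K"
      and fg: "lattice_iso K L M f" "lattice_iso K M N g" by (auto simp: lattice_iso_rel_def)
    have "f x \<in> carrier M" if "x \<in> carrier L" for x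
      using fg(1) that by (auto simp: lattice_iso_def bij_betw_def)
    with fg have "lattice_iso K L N (g \<circ> f)"
      by (auto simp: lattice_iso_def intro: bij_betw_trans[of f _ "carrier M"])
    with * show "(L, N) \<in> lattice_iso_rel K" unfolding lattice_iso_rel_def by blast
  qed
qed

text \<open>Both summands are required to be lattices themselves, in particular nonzero and free.\<close>

definition reducible_lattice :: "real set \<Rightarrow> 'a form_module \<Rightarrow> bool"
  where "reducible_lattice K L \<longleftrightarrow> (\<exists>H1 H2.
    H1 \<subseteq> carrier L \<and> H2 \<subseteq> carrier L \<and>
    O_lattice K (L\<lparr>carrier := H1\<rparr>) \<and> O_lattice K (L\<lparr>carrier := H2\<rparr>) \<and>
    H1 \<inter> H2 = {\<zero>\<^bsub>L\<^esub>} \<and> H1 <+>\<^bsub>L\<^esub> H2 = carrier L \<and>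
    (\<forall>x\<in>H1. \<forall>y\<in>H2. form L x y = 0))"


section \<open>Roots of unity\<close>

definition roots_of_unity :: "complex monoid"
  where "roots_of_unity = \<lparr>carrier = {z. \<exists>n>0. z ^ n = 1}, monoid.mult = (*), one = 1\<rparr>"

definition \<zeta> :: "nat \<Rightarrow> complex"
  where "\<zeta> n = cis (2 * pi / real n)"

definition mu_lattice :: "'a form_module \<Rightarrow> complex set"
  where "mu_lattice L = generate roots_of_unity
    {z \<in> carrier roots_of_unity.
       \<exists>\<alpha>\<in>roots L. \<exists>\<beta>\<in>roots L. z + inverse z = complex_of_real (form L \<alpha> \<beta>)}"

definition mu_set :: "nat set \<Rightarrow> complex set"
  where "mu_set C = generate roots_of_unity ((\<lambda>n. \<zeta> (2 * n)) ` C)"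


section \<open>The graph\<close>

text \<open>Choosing another primitive \<open>2n\<close>-th root of unity gives the same set: \<open>\<rat>(\<zeta> + 1/\<zeta>)\<close> is Galois over
  \<open>\<rat>\<close>, so it contains all conjugates of \<open>\<zeta> + 1/\<zeta>\<close>.\<close>

definition Q_vertices :: "real set \<Rightarrow> nat set"
  where "Q_vertices K = {n. n > 1 \<and> \<zeta> (2 * n) + inverse (\<zeta> (2 * n)) \<in> complex_of_real ` K}"

definition Q_edges :: "real set \<Rightarrow> (nat \<times> nat) set"
  where "Q_edges K = {(x, y). x \<in> Q_vertices K \<and> y \<in> Q_vertices K \<and> x dvd y \<and> Factorial_Ring.prime (y div x)}"

definition Q_le :: "real set \<Rightarrow> nat \<Rightarrow> nat \<Rightarrow> bool"
  where "Q_le K x y \<longleftrightarrow> x \<in> Q_vertices K \<and> y \<in> Q_vertices K \<and> (x, y) \<in> (Q_edges K)\<^sup>*"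

definition Q_maximal :: "real set \<Rightarrow> nat \<Rightarrow> bool"
  where "Q_maximal K m \<longleftrightarrow> m \<in> Q_vertices K \<and> (\<forall>y. Q_le K m y \<longrightarrow> y = m)"

definition Q_components :: "real set \<Rightarrow> nat set set"
  where "Q_components K = Q_vertices K // (Q_edges K \<union> (Q_edges K)\<inverse>)\<^sup>*"

definition P_family :: "real set \<Rightarrow> nat set set"
  where "P_family K = {{q} | q. q \<in> Q_vertices K \<and> primepow q}"

definition R_family :: "real set \<Rightarrow> nat set set"
  where "R_family K = {C \<in> Q_components K. \<exists>n\<in>C. \<not> primepow n}"


section \<open>Root lattices of type \<open>I\<^sub>2(m)\<close>\<close>

text \<open>The vector space \<open>K \<otimes> L\<close> over \<open>K\<close>, the tensor product being taken over the ring of integers: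
  the free abelian group on the pairs \<open>(k, x)\<close> modulo the balancing relations.\<close>

definition tensor_pairs :: "real set \<Rightarrow> 'a form_module \<Rightarrow> ((real \<times> 'a) \<Rightarrow>\<^sub>0 int) monoid"
  where "tensor_pairs K L = free_Abelian_group (K \<times> carrier L)"

definition tensor_relations :: "real set \<Rightarrow> 'a form_module \<Rightarrow> ((real \<times> 'a) \<Rightarrow>\<^sub>0 int) set"
  where "tensor_relations K L = generate (tensor_pairs K L)
    ({frag_of (k + l, x) - frag_of (k, x) - frag_of (l, x) | k l x.
        k \<in> K \<and> l \<in> K \<and> x \<in> carrier L} \<union>
     {frag_of (k, x \<oplus>\<^bsub>L\<^esub> y) - frag_of (k, x) - frag_of (k, y) | k x y.
        k \<in> K \<and> x \<in> carrier L \<and> y \<in> carrier L} \<union>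
     {frag_of (k * a, x) - frag_of (k, a \<odot>\<^bsub>L\<^esub> x) | k a x.
        k \<in> K \<and> a \<in> integers_of K \<and> x \<in> carrier L})"

definition pure_tensor :: "real set \<Rightarrow> 'a form_module \<Rightarrow> real \<Rightarrow> 'a \<Rightarrow> ((real \<times> 'a) \<Rightarrow>\<^sub>0 int) set"
  where "pure_tensor K L k x = tensor_relations K L #>\<^bsub>tensor_pairs K L\<^esub> frag_of (k, x)"

text \<open>Scalars act by \<open>k \<odot> (l \<otimes> x) = kl \<otimes> x\<close>; adding the relations to the image of a coset under
  this map on representatives yields a full coset again.\<close>

definition scalar_extension :: "real set \<Rightarrow> 'a form_module \<Rightarrow> (real, ((real \<times> 'a) \<Rightarrow>\<^sub>0 int) set) module"
  where "scalar_extension K L = \<lparr>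
    carrier = carrier (tensor_pairs K L Mod tensor_relations K L),
    monoid.mult = undefined,
    one = undefined,
    ring.zero = one (tensor_pairs K L Mod tensor_relations K L),
    add = monoid.mult (tensor_pairs K L Mod tensor_relations K L),
    smult = (\<lambda>k T. tensor_relations K L <#>\<^bsub>tensor_pairs K L\<^esub>
                     (frag_extend (\<lambda>(l, x). frag_of (k * l, x)) ` T))\<rparr>"

text \<open>A lattice, being free, embeds into its scalar extension by \<open>x \<mapsto> 1 \<otimes> x\<close>.\<close>

definition fundamental_system :: "real set \<Rightarrow> 'a form_module \<Rightarrow> 'a set \<Rightarrow> bool"
  where "fundamental_system K L \<Delta> \<longleftrightarrow>
    \<Delta> \<subseteq> roots L \<and>
    finite_basis (ring_on K) (scalar_extension K L) (pure_tensor K L 1 ` \<Delta>) \<and>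
    (\<forall>\<gamma>\<in>roots L. \<exists>c \<in> \<Delta> \<rightarrow> integers_of K.
       \<gamma> = finsum L (\<lambda>\<beta>. c \<beta> \<odot>\<^bsub>L\<^esub> \<beta>) \<Delta> \<and>
       ((\<forall>\<beta>\<in>\<Delta>. c \<beta> \<in> {a \<in> integers_of K. a \<ge> 1} \<union> {0}) \<or>
        (\<forall>\<beta>\<in>\<Delta>. - c \<beta> \<in> {a \<in> integers_of K. a \<ge> 1} \<union> {0})))"

definition type_I2 :: "real set \<Rightarrow> nat \<Rightarrow> 'a form_module \<Rightarrow> bool"
  where "type_I2 K m L \<longleftrightarrow> L \<in> rank2_root_lattices K \<and>
    (\<exists>\<alpha> \<beta>. \<alpha> \<noteq> \<beta> \<and> fundamental_system K L {\<alpha>, \<beta>} \<and> form L \<alpha> \<beta> = - 2 * cos (pi / real m))"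

end

theory Submission
  imports Defs "Jordan_Normal_Form.Char_Poly" "HOL-Library.Real_Mod"
begin

text \<open>By positivity and Kronecker's theorem the product of two roots is \<open>z + 1/z\<close> for a root of unity \<open>z\<close>.
  Hence, sending a fixed root to 1, a root lattice \<open>L\<close> of rank 2 embeds into the complex numbers with
  form \<open>x y\<^sup>* + x\<^sup>* y\<close> in such a way that its roots become a set of roots of unity closed under
  reflections. Such a set meets every finite group of roots of unity in a cyclic group, and since \<open>L\<close> is finitely generated,
  it is isometric to \<open>\<Lambda> n = \<O> + \<O> \<zeta>\<^sub>2\<^sub>n\<close> for some \<open>n\<close> in \<open>Q\<close>. Moreover \<open>\<mu>(L)\<close> is the group \<open>U n\<close> of all roots
  of unity in the ring \<open>\<Lambda> n\<close>, and it determines \<open>\<Lambda> n\<close>.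

  The discriminant of \<open>\<Lambda> n\<close> is associated to \<open>(1 - \<zeta>\<^sub>n)\<^sup>2\<close>. If \<open>n\<close> is not a prime power, this is a unit, so \<open>\<Lambda> n = \<Lambda> m\<close>
  for every multiple \<open>m\<close> of \<open>n\<close> in \<open>Q\<close>; as components of the graph are closed under least common
  multiples, \<open>U n\<close> is the group of the component of \<open>n\<close>. If \<open>n\<close> is a prime power, the discriminants
  of \<open>\<Lambda> n\<close> and \<open>\<Lambda> m\<close> differ for all proper multiples \<open>m\<close> of \<open>n\<close>, so \<open>U n\<close> consists of the \<open>2n\<close>-th roots of unity only.

  The pair \<open>1, -\<zeta>\<^sub>2\<^sub>m\<^sup>*\<close> is a fundamental system of \<open>\<Lambda> m\<close> exactly if no root has argument strictly
  between 0 and \<open>\<pi>/m\<close>.\<close>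

section \<open>Algebraic integers\<close>

text \<open>\<open>K\<close> may have infinite degree, so neither norms nor finiteness of the root
  system is at hand. Divisibility is therefore expressed by explicit algebraic integer quotients of
  complex numbers. Positivity of the form is assumed for embeddings of \<open>K\<close> into the
  reals, whereas Kronecker's theorem speaks of the conjugates of one number; bridging the two
  requires extending a homomorphism from \<open>Z[c]\<close> to all of \<open>K\<close>, and total
  reality makes the extension real-valued. The discriminant enters through its square root
  \<open>z - cnj z\<close> for \<open>z = \<zeta> (2 * n)\<close>, which equals
  \<open>1 - \<zeta> n\<close> up to a root of unity. Whether this is invertible among the algebraic
  integers depends on \<open>n\<close> alone: if \<open>n\<close> is a product of two coprime
  factors greater than 1, then \<open>1 - \<zeta> n\<close> divides both; if \<open>n\<close> is a
  power of a prime \<open>p\<close>, then \<open>p\<close> divides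
  \<open>(1 - \<zeta> n) ^ n\<close>. As the type \<open>'a\<close> of lattice elements is an
  arbitrary infinite one, existence is shown by copying the countable sets
  \<open>\<Lambda> n\<close> into it.\<close>

lemma eigenvalue_of_int_algebraic_int:
  fixes c :: complex and v :: "nat \<Rightarrow> complex" and A :: "nat \<Rightarrow> nat \<Rightarrow> int"
  assumes v: "i0 < N" "v i0 \<noteq> 0"
    and ev: "\<And>i. i < N \<Longrightarrow> c * v i = (\<Sum>j<N. of_int (A i j) * v j)"
  shows "algebraic_int c"
proof -
  define M where "M = mat N N (\<lambda>(i, j). A i j)"
  have M: "M \<in> carrier_mat N N" by (simp add: M_def)
  let ?M = "map_mat (of_int :: int \<Rightarrow> complex) M"
  have M': "?M \<in> carrier_mat N N" using M by simp
  have "eigenvector ?M (vec N v) c"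
    unfolding eigenvector_def
  proof (intro conjI)
    show "vec N v \<in> carrier_vec (dim_row ?M)" using M by simp
    show "vec N v \<noteq> 0\<^sub>v (dim_row ?M)" using v M by (auto simp: vec_eq_iff)
    show "?M *\<^sub>v vec N v = c \<cdot>\<^sub>v vec N v"
      by (rule eq_vecI) (auto simp: M_def scalar_prod_def ev lessThan_atLeast0 intro!: sum.cong)
  qed
  hence "eigenvalue ?M c" unfolding eigenvalue_def by blast
  hence "poly (char_poly ?M) c = 0" using eigenvalue_root_char_poly[OF M'] by simp
  hence "poly (map_poly of_int (char_poly M)) c = 0"
    using of_int_hom.char_poly_hom[OF M, where 'a = complex] by simp
  moreover have "Polynomial.lead_coeff (char_poly M) = 1" using degree_monic_char_poly[OF M] by simp
  ultimately show ?thesis unfolding algebraic_int_altdef_ipoly by blast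
qed

definition int_span :: "nat \<Rightarrow> (nat \<Rightarrow> complex) \<Rightarrow> complex set"
  where "int_span N v = {\<Sum>j<N. of_int (a j) * v j | a. True}"

lemma int_span_base: "i < N \<Longrightarrow> v i \<in> int_span N v"
  unfolding int_span_def
  by (rule CollectI, rule exI[of _ "\<lambda>j. if j = i then 1 else 0"]) (simp add: if_distrib if_distribR cong: if_cong)

lemma int_span_zero: "0 \<in> int_span N v"
  unfolding int_span_def by (rule CollectI, rule exI[of _ "\<lambda>j. 0"]) simp

lemma int_span_add: "x \<in> int_span N v \<Longrightarrow> y \<in> int_span N v \<Longrightarrow> x + y \<in> int_span N v"
  unfolding int_span_def
proof safe
  fix a b
  show "\<exists>c. (\<Sum>j<N. of_int (a j) * v j) + (\<Sum>j<N. of_int (b j) * v j) = (\<Sum>j<N. of_int (c j) * v j) \<and> True"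
    by (rule exI[of _ "\<lambda>j. a j + b j"]) (simp add: sum.distrib algebra_simps)
qed

lemma int_span_smult: "x \<in> int_span N v \<Longrightarrow> of_int k * x \<in> int_span N v"
  unfolding int_span_def
proof safe
  fix a
  show "\<exists>c. of_int k * (\<Sum>j<N. of_int (a j) * v j) = (\<Sum>j<N. of_int (c j) * v j) \<and> True"
    by (rule exI[of _ "\<lambda>j. k * a j"]) (simp add: sum_distrib_left algebra_simps)
qed

lemma int_span_sum: "(\<And>i. i \<in> I \<Longrightarrow> f i \<in> int_span N v) \<Longrightarrow> sum f I \<in> int_span N v"
  by (induction I rule: infinite_finite_induct) (auto intro: int_span_add int_span_zero)

text \<open>Multiplication by \<open>c\<close> acts on the generators through an integer matrix, of
  which \<open>c\<close> is an eigenvalue; the nonzero generator keeps the eigenvector from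
  vanishing.\<close>

lemma algebraic_int_if_int_span:
  assumes "i0 < N" "v i0 \<noteq> 0" and "\<And>i. i < N \<Longrightarrow> c * v i \<in> int_span N v"
  shows "algebraic_int c"
proof -
  have "\<forall>i. \<exists>a. i < N \<longrightarrow> c * v i = (\<Sum>j<N. of_int (a j) * v j)"
    using assms(3) unfolding int_span_def by blast
  then obtain A :: "nat \<Rightarrow> nat \<Rightarrow> int" where "\<And>i. i < N \<Longrightarrow> c * v i = (\<Sum>j<N. of_int (A i j) * v j)"
    by metis
  thus ?thesis using eigenvalue_of_int_algebraic_int[of i0 N v c A] assms by blast
qed

lemma algebraic_int_power_reduce:
  fixes x :: complex
  assumes "algebraic_int x"
  obtains m a where "m > 0" "x ^ m = (\<Sum>i<m. of_int (a i) * x ^ i)"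
proof -
  obtain p :: "int poly" where p: "poly (map_poly of_int p) x = 0" "Polynomial.lead_coeff p = 1"
    using assms unfolding algebraic_int_altdef_ipoly by blast
  let ?m = "Polynomial.degree p"
  have m: "?m > 0"
  proof (rule ccontr)
    assume "\<not> ?m > 0"
    then obtain k where "p = [:k:]" by (auto elim: degree_eq_zeroE)
    thus False using p by simp
  qed
  have "0 = (\<Sum>i\<le>?m. of_int (poly.coeff p i) * x ^ i)"
    using p(1) by (simp add: poly_altdef)
  also have "\<dots> = x ^ ?m + (\<Sum>i<?m. of_int (poly.coeff p i) * x ^ i)"
    using p(2) by (simp add: lessThan_Suc_atMost[symmetric] del: lessThan_Suc_atMost)
  finally have "x ^ ?m = - (\<Sum>i<?m. of_int (poly.coeff p i) * x ^ i)"
    by (metis eq_neg_iff_add_eq_0)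
  also have "\<dots> = (\<Sum>i<?m. of_int (- poly.coeff p i) * x ^ i)"
    unfolding sum_negf[symmetric] by (intro sum.cong refl) (simp only: of_int_minus minus_mult_left)
  finally have "x ^ ?m = (\<Sum>i<?m. of_int (- poly.coeff p i) * x ^ i)" .
  from that[of ?m "\<lambda>i. - poly.coeff p i", OF m this] show ?thesis .
qed

text \<open>The monomials \<open>x ^ i * y ^ j\<close> with \<open>i < m\<close> and
  \<open>j < n\<close> span a group that is stable under multiplication by \<open>x\<close> and by
  \<open>y\<close>, the monic equations reducing the powers that overflow.\<close>

lemma
  fixes x y :: complex
  assumes "algebraic_int x" "algebraic_int y"
  shows algebraic_int_add: "algebraic_int (x + y)"
    and algebraic_int_mult: "algebraic_int (x * y)"
proof -
  obtain m a where m: "m > 0" and a: "x ^ m = (\<Sum>i<m. of_int (a i) * x ^ i)"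
    using algebraic_int_power_reduce[OF assms(1)] by blast
  obtain n b where n: "n > 0" and b: "y ^ n = (\<Sum>i<n. of_int (b i) * y ^ i)"
    using algebraic_int_power_reduce[OF assms(2)] by blast
  \<comment> \<open>The pair of exponents \<open>(i, j)\<close> is numbered
    \<open>i * n + j\<close>, so that one index below \<open>m * n\<close> runs through all
    monomials.\<close>
  define v where "v k = x ^ (k div n) * y ^ (k mod n)" for k
  let ?S = "int_span (m * n) v"
  have mono: "x ^ i * y ^ j \<in> ?S" if "i < m" "j < n" for i j
  proof -
    have "i * n + j < m * n"
    proof -
      have "i * n + j < Suc i * n" using that by simp
      also have "\<dots> \<le> m * n" using that by (intro mult_le_mono1) simp
      finally show ?thesis .
    qed
    from int_span_base[OF this, of v] show ?thesis using that by (simp add: v_def)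
  qed
  have monox: "x ^ Suc i * y ^ j \<in> ?S" if "i < m" "j < n" for i j
  proof (cases "Suc i < m")
    case False
    hence "Suc i = m" using that by simp
    have "x ^ m * y ^ j = (\<Sum>i<m. of_int (a i) * (x ^ i * y ^ j))"
      by (simp add: a sum_distrib_right mult.assoc)
    also have "\<dots> \<in> ?S" using that by (intro int_span_sum int_span_smult mono) auto
    finally show ?thesis using \<open>Suc i = m\<close> by simp
  qed (use that mono in blast)
  have monoy: "x ^ i * y ^ Suc j \<in> ?S" if "i < m" "j < n" for i j
  proof (cases "Suc j < n")
    case False
    hence "Suc j = n" using that by simp
    have "x ^ i * y ^ n = (\<Sum>j<n. of_int (b j) * (x ^ i * y ^ j))"
      by (simp add: b sum_distrib_left mult_ac)
    also have "\<dots> \<in> ?S" using that by (intro int_span_sum int_span_smult mono) auto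
    finally show ?thesis using \<open>Suc j = n\<close> by simp
  qed (use that mono in blast)
  have bounds: "k div n < m" "k mod n < n" if "k < m * n" for k
    using that n by (auto simp: less_mult_imp_div_less)
  have x: "x * v k \<in> ?S" and y: "y * v k \<in> ?S" if "k < m * n" for k
    using monox[OF bounds[OF that]] monoy[OF bounds[OF that]] by (simp_all add: v_def mult_ac)
  \<comment> \<open>The product \<open>x * y\<close> applies \<open>x\<close> to
    \<open>y * v k\<close>, which is no longer a generator; hence stability of the whole span is
    needed.\<close>
  have x': "x * s \<in> ?S" if "s \<in> ?S" for s
  proof -
    obtain c where "s = (\<Sum>j<m * n. of_int (c j) * v j)" using \<open>s \<in> ?S\<close> by (auto simp: int_span_def)
    hence "x * s = (\<Sum>j<m * n. of_int (c j) * (x * v j))" by (simp add: sum_distrib_left mult_ac)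
    thus ?thesis using x by (auto intro!: int_span_sum int_span_smult)
  qed
  have v0: "0 < m * n" "v 0 \<noteq> 0" using m n by (auto simp: v_def)
  show "algebraic_int (x + y)"
    by (rule algebraic_int_if_int_span[where v = v, OF v0]) (auto simp: distrib_right intro!: int_span_add x y)
  show "algebraic_int (x * y)"
    by (rule algebraic_int_if_int_span[where v = v, OF v0]) (auto simp: mult.assoc intro!: x' y)
qed

lemma algebraic_int_diff:
  fixes x y :: complex
  shows "algebraic_int x \<Longrightarrow> algebraic_int y \<Longrightarrow> algebraic_int (x - y)"
  using algebraic_int_add[of x "- y"] by simp

lemma algebraic_int_power: "algebraic_int (x :: complex) \<Longrightarrow> algebraic_int (x ^ n)"
  by (induction n) (auto intro: algebraic_int_mult)

lemma algebraic_int_sum: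
  "(\<And>i. i \<in> I \<Longrightarrow> algebraic_int (f i :: complex)) \<Longrightarrow> algebraic_int (sum f I)"
  by (induction I rule: infinite_finite_induct) (auto intro: algebraic_int_add)

lemma algebraic_int_unit_root:
  assumes "n > 0" "(z :: complex) ^ n = 1"
  shows "algebraic_int z"
proof -
  define p :: "complex poly" where "p = Polynomial.monom 1 n + (- 1)"
  have "Polynomial.degree p = n"
    using assms unfolding p_def by (subst degree_add_eq_left) (auto simp: degree_monom_eq)
  moreover have "poly p z = 0" using assms by (simp add: p_def poly_monom)
  ultimately show ?thesis
    using assms by (intro algebraic_int.intros[of p]) (auto simp: p_def coeff_1)
qed

section \<open>Kronecker's theorem\<close>

abbreviation rat_poly :: "rat poly \<Rightarrow> complex poly" where "rat_poly \<equiv> map_poly of_rat"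

text \<open>For algebraic \<open>c\<close> these \<open>z\<close> are the roots of the minimal
  polynomial of \<open>c\<close> over the rationals. Integer polynomials avoid choosing that
  polynomial and say directly that \<open>f(c) \<mapsto> f(z)\<close> is well defined on
  \<open>Z[c]\<close>.\<close>

definition conjugate_of :: "complex \<Rightarrow> complex \<Rightarrow> bool"
  where "conjugate_of c z \<longleftrightarrow>
    (\<forall>f :: int poly. poly (map_poly of_int f) c = 0 \<longrightarrow> poly (map_poly of_int f) z = 0)"

lemma conjugate_of_refl: "conjugate_of c c"
  by (simp add: conjugate_of_def)

lemma conjugate_of_algebraic_int: "conjugate_of c z \<Longrightarrow> algebraic_int c \<Longrightarrow> algebraic_int z"
  unfolding algebraic_int_altdef_ipoly conjugate_of_def by blast

interpretation rat_poly_hom: map_poly_idom_hom "of_rat :: rat \<Rightarrow> complex" ..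

lemma rat_poly_of_int_poly: "rat_poly (map_poly of_int f) = map_poly of_int f"
  by (rule poly_eqI) (simp add: coeff_map_poly)

text \<open>Take an annihilating polynomial of least degree: the remainder of any other one modulo
  it still annihilates \<open>c\<close> and is therefore zero.\<close>

lemma minimal_rat_poly:
  fixes c :: complex
  assumes "algebraic_int c"
  obtains q :: "rat poly" where "Polynomial.lead_coeff q = 1" "poly (rat_poly q) c = 0"
    "\<And>h. poly (rat_poly h) c = 0 \<Longrightarrow> q dvd h"
proof -
  define P where "P q \<longleftrightarrow> q \<noteq> 0 \<and> poly (rat_poly q) c = 0" for q
  obtain p :: "int poly" where p: "poly (map_poly of_int p) c = 0" "Polynomial.lead_coeff p = 1"
    using assms unfolding algebraic_int_altdef_ipoly by blast
  have "P (map_poly of_int p)" using p by (auto simp: P_def rat_poly_of_int_poly)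
  then obtain q where q: "P q" "\<And>h. P h \<Longrightarrow> Polynomial.degree q \<le> Polynomial.degree h"
    using ex_has_least_nat[of P _ Polynomial.degree] by blast
  have dvd: "q dvd h" if "poly (rat_poly h) c = 0" for h
  proof -
    have "rat_poly h = rat_poly q * rat_poly (h div q) + rat_poly (h mod q)"
      by (metis mult_div_mod_eq rat_poly_hom.hom_add rat_poly_hom.hom_mult)
    hence "poly (rat_poly (h mod q)) c = 0" using q(1) that by (simp add: P_def)
    hence "h mod q = 0 \<or> P (h mod q)" by (simp add: P_def)
    moreover have "h mod q = 0 \<or> Polynomial.degree (h mod q) < Polynomial.degree q"
      using degree_mod_less[of q h] q(1) by (auto simp: P_def)
    ultimately have "h mod q = 0" using q(2) leD by blast
    thus ?thesis by (simp add: dvd_eq_mod_eq_0)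
  qed
  let ?q = "Polynomial.smult (inverse (Polynomial.lead_coeff q)) q"
  have "Polynomial.lead_coeff ?q = 1" using q(1) by (simp add: P_def)
  moreover have "poly (rat_poly ?q) c = 0" using q(1) by (simp add: P_def of_rat_hom.map_poly_hom_smult)
  moreover have "?q dvd h" if "poly (rat_poly h) c = 0" for h
    using dvd[OF that] q(1) by (simp add: P_def smult_dvd_iff)
  ultimately show ?thesis using that by blast
qed

lemma coeff_prod_linear_algebraic_int:
  assumes "finite S" "\<And>z. z \<in> S \<Longrightarrow> algebraic_int (z :: complex)"
  shows "algebraic_int (poly.coeff (\<Prod>z\<in>S. [:- z, 1:]) i)"
  using assms
proof (induction S arbitrary: i)
  case (insert z S)
  have "algebraic_int (poly.coeff ([:- z, 1:] * (\<Prod>z\<in>S. [:- z, 1:])) i)"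
    using insert by (cases i) (auto intro!: algebraic_int_diff algebraic_int_mult)
  thus ?case using insert by simp
qed (auto simp: coeff_1)

text \<open>The rational minimal polynomial is the product of linear factors over the conjugates of
  \<open>c\<close>, which are algebraic integers. Its coefficients are thus rational algebraic
  integers, hence integers. Simplicity of the roots makes them usable as interpolation
  nodes.\<close>

lemma minimal_int_poly:
  fixes c :: complex
  assumes "algebraic_int c"
  obtains p :: "int poly" where "Polynomial.lead_coeff p = 1" "rsquarefree (map_poly of_int p :: complex poly)"
    "\<And>z. poly (map_poly of_int p) z = 0 \<Longrightarrow> conjugate_of c z"
    "poly (map_poly of_int p) c = 0"
proof -
  obtain q where q: "Polynomial.lead_coeff q = 1" "poly (rat_poly q) c = 0"
    and q_dvd: "\<And>h. poly (rat_poly h) c = 0 \<Longrightarrow> q dvd h"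
    using minimal_rat_poly[OF assms] by blast
  have q0: "q \<noteq> 0" using q(1) by auto
  have conj: "conjugate_of c z" if "poly (rat_poly q) z = 0" for z
    unfolding conjugate_of_def
  proof safe
    fix f :: "int poly" assume "poly (map_poly of_int f) c = 0"
    hence "q dvd map_poly of_int f" by (intro q_dvd) (simp add: rat_poly_of_int_poly)
    then obtain k where "map_poly of_int f = q * k" by blast
    hence "rat_poly (map_poly of_int f) = rat_poly q * rat_poly k" by (simp add: rat_poly_hom.hom_mult)
    thus "poly (map_poly of_int f) z = 0" using that by (simp add: rat_poly_of_int_poly)
  qed
  have int: "algebraic_int z" if "poly (rat_poly q) z = 0" for z
    using conjugate_of_algebraic_int[OF conj[OF that] assms] .
  have pderiv: "pderiv (rat_poly q) = rat_poly (pderiv q)"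
    by (rule poly_eqI) (simp add: coeff_pderiv coeff_map_poly of_rat_mult of_rat_add)
  have sqf: "rsquarefree (rat_poly q)"
    unfolding rsquarefree_roots
  proof safe
    \<comment> \<open>The minimal polynomial \<open>g\<close> of a double root \<open>z\<close>
      divides \<open>q\<close> and its derivative. If \<open>c\<close> is a root of
      \<open>g\<close>, then \<open>q\<close> divides its own derivative, which has smaller degree;
      otherwise \<open>q\<close> divides the cofactor \<open>k\<close>, so \<open>g\<close> is
      constant.\<close>
    fix z assume z: "poly (rat_poly q) z = 0" "poly (pderiv (rat_poly q)) z = 0"
    obtain g where g: "Polynomial.lead_coeff g = 1" "poly (rat_poly g) z = 0"
      and g_dvd: "\<And>h. poly (rat_poly h) z = 0 \<Longrightarrow> g dvd h"
      using minimal_rat_poly[OF int[OF z(1)]] by blast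
    obtain k where k: "q = g * k" using g_dvd z(1) by blast
    obtain k' where k': "pderiv q = g * k'" using g_dvd z(2) pderiv by force
    have "poly (rat_poly g) c = 0 \<or> poly (rat_poly k) c = 0"
      using q(2) by (simp add: k rat_poly_hom.hom_mult)
    thus False
    proof
      assume "poly (rat_poly g) c = 0"
      hence "poly (rat_poly (pderiv q)) c = 0" by (simp add: k' rat_poly_hom.hom_mult)
      hence dvd: "q dvd pderiv q" by (rule q_dvd)
      have "Polynomial.degree q \<noteq> 0"
      proof
        assume "Polynomial.degree q = 0"
        then obtain a where "q = [:a:]" by (rule degree_eq_zeroE)
        thus False using q by simp
      qed
      thus False using dvd not_dvd_pderiv by blast
    next
      assume "poly (rat_poly k) c = 0"
      hence "q dvd k" by (rule q_dvd)
      have nz: "g \<noteq> 0" "k \<noteq> 0" using q0 k by auto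
      have "Polynomial.degree q \<le> Polynomial.degree k" using \<open>q dvd k\<close> nz by (intro dvd_imp_degree_le)
      hence "Polynomial.degree g = 0" using nz k by (simp add: degree_mult_eq)
      then obtain a where "g = [:a:]" by (rule degree_eq_zeroE)
      thus False using g by simp
    qed
  qed
  have lc: "Polynomial.lead_coeff (rat_poly q) = 1" using q(1) by simp
  have fin: "finite {z. poly (rat_poly q) z = 0}" using q0 by (intro poly_roots_finite) auto
  have prod_eq: "(\<Prod>z | poly (rat_poly q) z = 0. [:- z, 1:]) = rat_poly q"
    using complex_poly_decompose_rsquarefree[OF sqf] lc by simp
  have "algebraic_int (poly.coeff (rat_poly q) i)" for i
    using coeff_prod_linear_algebraic_int[OF fin, of i] int unfolding prod_eq by blast
  hence "poly.coeff (rat_poly q) i \<in> \<int>" for i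
    by (rule rational_algebraic_int_is_int) simp
  hence qint: "poly.coeff q i \<in> \<int>" for i
    by (simp add: Ints_def) (metis of_rat_eq_iff of_rat_of_int_eq rangeE rangeI)
  define p where "p = map_poly floor q"
  have qp: "q = map_poly of_int p"
    using qint by (intro poly_eqI) (simp add: p_def coeff_map_poly of_int_floor)
  hence eq: "rat_poly q = map_poly of_int p" by (simp add: rat_poly_of_int_poly)
  show ?thesis
  proof (rule that[of p])
    show "Polynomial.lead_coeff p = 1" using q(1) unfolding qp by simp
    show "rsquarefree (map_poly of_int p :: complex poly)" using sqf eq by simp
    show "poly (map_poly of_int p) c = 0" using q(2) eq by simp
    show "conjugate_of c z" if "poly (map_poly of_int p) z = 0" for z
      using conj that eq by simp
  qed
qed

section \<open>Bounded conjugates and the pigeonhole principle\<close>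

lemma lagrange_interpolation:
  fixes r :: "complex poly"
  assumes S: "finite S" "Polynomial.degree r < card S"
  shows "r = (\<Sum>z\<in>S. Polynomial.smult (poly r z)
    (Polynomial.smult (inverse (\<Prod>w\<in>S - {z}. z - w)) (\<Prod>w\<in>S - {z}. [:- w, 1:])))"
proof (rule poly_eqI_degree[of S])
  let ?l = "\<lambda>z. Polynomial.smult (inverse (\<Prod>w\<in>S - {z}. z - w)) (\<Prod>w\<in>S - {z}. [:- w, 1:])"
  have deg: "Polynomial.degree (?l z) < card S" if "z \<in> S" for z
  proof -
    have "Polynomial.degree (\<Prod>w\<in>S - {z}. [:- w, 1:]) \<le> (\<Sum>w\<in>S - {z}. 1)"
      by (rule order.trans[OF degree_prod_sum_le]) (auto simp: S)
    also have "\<dots> < card S" using S that by (simp add: card_gt_0_iff)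
    finally show ?thesis using degree_smult_le le_less_trans by blast
  qed
  show "card S > Polynomial.degree r" by (rule S)
  show "card S > Polynomial.degree (\<Sum>z\<in>S. Polynomial.smult (poly r z) (?l z))"
  proof (rule degree_sum_less)
    show "0 < card S" using S(2) by simp
    show "Polynomial.degree (Polynomial.smult (poly r z) (?l z)) < card S" if "z \<in> S" for z
      using deg[OF that] degree_smult_le le_less_trans by blast
  qed
  fix x assume x: "x \<in> S"
  have "poly (?l z) x = (if z = x then 1 else 0)" if "z \<in> S" for z
  proof (cases "z = x")
    case True
    have "(\<Prod>w\<in>S - {x}. x - w) \<noteq> 0" using S by (auto simp: prod_zero_iff)
    thus ?thesis using True by (simp add: poly_prod)
  next
    case False
    hence "(\<Prod>w\<in>S - {z}. x - w) = 0" using x S by (auto simp: prod_zero_iff)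
    thus ?thesis using False by (simp add: poly_prod)
  qed
  hence "(\<Sum>z\<in>S. poly r z * poly (?l z) x) = (\<Sum>z\<in>S. if z = x then poly r z else 0)"
    by (intro sum.cong) auto
  also have "\<dots> = poly r x" using x S by simp
  finally show "poly r x = poly (\<Sum>z\<in>S. Polynomial.smult (poly r z) (?l z)) x"
    by (simp add: poly_sum mult.assoc)
qed

lemma finite_bounded_int_polys:
  "finite {q :: int poly. (q = 0 \<or> Polynomial.degree q < d) \<and> (\<forall>i<d. \<bar>poly.coeff q i\<bar> \<le> N)}" (is "finite ?A")
proof (rule inj_on_finite)
  show "finite (PiE {..<d} (\<lambda>_. {-N..N}))" by (intro finite_PiE) auto
  let ?f = "\<lambda>q. restrict (poly.coeff q) {..<d}"
  show "?f ` ?A \<subseteq> PiE {..<d} (\<lambda>_. {-N..N})"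
    unfolding image_subset_iff restrict_PiE_iff atLeastAtMost_iff
    by (auto simp: abs_le_iff)
  show "inj_on ?f ?A"
  proof (rule inj_onI, rule poly_eqI)
    fix p q i assume pq: "p \<in> ?A" "q \<in> ?A" "?f p = ?f q"
    show "poly.coeff p i = poly.coeff q i"
    proof (cases "i < d")
      case True thus ?thesis using fun_cong[OF pq(3), of i] by simp
    next
      case False
      hence "poly.coeff p i = 0" "poly.coeff q i = 0" using pq(1,2) by (auto intro: coeff_eq_0)
      thus ?thesis by simp
    qed
  qed
qed

text \<open>Reducing modulo the minimal polynomial and interpolating at the conjugates bounds the
  integer coefficients of the remainders.\<close>

lemma bounded_conjugates_repeat:
  fixes c :: complex and f :: "nat \<Rightarrow> int poly"
  assumes "algebraic_int c"
    and B: "\<And>n z. conjugate_of c z \<Longrightarrow> norm (poly (map_poly of_int (f n)) z) \<le> B"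
  obtains m n where "m < n" "poly (map_poly of_int (f m)) c = poly (map_poly of_int (f n)) c"
proof -
  obtain p :: "int poly" where lc: "Polynomial.lead_coeff p = 1"
    and sqf: "rsquarefree (map_poly of_int p :: complex poly)"
    and conj: "\<And>z. poly (map_poly of_int p) z = 0 \<Longrightarrow> conjugate_of c z"
    and pc: "poly (map_poly of_int p) c = 0"
    using minimal_int_poly[OF assms(1)] by blast
  have p0: "p \<noteq> 0" using lc by auto
  let ?P = "map_poly of_int p :: complex poly"
  define S where "S = {z. poly ?P z = 0}"
  have S: "finite S" unfolding S_def using p0 by (intro poly_roots_finite) simp
  define d where "d = Polynomial.degree p"
  have "(\<Prod>z\<in>S. [:- z, 1:]) = ?P"
    using complex_poly_decompose_rsquarefree[OF sqf] lc by (simp add: S_def)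
  moreover have "Polynomial.degree (\<Prod>z\<in>S. [:- z, 1:]) = (\<Sum>z\<in>S. Polynomial.degree [:- z, 1:])"
    by (rule degree_prod_sum_eq) auto
  ultimately have d: "card S = d" by (simp add: d_def)
  have "c \<in> S" using pc by (simp add: S_def)
  hence d_pos: "d > 0" using S d card_gt_0_iff by fastforce
  \<comment> \<open>As \<open>p\<close> is monic, the pseudo-remainder is a genuine remainder: it
    has integer coefficients and the same values at the roots of \<open>p\<close>.\<close>
  define r where "r n = pseudo_mod (f n) p" for n
  have r_deg: "r n = 0 \<or> Polynomial.degree (r n) < d" for n
    unfolding r_def d_def by (rule pseudo_mod(2)[OF p0])
  have r_val: "poly (map_poly of_int (r n)) z = (poly (map_poly of_int (f n)) z :: complex)" if "z \<in> S" for n z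
  proof -
    obtain q where "pseudo_divmod (f n) p = (q, r n)"
      by (cases "pseudo_divmod (f n) p") (simp add: r_def pseudo_mod_def)
    from pseudo_divmod(1)[OF p0 this] have "f n = p * q + r n" using lc by simp
    hence "map_poly of_int (f n) = ?P * map_poly of_int q + map_poly of_int (r n)"
      by (simp add: of_int_poly_hom.hom_add of_int_poly_hom.hom_mult)
    thus ?thesis using that by (simp add: S_def)
  qed
  define l where "l z = Polynomial.smult (inverse (\<Prod>w\<in>S - {z}. z - w)) (\<Prod>w\<in>S - {z}. [:- w, 1:])" for z
  \<comment> \<open>Summing over all \<open>i\<close> gives one bound that serves every
    coefficient.\<close>
  define N where "N = (\<Sum>i<d. \<bar>\<lceil>\<Sum>z\<in>S. B * norm (poly.coeff (l z) i)\<rceil>\<bar>)"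
  have bound: "\<bar>poly.coeff (r n) i\<bar> \<le> N" if "i < d" for n i
  proof -
    let ?R = "map_poly of_int (r n) :: complex poly"
    have "Polynomial.degree ?R < card S" using r_deg[of n] d d_pos by auto
    from lagrange_interpolation[OF S this, folded l_def]
    have "poly.coeff ?R i = poly.coeff (\<Sum>z\<in>S. Polynomial.smult (poly ?R z) (l z)) i"
      by (rule arg_cong)
    also have "\<dots> = (\<Sum>z\<in>S. poly ?R z * poly.coeff (l z) i)" by (simp only: coeff_sum coeff_smult)
    also have "norm \<dots> \<le> (\<Sum>z\<in>S. norm (poly ?R z * poly.coeff (l z) i))" by (rule norm_sum)
    also have "\<dots> \<le> (\<Sum>z\<in>S. B * norm (poly.coeff (l z) i))"
      using B conj by (intro sum_mono) (auto simp: norm_mult r_val S_def intro!: mult_right_mono)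
    finally have "real_of_int \<bar>poly.coeff (r n) i\<bar> \<le> (\<Sum>z\<in>S. B * norm (poly.coeff (l z) i))" by simp
    hence "\<bar>poly.coeff (r n) i\<bar> \<le> \<bar>\<lceil>\<Sum>z\<in>S. B * norm (poly.coeff (l z) i)\<rceil>\<bar>" by linarith
    moreover have "\<bar>\<lceil>\<Sum>z\<in>S. B * norm (poly.coeff (l z) i)\<rceil>\<bar> \<le> N" unfolding N_def
      using that by (intro member_le_sum) auto
    ultimately show ?thesis by linarith
  qed
  have "range r \<subseteq> {q. (q = 0 \<or> Polynomial.degree q < d) \<and> (\<forall>i<d. \<bar>poly.coeff q i\<bar> \<le> N)}"
    using r_deg bound by blast
  hence "finite (range r)" using finite_bounded_int_polys finite_subset by blast
  hence "\<not> inj r" using finite_imageD infinite_UNIV_nat by blast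
  then obtain m n where "m \<noteq> n" "r m = r n" by (auto simp: inj_on_def)
  moreover have "poly (map_poly of_int (r n)) c = (poly (map_poly of_int (f n)) c :: complex)" for n
    using r_val \<open>c \<in> S\<close> by blast
  ultimately show ?thesis using that by (metis nat_neq_iff)
qed

text \<open>The powers of \<open>c\<close> have bounded conjugates, so two of them coincide; but the
  moduli of the powers of a nonzero \<open>c\<close> of modulus below 1 strictly decrease.\<close>

lemma small_conjugates_imp_zero:
  fixes c :: complex
  assumes "algebraic_int c" "\<And>z. conjugate_of c z \<Longrightarrow> norm z < 1"
  shows "c = 0"
proof (rule ccontr)
  assume "c \<noteq> 0"
  have bound: "norm (poly (map_poly of_int (Polynomial.monom 1 n)) z) \<le> 1" if "conjugate_of c z" for n z
    using assms(2)[OF that] by (simp add: map_poly_monom poly_monom norm_power power_le_one)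
  obtain m n where mn: "m < n" "poly (map_poly of_int (Polynomial.monom 1 m)) c = poly (map_poly of_int (Polynomial.monom 1 n)) c"
    by (rule bounded_conjugates_repeat[of c "\<lambda>n. Polynomial.monom 1 n" 1, OF assms(1)]) (use bound in auto)
  hence "norm c ^ m = norm c ^ n" by (simp add: map_poly_monom poly_monom flip: norm_power)
  moreover have "norm c ^ n < norm c ^ m"
    using mn(1) assms(2)[OF conjugate_of_refl] \<open>c \<noteq> 0\<close> by (intro power_strict_decreasing) auto
  ultimately show False by simp
qed

text \<open>These are \<open>2 T_n(X / 2)\<close> for the Chebyshev polynomials \<open>T_n\<close>;
  in this normalisation the coefficients are integers, and \<open>w + 1/w\<close> is sent to
  \<open>w^n + 1/w^n\<close>.\<close>

fun cheb :: "nat \<Rightarrow> int poly" where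
  "cheb 0 = [:2:]"
| "cheb (Suc 0) = [:0, 1:]"
| "cheb (Suc (Suc n)) = [:0, 1:] * cheb (Suc n) - cheb n"

lemma poly_cheb_sum_inverse:
  fixes w :: complex
  assumes "w \<noteq> 0"
  shows "poly (map_poly of_int (cheb n)) (w + inverse w) = w ^ n + inverse w ^ n"
proof (induction n rule: cheb.induct)
  case (3 n)
  have "map_poly of_int (cheb (Suc (Suc n))) = [:0, 1:] * map_poly of_int (cheb (Suc n)) - (map_poly of_int (cheb n) :: complex poly)"
    by (simp only: cheb.simps of_int_poly_hom.hom_minus of_int_poly_hom.hom_mult) (simp add: map_poly_pCons)
  hence "poly (map_poly of_int (cheb (Suc (Suc n)))) (w + inverse w) =
      (w + inverse w) * (w ^ Suc n + inverse w ^ Suc n) - (w ^ n + inverse w ^ n)"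
    using 3 by (simp del: cheb.simps power_Suc)
  also have "\<dots> = w ^ Suc (Suc n) + inverse w ^ Suc (Suc n)"
  proof -
    have "(w + v) * (w * a + v * b) - (a + b) = w * (w * a) + v * (v * b)" if "w * v = 1" for v a b :: complex
    proof -
      have "(w + v) * (w * a + v * b) = w * (w * a) + (w * v) * a + (w * v) * b + v * (v * b)"
        by (simp add: algebra_simps)
      thus ?thesis using that by simp
    qed
    thus ?thesis using assms by simp
  qed
  finally show ?case .
qed (simp_all add: map_poly_pCons)

lemma cis_power_sum_inverse: "cis t ^ n + inverse (cis t) ^ n = complex_of_real (2 * cos (real n * t))"
  unfolding cis_inverse Complex.DeMoivre
  by (simp only: complex_eq_iff plus_complex.simps cis.simps Re_complex_of_real Im_complex_of_real
      mult_minus_right cos_minus sin_minus) simp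

lemma poly_cheb: "poly (map_poly of_int (cheb n)) (complex_of_real (2 * cos t)) = of_real (2 * cos (real n * t))"
  using poly_cheb_sum_inverse[of "cis t" n] cis_power_sum_inverse[of t n] cis_power_sum_inverse[of t 1] by simp

text \<open>Write \<open>c = 2 cos \<theta>\<close>. The numbers \<open>2 cos (n \<theta>)\<close>
  lie in \<open>Z[c]\<close>, and all their conjugates lie in \<open>[-2, 2]\<close>, so two of them
  coincide and \<open>\<theta>\<close> is a rational multiple of \<open>pi\<close>.\<close>

theorem kronecker:
  fixes c :: real
  assumes "algebraic_int c"
    and real: "\<And>z. conjugate_of (of_real c) z \<Longrightarrow> \<exists>t. z = of_real t \<and> \<bar>t\<bar> \<le> 2"
  obtains w :: complex and N where "N > 0" "w ^ N = 1" "w + inverse w = of_real c"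
proof -
  have cheb_bound: "norm (poly (map_poly of_int (cheb n)) z) \<le> 2" if conj: "conjugate_of (of_real c) z" for n z
  proof -
    obtain t where t: "z = of_real t" "\<bar>t\<bar> \<le> 2" using real[OF conj] by blast
    hence "z = of_real (2 * cos (arccos (t / 2)))" by (auto simp: cos_arccos_abs)
    hence "poly (map_poly of_int (cheb n)) z = of_real (2 * cos (real n * arccos (t / 2)))"
      using poly_cheb by metis
    also have "norm \<dots> \<le> 2" by (simp only: norm_of_real) (simp add: abs_mult)
    finally show ?thesis .
  qed
  define \<theta> where "\<theta> = arccos (c / 2)"
  have "\<bar>c\<bar> \<le> 2" using real[OF conjugate_of_refl] by auto
  hence c: "c = 2 * cos \<theta>" by (auto simp: \<theta>_def cos_arccos_abs)
  have alg: "algebraic_int (complex_of_real c)" using assms(1) by blast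
  obtain m n where mn: "m < n" "poly (map_poly of_int (cheb m)) (of_real c :: complex) = poly (map_poly of_int (cheb n)) (of_real c)"
    by (rule bounded_conjugates_repeat[of "complex_of_real c" cheb 2, OF alg]) (use cheb_bound in auto)
  have eq: "2 * cos (real m * \<theta>) = 2 * cos (real n * \<theta>)"
    using mn(2) unfolding c poly_cheb of_real_eq_iff .
  define w where "w = cis \<theta>"
  have w0: "w \<noteq> 0" by (simp add: w_def)
  have wp: "w ^ k + inverse w ^ k = of_real (2 * cos (real k * \<theta>))" for k
    unfolding w_def by (rule cis_power_sum_inverse)
  have "w ^ m + inverse w ^ m = w ^ n + inverse w ^ n" by (simp only: wp eq)
  \<comment> \<open>Equality of \<open>a + 1/a\<close> and \<open>b + 1/b\<close> forces
    \<open>b = a\<close> or \<open>b = 1/a\<close>; applied to powers of \<open>w\<close> this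
    yields the order \<open>n - m\<close> or \<open>n + m\<close>.\<close>
  moreover have "(b - a) * (b * a - 1) = 0" if "a \<noteq> 0" "b \<noteq> 0" "a + inverse a = b + inverse b" for a b :: complex
  proof -
    have "a * b * (a + inverse a) = a * b * (b + inverse b)" using that by simp
    moreover have "a * b * inverse a = b" "a * b * inverse b = a" using that(1,2) by simp_all
    ultimately have "a * b * a + b = a * b * b + a" by (simp only: distrib_left)
    thus ?thesis by (simp add: algebra_simps)
  qed
  ultimately have "(w ^ n - w ^ m) * (w ^ n * w ^ m - 1) = 0"
    using w0 by (metis power_inverse power_not_zero)
  hence "(w ^ n - w ^ m) * (w ^ (n + m) - 1) = 0" by (simp add: power_add)
  hence "w ^ n = w ^ m \<or> w ^ (n + m) = 1" by simp
  moreover have "w ^ n = w ^ m * w ^ (n - m)" using mn(1) by (simp flip: power_add)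
  ultimately have "w ^ (n - m) = 1 \<or> w ^ (n + m) = 1" using w0 by auto
  moreover have "w + inverse w = of_real c" using wp[of 1] by (simp add: c)
  moreover have "n - m > 0" "n + m > 0" using mn(1) by auto
  ultimately show ?thesis using that[of "n - m" w] that[of "n + m" w] by blast
qed

section \<open>Extension of embeddings\<close>

text \<open>Instantiated both with \<open>K\<close> and with \<open>\<O>\<close>, so that spans over
  the field and over its integers share their lemmas.\<close>

locale real_subring =
  fixes A :: "real set"
  assumes A_one: "1 \<in> A" and A_add: "x \<in> A \<Longrightarrow> y \<in> A \<Longrightarrow> x + y \<in> A"
    and A_minus: "x \<in> A \<Longrightarrow> - x \<in> A" and A_mult: "x \<in> A \<Longrightarrow> y \<in> A \<Longrightarrow> x * y \<in> A"
begin

lemma A_zero: "0 \<in> A" using A_add[OF A_one A_minus[OF A_one]] by simp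
lemma A_power: "x \<in> A \<Longrightarrow> x ^ n \<in> A" by (induction n) (auto intro: A_one A_mult)
lemma A_sum: "(\<And>i. i \<in> I \<Longrightarrow> f i \<in> A) \<Longrightarrow> sum f I \<in> A"
  by (induction I rule: infinite_finite_induct) (auto intro: A_zero A_add)
lemma A_of_nat: "of_nat n \<in> A" by (induction n) (auto intro: A_zero A_one A_add)
lemma A_of_int: "of_int n \<in> A"
  using A_of_nat A_minus[OF A_of_nat] by (cases n rule: int_cases2) auto
lemma A_int_poly: "c \<in> A \<Longrightarrow> poly (map_poly of_int f) c \<in> A"
  by (induction f) (auto simp: map_poly_pCons intro!: A_zero A_add A_of_int A_mult)

end

lemma embeddings_iff:
  "\<sigma> \<in> embeddings K \<longleftrightarrow>
    (\<forall>x\<in>K. \<forall>y\<in>K. \<sigma> (x * y) = \<sigma> x * \<sigma> y \<and> \<sigma> (x + y) = \<sigma> x + \<sigma> y) \<and> \<sigma> 1 = 1"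
  by (auto simp: embeddings_def Ring.ring_hom_def ring_of_type_algebra_def)

text \<open>The graph of a homomorphism from a subring of \<open>K\<close> to the complex numbers.
  Closure under differences reduces single-valuedness to the value at 0. Working with graphs turns
  extension into inclusion and makes the union of a chain the obvious upper bound.\<close>

definition partial_embedding :: "real set \<Rightarrow> (real \<times> complex) set \<Rightarrow> bool"
  where "partial_embedding K G \<longleftrightarrow> fst ` G \<subseteq> K \<and> (1, 1) \<in> G \<and>
    (\<forall>a u b v. (a, u) \<in> G \<longrightarrow> (b, v) \<in> G \<longrightarrow> (a - b, u - v) \<in> G \<and> (a * b, u * v) \<in> G) \<and>
    (\<forall>u. (0, u) \<in> G \<longrightarrow> u = 0)"

locale embedding_graph = real_subring K for K +
  fixes G :: "(real \<times> complex) set"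
  assumes pe: "partial_embedding K G" and K_alg: "x \<in> K \<Longrightarrow> Polynomial.algebraic x"
begin

lemma G_K: "(a, u) \<in> G \<Longrightarrow> a \<in> K" using pe by (force simp: partial_embedding_def)
lemma G_one: "(1, 1) \<in> G" using pe by (simp add: partial_embedding_def)
lemma G_diff: "(a, u) \<in> G \<Longrightarrow> (b, v) \<in> G \<Longrightarrow> (a - b, u - v) \<in> G" using pe by (simp add: partial_embedding_def)
lemma G_mult: "(a, u) \<in> G \<Longrightarrow> (b, v) \<in> G \<Longrightarrow> (a * b, u * v) \<in> G" using pe by (simp add: partial_embedding_def)
lemma G_unique0: "(0, u) \<in> G \<Longrightarrow> u = 0" using pe by (simp add: partial_embedding_def)
lemma G_zero: "(0, 0) \<in> G" using G_diff[OF G_one G_one] by simp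
lemma G_add: "(a, u) \<in> G \<Longrightarrow> (b, v) \<in> G \<Longrightarrow> (a + b, u + v) \<in> G"
  using G_diff[of a u "0 - b" "0 - v"] G_diff[OF G_zero] by simp
lemma G_unique: "(a, u) \<in> G \<Longrightarrow> (a, v) \<in> G \<Longrightarrow> u = v"
  using G_diff[of a u a v] G_unique0[of "u - v"] by simp
lemma G_sum: "(\<And>i. i \<in> I \<Longrightarrow> (f i, g i) \<in> G) \<Longrightarrow> (sum f I, sum g I) \<in> G"
  by (induction I rule: infinite_finite_induct) (auto intro: G_zero G_add)
lemma G_nat: "(of_nat n, of_nat n) \<in> G"
  by (induction n) (auto intro: G_zero G_one G_add)
lemma G_int: "(of_int n, of_int n) \<in> G"
  using G_nat G_diff[OF G_zero G_nat] by (cases n rule: int_cases2) auto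
lemma G_power: "(a, u) \<in> G \<Longrightarrow> (a ^ n, u ^ n) \<in> G"
  by (induction n) (auto intro: G_one G_mult)

text \<open>\<open>g\<close> is the image of \<open>f\<close> under the homomorphism with graph
  \<open>G\<close>, applied to coefficients; a relation, since that homomorphism is only
  partial.\<close>

definition rel_poly :: "real poly \<Rightarrow> complex poly \<Rightarrow> bool"
  where "rel_poly f g \<longleftrightarrow> (\<forall>i. (poly.coeff f i, poly.coeff g i) \<in> G)"

lemma rel_poly_diff: "rel_poly f g \<Longrightarrow> rel_poly h k \<Longrightarrow> rel_poly (f - h) (g - k)"
  by (simp add: rel_poly_def G_diff)
lemma rel_poly_mult: "rel_poly f g \<Longrightarrow> rel_poly h k \<Longrightarrow> rel_poly (f * h) (g * k)"
  unfolding rel_poly_def coeff_mult by (auto intro: G_sum G_mult)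
lemma rel_poly_monom: "(a, u) \<in> G \<Longrightarrow> rel_poly (Polynomial.monom a n) (Polynomial.monom u n)"
  by (simp add: rel_poly_def Polynomial.coeff_monom G_zero)
lemma rel_poly_int: "rel_poly (map_poly of_int f) (map_poly of_int f)"
  by (simp add: rel_poly_def coeff_map_poly G_int)
lemma rel_poly_zero: "rel_poly 0 g \<Longrightarrow> g = 0"
  unfolding rel_poly_def using G_unique0 by (intro poly_eqI) auto
lemma rel_poly_poly: "rel_poly f g \<Longrightarrow> (a, u) \<in> G \<Longrightarrow> (poly f a, poly g u) \<in> G"
proof -
  assume fg: "rel_poly f g" "(a, u) \<in> G"
  let ?n = "max (Polynomial.degree f) (Polynomial.degree g)"
  have "poly f a = (\<Sum>i\<le>?n. poly.coeff f i * a ^ i)" "poly g u = (\<Sum>i\<le>?n. poly.coeff g i * u ^ i)"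
    unfolding poly_altdef by (rule sum.mono_neutral_left; auto simp: coeff_eq_0)+
  thus ?thesis using fg by (auto simp: rel_poly_def intro!: G_sum G_mult G_power)
qed

text \<open>The domain of \<open>G\<close> need not be a field, so injectivity uses algebraicity:
  strip all factors \<open>X\<close> from an integer polynomial annihilating \<open>a\<close>. The
  rest \<open>q\<close> still annihilates a nonzero \<open>a\<close> and has nonzero constant term,
  but if \<open>a\<close> were sent to 0, then \<open>q(a) = 0\<close> would be sent to that
  constant term.\<close>

lemma G_inj0: assumes "(a, 0) \<in> G" shows "a = 0"
proof (rule ccontr)
  assume a: "a \<noteq> 0"
  obtain p :: "int poly" where p: "poly (map_poly of_int p) a = 0" "p \<noteq> 0"
    using K_alg[OF G_K[OF assms]] by (auto elim: algebraicE')
  obtain q where q: "p = [:- 0, 1:] ^ Polynomial.order 0 p * q" "\<not> [:- 0, 1:] dvd q"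
    using order_decomp[OF p(2), of 0] by blast
  have "poly (map_poly of_int q) a = 0"
    using p(1) a by (subst (asm) q(1)) (simp add: of_int_poly_hom.hom_mult of_int_poly_hom.hom_power map_poly_pCons)
  hence "(0, poly (map_poly of_int q) 0) \<in> G" using rel_poly_poly[OF rel_poly_int assms, of q] by simp
  hence "poly (map_poly of_int q) (0 :: complex) = 0" by (rule G_unique0)
  hence "poly q 0 = 0" by (simp add: poly_0_coeff_0 coeff_map_poly)
  thus False using q(2) by (simp add: poly_eq_0_iff_dvd)
qed

text \<open>Let \<open>f\<close> have least degree among the polynomials over the domain of
  \<open>G\<close> that vanish at \<open>x\<close>, and let \<open>w\<close> be a root of its image.
  Any other such polynomial reduces to zero by division by \<open>f\<close>, carried out in parallel
  on the images. The domain is not a field, hence pseudo-division.\<close>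

lemma common_root:
  assumes x: "x \<in> K"
  shows "\<exists>w. \<forall>h k. rel_poly h k \<longrightarrow> poly h x = 0 \<longrightarrow> poly k w = 0"
proof -
  define P where "P f \<longleftrightarrow> f \<noteq> 0 \<and> poly f x = 0 \<and> (\<exists>g. rel_poly f g)" for f
  obtain p :: "int poly" where "poly (map_poly of_int p) x = 0" "p \<noteq> 0"
    using K_alg[OF x] by (auto elim: algebraicE')
  hence "P (map_poly of_int p)" using rel_poly_int by (auto simp: P_def)
  then obtain f where f: "P f" "\<And>h. P h \<Longrightarrow> Polynomial.degree f \<le> Polynomial.degree h"
    using ex_has_least_nat[of P _ Polynomial.degree] by blast
  obtain g where g: "rel_poly f g" using f(1) by (auto simp: P_def)
  have f0: "f \<noteq> 0" "poly f x = 0" using f(1) by (auto simp: P_def)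
  let ?d = "Polynomial.degree f"
  have lcG: "(poly.coeff f ?d, poly.coeff g ?d) \<in> G" using g by (simp add: rel_poly_def)
  \<comment> \<open>By injectivity the leading coefficient of \<open>f\<close> has a nonzero image,
    so the image is not constant and the multiplication by that coefficient can be undone at the
    end.\<close>
  have lc: "poly.coeff g ?d \<noteq> 0"
    using f0(1) lcG G_inj0[of "poly.coeff f ?d"] by auto
  have "?d \<noteq> 0"
  proof
    assume "?d = 0"
    then obtain a where "f = [:a:]" by (rule degree_eq_zeroE)
    thus False using f0 by simp
  qed
  hence "Polynomial.degree g \<noteq> 0" using le_degree[OF lc] by simp
  hence "\<not> Fundamental_Theorem_Algebra.constant (poly g)" by (simp add: constant_degree)
  then obtain w where w: "poly g w = 0" using fundamental_theorem_of_algebra by blast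
  have "poly k w = 0" if "rel_poly h k" "poly h x = 0" for h k
    using that
  proof (induction "Polynomial.degree h" arbitrary: h k rule: less_induct)
    case (less h k)
    show ?case
    proof (cases "h = 0")
      case True
      thus ?thesis using rel_poly_zero[of k] less.prems by simp
    next
      case False
      let ?e = "Polynomial.degree h"
      have le: "?d \<le> ?e" using f(2)[of h] False less.prems by (auto simp: P_def)
      define m where "m = Polynomial.monom (poly.coeff h ?e) (?e - ?d)"
      define m' where "m' = Polynomial.monom (poly.coeff k ?e) (?e - ?d)"
      have mm: "rel_poly m m'"
        unfolding m_def m'_def using less.prems(1) by (intro rel_poly_monom) (simp add: rel_poly_def)
      define c where "c = Polynomial.monom (poly.coeff f ?d) 0"
      define c' where "c' = Polynomial.monom (poly.coeff g ?d) 0"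
      have cc: "rel_poly c c'" unfolding c_def c'_def using lcG by (rule rel_poly_monom)
      \<comment> \<open>Multiplying \<open>h\<close> by the leading coefficient of \<open>f\<close>
        replaces the division; the leading terms then cancel.\<close>
      let ?h = "c * h - m * f" and ?k = "c' * k - m' * g"
      have rel: "rel_poly ?h ?k" by (intro rel_poly_diff rel_poly_mult cc mm less.prems g)
      have root: "poly ?h x = 0" using less.prems f0 by simp
      have ch: "c * h = Polynomial.smult (poly.coeff f ?d) h" by (simp add: c_def monom_0)
      have "Polynomial.degree (m * f) = ?e"
        using False f0 le by (simp add: m_def degree_mult_eq degree_monom_eq)
      hence deg_le: "Polynomial.degree ?h \<le> ?e"
        by (intro degree_diff_le) (simp_all add: ch)
      have "poly.coeff (m * f) ?e = poly.coeff h ?e * poly.coeff f ?d"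
        using le by (simp add: m_def coeff_monom_mult)
      hence "poly.coeff ?h ?e = 0" by (simp add: ch)
      hence "?h = 0 \<or> Polynomial.degree ?h < ?e"
        using deg_le by (metis le_neq_implies_less leading_coeff_0_iff)
      hence "poly ?k w = 0"
        using rel root rel_poly_zero less.hyps by (metis poly_0)
      thus ?thesis using w lc by (simp add: c'_def monom_0)
    qed
  qed
  thus ?thesis by blast
qed

text \<open>Sending \<open>h(x)\<close> to \<open>k(w)\<close>, where \<open>k\<close> is the image
  of \<open>h\<close>, is well defined because \<open>w\<close> is a root of the image of every
  polynomial that vanishes at \<open>x\<close>.\<close>

lemma extend_by_element:
  assumes x: "x \<in> K"
  obtains G' w where "partial_embedding K G'" "G \<subseteq> G'" "(x, w) \<in> G'"
proof -
  obtain w where w: "\<And>h k. rel_poly h k \<Longrightarrow> poly h x = 0 \<Longrightarrow> poly k w = 0"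
    using common_root[OF x] by blast
  define G' where "G' = {(poly h x, poly k w) | h k. rel_poly h k}"
  have const: "(a, u) \<in> G'" if "(a, u) \<in> G" for a u
    unfolding G'_def using rel_poly_monom[OF that, of 0]
    by (intro CollectI exI[of _ "Polynomial.monom a 0"] exI[of _ "Polynomial.monom u 0"]) (simp add: monom_0)
  have "(x, w) \<in> G'"
    unfolding G'_def using rel_poly_monom[OF G_one, of 1]
    by (intro CollectI exI[of _ "Polynomial.monom 1 1"]) (simp add: poly_monom)
  moreover have "partial_embedding K G'"
    unfolding partial_embedding_def
  proof (intro conjI allI impI)
    show "fst ` G' \<subseteq> K"
    proof -
      have "poly.coeff h i \<in> K" if "rel_poly h k" for h k i
        using that G_K unfolding rel_poly_def by blast
      thus ?thesis unfolding G'_def poly_altdef using x by (auto intro!: A_sum A_mult A_power)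
    qed
    show "(1, 1) \<in> G'" using const G_one by blast
  next
    fix a u b v assume "(a, u) \<in> G'" "(b, v) \<in> G'"
    then obtain h k h' k' where *: "rel_poly h k" "rel_poly h' k'" "a = poly h x" "u = poly k w" "b = poly h' x" "v = poly k' w"
      by (auto simp: G'_def)
    show "(a - b, u - v) \<in> G'"
      unfolding G'_def using rel_poly_diff[OF *(1,2)] *
      by (intro CollectI exI[of _ "h - h'"] exI[of _ "k - k'"]) simp
    show "(a * b, u * v) \<in> G'"
      unfolding G'_def using rel_poly_mult[OF *(1,2)] *
      by (intro CollectI exI[of _ "h * h'"] exI[of _ "k * k'"]) simp
  next
    fix u assume "(0, u) \<in> G'"
    thus "u = 0" using w by (auto simp: G'_def)
  qed
  moreover have "G \<subseteq> G'" using const by auto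
  ultimately show ?thesis by (intro that)
qed

end

lemma partial_embedding_Union:
  assumes "\<C> \<noteq> {}" "\<And>G. G \<in> \<C> \<Longrightarrow> partial_embedding K G"
    and chain: "\<And>G H. G \<in> \<C> \<Longrightarrow> H \<in> \<C> \<Longrightarrow> G \<subseteq> H \<or> H \<subseteq> G"
  shows "partial_embedding K (\<Union>\<C>)"
  unfolding partial_embedding_def
proof (intro conjI allI impI)
  show "fst ` \<Union>\<C> \<subseteq> K" using assms(2) unfolding partial_embedding_def by blast
  show "(1, 1) \<in> \<Union>\<C>" using assms(1,2) unfolding partial_embedding_def by blast
next
  fix a u b v assume "(a, u) \<in> \<Union>\<C>" "(b, v) \<in> \<Union>\<C>"
  then obtain G where "G \<in> \<C>" "(a, u) \<in> G" "(b, v) \<in> G" using chain by blast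
  with assms(2)[of G] show "(a - b, u - v) \<in> \<Union>\<C>" "(a * b, u * v) \<in> \<Union>\<C>"
    unfolding partial_embedding_def by blast+
next
  fix u assume "(0, u) \<in> \<Union>\<C>"
  thus "u = 0" using assms(2) unfolding partial_embedding_def by blast
qed

text \<open>Zorn's lemma, applied to the graphs of homomorphisms on subrings.\<close>

lemma (in real_subring) extend_partial_embedding:
  assumes "partial_embedding A G0" and alg: "\<And>x. x \<in> A \<Longrightarrow> Polynomial.algebraic x"
  shows "\<exists>\<sigma> \<in> embeddings A. \<forall>(a, u) \<in> G0. \<sigma> a = u"
proof -
  define \<G> where "\<G> = {G. partial_embedding A G \<and> G0 \<subseteq> G}"
  have "\<exists>M\<in>\<G>. \<forall>N\<in>\<G>. M \<subseteq> N \<longrightarrow> N = M"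
  proof (rule subset_Zorn_nonempty)
    show "\<G> \<noteq> {}" using assms(1) by (auto simp: \<G>_def)
    fix \<C> assume "\<C> \<noteq> {}" "subset.chain \<G> \<C>"
    hence "partial_embedding A (\<Union>\<C>)"
      by (intro partial_embedding_Union) (auto simp: subset_chain_def \<G>_def)
    moreover have "G0 \<subseteq> \<Union>\<C>"
      using \<open>\<C> \<noteq> {}\<close> \<open>subset.chain \<G> \<C>\<close> unfolding subset_chain_def \<G>_def by blast
    ultimately show "\<Union>\<C> \<in> \<G>" by (simp add: \<G>_def)
  qed
  then obtain M where "M \<in> \<G>" and max': "\<forall>N\<in>\<G>. M \<subseteq> N \<longrightarrow> N = M" by blast
  hence M: "partial_embedding A M" "G0 \<subseteq> M" by (simp_all add: \<G>_def)
  have max: "N = M" if "partial_embedding A N" "M \<subseteq> N" for N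
    using max'[rule_format, of N] that M(2) by (simp add: \<G>_def subset_trans)
  interpret embedding_graph A M by unfold_locales (use M alg in auto)
  \<comment> \<open>A maximal graph is defined everywhere, for it could otherwise be enlarged by a
    value at \<open>x\<close>.\<close>
  have ex: "\<exists>w. (x, w) \<in> M" if x: "x \<in> A" for x
  proof -
    obtain G' w where "partial_embedding A G'" "M \<subseteq> G'" "(x, w) \<in> G'"
      by (rule extend_by_element[OF x])
    thus ?thesis using max[of G'] by blast
  qed
  define \<sigma> where "\<sigma> x = (THE w. (x, w) \<in> M)" for x
  have \<sigma>: "\<sigma> x = w" if "(x, w) \<in> M" for x w
    unfolding \<sigma>_def using that G_unique by blast
  have \<sigma>M: "(x, \<sigma> x) \<in> M" if "x \<in> A" for x using ex[OF that] \<sigma> by blast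
  have "\<sigma> \<in> embeddings A"
    unfolding embeddings_iff by (intro conjI ballI \<sigma> G_mult G_add \<sigma>M G_one)
  thus ?thesis using \<sigma> M(2) by blast
qed

text \<open>The assignment \<open>f(c) \<mapsto> f(z)\<close> on \<open>Z[c]\<close> is well defined
  exactly because \<open>z\<close> is a conjugate of \<open>c\<close>; it remains to extend
  it.\<close>

lemma (in real_subring) embedding_of_conjugate:
  assumes alg: "\<And>x. x \<in> A \<Longrightarrow> Polynomial.algebraic x" and c: "c \<in> A" "conjugate_of (of_real c) z"
  shows "\<exists>\<sigma> \<in> embeddings A. \<sigma> c = z"
proof -
  define G where "G = {(poly (map_poly of_int f) c, poly (map_poly of_int f) z) | f :: int poly. True}"
  have cr: "poly (map_poly of_int f) (complex_of_real c) = of_real (poly (map_poly of_int f) c)" for f :: "int poly"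
    by (induction f) (auto simp: map_poly_pCons)
  have "partial_embedding A G"
    unfolding partial_embedding_def
  proof (intro conjI allI impI)
    show "fst ` G \<subseteq> A" using A_int_poly[OF c(1)] by (auto simp: G_def)
    show "(1, 1) \<in> G" unfolding G_def by (intro CollectI exI[of _ 1]) simp
  next
    fix a u b v assume "(a, u) \<in> G" "(b, v) \<in> G"
    then obtain f g :: "int poly" where *: "a = poly (map_poly of_int f) c" "u = poly (map_poly of_int f) z"
      "b = poly (map_poly of_int g) c" "v = poly (map_poly of_int g) z" by (auto simp: G_def)
    show "(a - b, u - v) \<in> G" unfolding G_def
      by (intro CollectI exI[of _ "f - g"]) (simp add: * of_int_poly_hom.hom_minus)
    show "(a * b, u * v) \<in> G" unfolding G_def
      by (intro CollectI exI[of _ "f * g"]) (simp add: * of_int_poly_hom.hom_mult)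
  next
    fix u assume "(0, u) \<in> G"
    then obtain f :: "int poly" where f: "poly (map_poly of_int f) c = 0" "u = poly (map_poly of_int f) z"
      by (auto simp: G_def)
    thus "u = 0" using c(2) cr[of f] by (simp add: conjugate_of_def)
  qed
  hence "\<exists>\<sigma> \<in> embeddings A. \<forall>(a, u) \<in> G. \<sigma> a = u"
    by (rule extend_partial_embedding[OF _ alg])
  moreover have "(c, z) \<in> G" unfolding G_def
    by (intro CollectI exI[of _ "[:0, 1:]"]) (simp add: map_poly_pCons)
  ultimately show ?thesis by (metis (mono_tags, lifting) case_prodD)
qed

section \<open>Totally real fields: arithmetic and embeddings\<close>

locale totally_real =
  fixes K :: "real set"
  assumes totally_real: "totally_real_field K"
begin

abbreviation "\<O> \<equiv> integers_of K"

lemma subfield_K: "subfield K (ring_of_type_algebra :: real ring)"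
  using totally_real by (simp add: totally_real_field_def)

lemma
  shows K_one: "1 \<in> K" and K_zero: "0 \<in> K"
    and K_minus: "x \<in> K \<Longrightarrow> - x \<in> K"
    and K_add: "x \<in> K \<Longrightarrow> y \<in> K \<Longrightarrow> x + y \<in> K"
    and K_mult: "x \<in> K \<Longrightarrow> y \<in> K \<Longrightarrow> x * y \<in> K"
    and K_inverse: "x \<in> K \<Longrightarrow> inverse x \<in> K"
proof -
  interpret R: field "ring_of_type_algebra :: real ring" by (rule field_from_type_algebra)
  have ops: "x \<oplus>\<^bsub>ring_of_type_algebra\<^esub> y = x + y" "x \<otimes>\<^bsub>ring_of_type_algebra\<^esub> y = x * y"
    "\<one>\<^bsub>ring_of_type_algebra\<^esub> = 1" "\<zero>\<^bsub>ring_of_type_algebra\<^esub> = 0" for x y :: real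
    by (simp_all add: ring_of_type_algebra_def)
  note sub = subringE[OF subfieldE(1)[OF subfield_K]]
  show "1 \<in> K" "0 \<in> K" using sub(2,3) by (simp_all only: ops)
  have minus: "\<ominus>\<^bsub>ring_of_type_algebra\<^esub> x = - x" for x :: real
    using R.minus_equality[of "- x" x] by (simp add: ring_of_type_algebra_def)
  show "- x \<in> K" if "x \<in> K" using sub(5)[OF that] minus by simp
  show "x + y \<in> K" "x * y \<in> K" if "x \<in> K" "y \<in> K"
    using sub(6,7)[OF that] by (simp_all only: ops)
  show "inverse x \<in> K" if "x \<in> K"
  proof (cases "x = 0")
    case False
    hence x: "x \<in> K - {\<zero>\<^bsub>ring_of_type_algebra\<^esub>}" unfolding ops using that by simp
    have "inv\<^bsub>ring_of_type_algebra\<^esub> x = inverse x"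
      using False by (intro R.comm_inv_char) (auto simp: ring_of_type_algebra_def)
    thus ?thesis using R.subfield_m_inv(1)[OF subfield_K x] by simp
  qed (use \<open>0 \<in> K\<close> in simp)
qed

sublocale K_ring: real_subring K
  by unfold_locales (auto intro: K_one K_add K_minus K_mult)

lemma
  assumes \<tau>: "\<tau> \<in> embeddings K"
  shows embedding_add: "x \<in> K \<Longrightarrow> y \<in> K \<Longrightarrow> \<tau> (x + y) = \<tau> x + \<tau> y"
    and embedding_mult: "x \<in> K \<Longrightarrow> y \<in> K \<Longrightarrow> \<tau> (x * y) = \<tau> x * \<tau> y"
    and embedding_one: "\<tau> 1 = 1"
  using \<tau> by (auto simp: embeddings_iff)

lemma embedding_zero: "\<tau> \<in> embeddings K \<Longrightarrow> \<tau> 0 = 0"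
proof -
  assume "\<tau> \<in> embeddings K"
  hence "\<tau> 0 + \<tau> 0 = \<tau> 0 + 0" using embedding_add[OF _ K_zero K_zero, of \<tau>] by (simp only: add_0_right)
  thus ?thesis by (simp only: add_left_cancel)
qed

lemma embedding_minus: "\<tau> \<in> embeddings K \<Longrightarrow> x \<in> K \<Longrightarrow> \<tau> (- x) = - \<tau> x"
  using embedding_add[of \<tau> x "- x"] embedding_zero[of \<tau>] K_minus by (simp add: eq_neg_iff_add_eq_0 add.commute)

lemma embedding_of_nat: "\<tau> \<in> embeddings K \<Longrightarrow> \<tau> (of_nat n) = of_nat n"
  by (induction n) (simp_all add: embedding_zero embedding_add embedding_one K_one K_ring.A_of_nat)

lemma embedding_of_int: "\<tau> \<in> embeddings K \<Longrightarrow> \<tau> (of_int n) = of_int n"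
  using embedding_of_nat[of \<tau>] embedding_minus[OF _ K_ring.A_of_nat, of \<tau>] by (cases n rule: int_cases2) auto

lemma embedding_int_poly:
  "\<tau> \<in> embeddings K \<Longrightarrow> c \<in> K \<Longrightarrow> \<tau> (poly (map_poly of_int f) c) = poly (map_poly of_int f) (\<tau> c)"
  by (induction f) (simp_all add: map_poly_pCons embedding_zero embedding_add embedding_mult embedding_of_int
      K_ring.A_of_int K_ring.A_int_poly K_mult)

lemma embedding_eq_0:
  assumes "\<tau> \<in> embeddings K" "x \<in> K" "\<tau> x = 0"
  shows "x = 0"
proof (rule ccontr)
  assume "x \<noteq> 0"
  thus False
    using embedding_mult[OF assms(1,2) K_inverse[OF assms(2)]] embedding_one[OF assms(1)] assms(3) by simp
qed

lemma K_diff: "x \<in> K \<Longrightarrow> y \<in> K \<Longrightarrow> x - y \<in> K"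
  using K_add[OF _ K_minus] by fastforce
lemma K_divide: "x \<in> K \<Longrightarrow> y \<in> K \<Longrightarrow> x / y \<in> K"
  by (simp add: divide_inverse K_mult K_inverse)
lemma K_algebraic: "x \<in> K \<Longrightarrow> Polynomial.algebraic x"
  using totally_real by (simp add: totally_real_field_def)

lemma O_K: "x \<in> \<O> \<Longrightarrow> x \<in> K" by (simp add: integers_of_def)
lemma O_algebraic_int: "x \<in> \<O> \<Longrightarrow> algebraic_int x" by (simp add: integers_of_def)
lemma OI: "x \<in> K \<Longrightarrow> algebraic_int (complex_of_real x) \<Longrightarrow> x \<in> \<O>" by (simp add: integers_of_def)
lemma O_one: "1 \<in> \<O>" by (simp add: integers_of_def K_one)
lemma O_zero: "0 \<in> \<O>" by (simp add: integers_of_def K_zero)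
lemma O_minus: "x \<in> \<O> \<Longrightarrow> - x \<in> \<O>" by (auto simp: integers_of_def K_minus)
lemma O_add: "x \<in> \<O> \<Longrightarrow> y \<in> \<O> \<Longrightarrow> x + y \<in> \<O>"
  using algebraic_int_add[of "of_real x" "of_real y"] by (intro OI) (auto simp: integers_of_def K_add)
lemma O_mult: "x \<in> \<O> \<Longrightarrow> y \<in> \<O> \<Longrightarrow> x * y \<in> \<O>"
  using algebraic_int_mult[of "of_real x" "of_real y"] by (intro OI) (auto simp: integers_of_def K_mult)
sublocale O_ring: real_subring \<O>
  by unfold_locales (auto intro: O_one O_add O_minus O_mult)

lemma O_two: "2 \<in> \<O>" using O_add[OF O_one O_one] by simp

text \<open>A bound that holds for all embeddings of \<open>K\<close> into the reals becomes a bound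
  on all conjugates of \<open>c\<close>, which is the form in which the results on bounded
  conjugates ask for it.\<close>

lemma conjugate_real_embedding:
  assumes c: "c \<in> K" "conjugate_of (of_real c) z"
  shows "\<exists>\<sigma> :: real \<Rightarrow> real. \<sigma> \<in> embeddings K \<and> z = of_real (\<sigma> c)"
proof -
  obtain \<tau> :: "real \<Rightarrow> complex" where \<tau>: "\<tau> \<in> embeddings K" "\<tau> c = z"
    using K_ring.embedding_of_conjugate[OF K_algebraic c] by blast
  have real: "\<tau> x \<in> \<real>" if "x \<in> K" for x
    using totally_real \<tau>(1) that by (auto simp: totally_real_field_def)
  hence re: "of_real (Re (\<tau> x)) = \<tau> x" if "x \<in> K" for x using that by (simp add: of_real_Re)
  have "(\<lambda>x. Re (\<tau> x)) \<in> embeddings K"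
    using \<tau>(1) real by (auto simp: embeddings_iff complex_is_Real_iff)
  thus ?thesis using re[OF c(1)] \<tau>(2) by (intro exI[of _ "\<lambda>x. Re (\<tau> x)"]) simp
qed

lemma O_kronecker:
  assumes "c \<in> \<O>" "\<And>\<sigma> :: real \<Rightarrow> real. \<sigma> \<in> embeddings K \<Longrightarrow> \<bar>\<sigma> c\<bar> \<le> 2"
  obtains w :: complex and N where "N > 0" "w ^ N = 1" "w + inverse w = of_real c"
proof -
  have *: "\<exists>t. z = of_real t \<and> \<bar>t\<bar> \<le> 2" if z: "conjugate_of (of_real c) z" for z
  proof -
    obtain \<sigma> :: "real \<Rightarrow> real" where "\<sigma> \<in> embeddings K" "z = of_real (\<sigma> c)"
      using conjugate_real_embedding[OF O_K[OF assms(1)] z] by blast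
    thus ?thesis using assms(2) by blast
  qed
  show ?thesis
    by (rule kronecker[OF O_algebraic_int[OF assms(1)] *]) (assumption | rule that)+
qed

lemma O_small_zero:
  assumes "c \<in> \<O>" "\<And>\<sigma> :: real \<Rightarrow> real. \<sigma> \<in> embeddings K \<Longrightarrow> \<bar>\<sigma> c\<bar> < 1"
  shows "c = 0"
proof -
  have "norm z < 1" if z: "conjugate_of (of_real c) z" for z
  proof -
    obtain \<sigma> :: "real \<Rightarrow> real" where "\<sigma> \<in> embeddings K" "z = of_real (\<sigma> c)"
      using conjugate_real_embedding[OF O_K[OF assms(1)] z] by blast
    thus ?thesis using assms(2) by simp
  qed
  moreover have "algebraic_int (complex_of_real c)" using O_algebraic_int[OF assms(1)] by simp
  ultimately have "complex_of_real c = 0" by (intro small_conjugates_imp_zero)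
  thus ?thesis by simp
qed

end

section \<open>Elementary facts on roots of unity\<close>

lemma \<zeta>_double: "\<zeta> (2 * n) = cis (pi / real n)"
  by (simp add: \<zeta>_def)

lemma \<zeta>_root: "n > 0 \<Longrightarrow> \<zeta> n ^ n = 1"
  by (simp add: \<zeta>_def Complex.DeMoivre)

lemma norm_\<zeta> [simp]: "norm (\<zeta> n) = 1" by (simp add: \<zeta>_def)

lemma \<zeta>_mult_power: "k > 0 \<Longrightarrow> \<zeta> (n * k) ^ k = \<zeta> n"
  by (simp add: \<zeta>_def Complex.DeMoivre)

lemma unit_mult_cnj: "norm z = 1 \<Longrightarrow> z * cnj z = 1"
  using complex_norm_square[of z] by simp

lemma unit_cnj: "norm z = 1 \<Longrightarrow> cnj z = inverse z"
  using inverse_unique[OF unit_mult_cnj] by simp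

lemma root_of_unity_norm: "n > 0 \<Longrightarrow> (z :: complex) ^ n = 1 \<Longrightarrow> norm z = 1"
  using power_eq_iff_eq_base[of n "norm z" 1] by (simp flip: norm_power)

lemma cis_eq_one_nat: "N > 0 \<Longrightarrow> cis (2 * pi * real j / real N) = 1 \<longleftrightarrow> N dvd j"
proof
  assume N: "N > 0" and "cis (2 * pi * real j / real N) = 1"
  then obtain k where "2 * pi * real j / real N = of_int k * (2 * pi)" by (auto simp: cis_eq_1_iff)
  hence "real j = of_int k * real N" using N by (simp add: field_simps)
  hence "int j = k * int N" by (metis of_int_eq_iff of_int_mult of_int_of_nat_eq)
  thus "N dvd j" by (metis dvd_triv_right int_dvd_int_iff)
next
  assume N: "N > 0" and "N dvd j"
  then obtain k where "j = N * k" by blast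
  hence "2 * pi * real j / real N = of_int (int k) * (2 * pi)" using N by simp
  thus "cis (2 * pi * real j / real N) = 1" using cis_eq_1_iff by blast
qed

lemma \<zeta>_power_eq_one: "n > 0 \<Longrightarrow> \<zeta> n ^ j = 1 \<longleftrightarrow> n dvd j"
  using cis_eq_one_nat[of n j] by (simp add: \<zeta>_def Complex.DeMoivre mult.commute)

lemma root_of_unity_\<zeta>_power:
  assumes "n > 0" "z ^ n = 1"
  obtains k where "z = \<zeta> n ^ k"
proof -
  have "z \<in> (\<lambda>k. cis (2 * pi * real k / real n)) ` {..<n}"
    using Complex.bij_betw_roots_unity[OF assms(1)] assms(2) by (simp add: bij_betw_def)
  thus ?thesis using that by (auto simp: \<zeta>_def Complex.DeMoivre mult.commute)
qed

lemma algebraic_int_\<zeta>: "n > 0 \<Longrightarrow> algebraic_int (\<zeta> n)"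
  by (rule algebraic_int_unit_root[OF _ \<zeta>_root])

lemma algebraic_int_of_nat: "algebraic_int (of_nat n :: complex)"
  by (rule int_imp_algebraic_int) simp

lemma algebraic_int_of_int: "algebraic_int (of_int n :: complex)"
  by (rule int_imp_algebraic_int) simp

section \<open>Cyclotomic units\<close>

lemma one_minus_power_dvd:
  fixes z :: complex
  assumes "algebraic_int z"
  obtains s where "algebraic_int s" "1 - z ^ m = (1 - z) * s"
  using one_diff_power_eq[of z m] algebraic_int_sum[of "{..<m}" "\<lambda>i. z ^ i"] algebraic_int_power[OF assms] by blast

text \<open>The powers of \<open>w\<close> below \<open>b\<close> sum to 0. Subtracting this sum
  from \<open>b\<close> leaves a sum of terms \<open>1 - w ^ j\<close>, each a multiple of
  \<open>1 - w\<close>.\<close>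

lemma order_multiple_of_one_minus_root:
  fixes w :: complex
  assumes "w ^ b = 1" "w \<noteq> 1" "b > 0"
  obtains s where "algebraic_int s" "of_nat b = (1 - w) * s"
proof -
  have w: "algebraic_int w" by (rule algebraic_int_unit_root[OF assms(3,1)])
  have "(1 - w) * (\<Sum>i<b. w ^ i) = 0" using one_diff_power_eq[of w b] assms(1) by simp
  hence "(\<Sum>i<b. w ^ i) = 0" using assms(2) by simp
  hence "of_nat b = (\<Sum>j<b. 1 - w ^ j)" by (simp add: sum_subtractf)
  also have "\<dots> = (1 - w) * (\<Sum>j<b. \<Sum>i<j. w ^ i)" by (simp add: one_diff_power_eq sum_distrib_left)
  finally have eq: "of_nat b = (1 - w) * (\<Sum>j<b. \<Sum>i<j. w ^ i)" .
  show ?thesis by (rule that[OF _ eq]) (intro algebraic_int_sum algebraic_int_power w)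
qed

text \<open>The power \<open>\<zeta> n ^ a\<close> is a nontrivial \<open>b\<close>-th root of
  unity, so \<open>1 - \<zeta> n ^ a\<close> divides \<open>b\<close>, and it is itself a multiple
  of \<open>1 - \<zeta> n\<close>.\<close>

lemma one_minus_root_dvd_nat:
  assumes "n > 0" "n = a * b" "b > 1"
  obtains s where "algebraic_int s" "of_nat b = (1 - \<zeta> n) * s"
proof -
  have a: "a > 0" using assms by (cases a) auto
  have root: "(\<zeta> n ^ a) ^ b = 1" using \<zeta>_root[OF assms(1)] assms(2) by (simp flip: power_mult)
  have ne: "\<zeta> n ^ a \<noteq> 1" using \<zeta>_power_eq_one[OF assms(1)] assms a by (auto dest: dvd_imp_le)
  obtain s where s: "algebraic_int s" "of_nat b = (1 - \<zeta> n ^ a) * s"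
    using order_multiple_of_one_minus_root[OF root ne] assms(3) by auto
  obtain t where t: "algebraic_int t" "1 - \<zeta> n ^ a = (1 - \<zeta> n) * t"
    using one_minus_power_dvd[OF algebraic_int_\<zeta>[OF assms(1)]] by blast
  show ?thesis using that[of "t * s"] s t algebraic_int_mult by simp
qed

lemma not_primepow_coprime_decomp:
  fixes n :: nat
  assumes "n > 1" "\<not> primepow n"
  obtains a b where "n = a * b" "Rings.coprime a b" "a > 1" "b > 1"
proof -
  obtain p where p: "Factorial_Ring.prime p" "p dvd n" using assms(1) prime_factor_nat[of n] by auto
  let ?m = "multiplicity p n"
  have "n \<noteq> 0" "\<not> is_unit p" using assms p by (auto simp: not_prime_unit)
  then obtain b where b: "n = p ^ ?m * b" "\<not> p dvd b" by (rule multiplicity_decompose')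
  have m: "?m > 0" using p assms(1) by (simp add: prime_multiplicity_gt_zero_iff)
  have "b \<noteq> 1" using b(1) m p(1) assms(2) by (metis mult.right_neutral primepow_prime_power)
  moreover have "b \<noteq> 0" using b assms by (auto intro: Nat.gr0I)
  moreover have "Rings.coprime (p ^ ?m) b" using p(1) b(2) by (simp add: prime_imp_coprime)
  moreover have "p ^ ?m > 1" using m prime_gt_1_nat[OF p(1)] by (intro one_less_power)
  ultimately show ?thesis using that[OF b(1)] by simp
qed

text \<open>Both coprime factors of \<open>n\<close> are multiples of \<open>1 - \<zeta> n\<close>,
  hence so is 1 by Bezout.\<close>

lemma one_minus_\<zeta>_unit:
  assumes "n > 1" "\<not> primepow n"
  shows "algebraic_int (inverse (1 - \<zeta> n))"
proof -
  obtain a b where ab: "n = a * b" "Rings.coprime a b" "a > 1" "b > 1"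
    using not_primepow_coprime_decomp[OF assms] .
  have n: "n > 0" using assms by simp
  obtain s where s: "algebraic_int s" "of_nat b = (1 - \<zeta> n) * s"
    using one_minus_root_dvd_nat[OF n ab(1) ab(4)] .
  obtain t where t: "algebraic_int t" "of_nat a = (1 - \<zeta> n) * t"
    using one_minus_root_dvd_nat[OF n _ ab(3), of b] ab(1) by (auto simp: mult.commute)
  obtain u v :: int where uv: "u * int a + v * int b = 1"
    using bezout_int[of "int a" "int b"] ab(2) by (auto simp: coprime_iff_gcd_eq_1)
  hence "(1 :: complex) = of_int u * of_nat a + of_int v * of_nat b"
    by (metis of_int_1 of_int_add of_int_mult of_int_of_nat_eq)
  also have "\<dots> = (1 - \<zeta> n) * (of_int u * t + of_int v * s)" by (simp add: s t algebra_simps)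
  finally have "inverse (1 - \<zeta> n) = of_int u * t + of_int v * s" by (metis inverse_unique)
  thus ?thesis using s t by (auto intro!: algebraic_int_add algebraic_int_mult algebraic_int_of_int)
qed

lemma freshman_dream:
  fixes x y :: complex and p :: nat
  assumes p: "Factorial_Ring.prime p" and "algebraic_int x" "algebraic_int y"
  obtains t where "algebraic_int t" "(x + y) ^ p = x ^ p + y ^ p + of_nat p * t"
proof -
  have p1: "p > 1" using prime_gt_1_nat[OF p] .
  define t where "t = (\<Sum>k\<in>{1..<p}. of_nat ((p choose k) div p) * (x ^ k * y ^ (p - k)))"
  have "(x + y) ^ p = (\<Sum>k\<le>p. of_nat (p choose k) * x ^ k * y ^ (p - k))" by (rule binomial_ring)
  also have "{..p} = insert 0 (insert p {1..<p})" using p1 by auto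
  also have "(\<Sum>k\<in>\<dots>. of_nat (p choose k) * x ^ k * y ^ (p - k)) =
      y ^ p + (x ^ p + (\<Sum>k\<in>{1..<p}. of_nat (p choose k) * x ^ k * y ^ (p - k)))"
    using p1 by simp
  also have "(\<Sum>k\<in>{1..<p}. of_nat (p choose k) * x ^ k * y ^ (p - k)) = of_nat p * t"
    unfolding t_def sum_distrib_left
  proof (rule sum.cong[OF refl])
    fix k assume "k \<in> {1..<p}"
    hence "p dvd (p choose k)" using dvd_choose_prime[of k p] p by auto
    hence "(p choose k) = p * ((p choose k) div p)" by simp
    hence "(of_nat (p choose k) :: complex) = of_nat p * of_nat ((p choose k) div p)" by (metis of_nat_mult)
    thus "of_nat (p choose k) * x ^ k * y ^ (p - k) = of_nat p * (of_nat ((p choose k) div p) * (x ^ k * y ^ (p - k)))"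
      by simp
  qed
  finally have "(x + y) ^ p = x ^ p + y ^ p + of_nat p * t" by simp
  moreover have "algebraic_int t" unfolding t_def using assms
    by (intro algebraic_int_sum algebraic_int_mult algebraic_int_of_nat algebraic_int_power)
  ultimately show ?thesis by (intro that)
qed

lemma one_minus_power_prime:
  fixes x :: complex and p :: nat
  assumes p: "Factorial_Ring.prime p" and x: "algebraic_int x"
  obtains t where "algebraic_int t" "(1 - x) ^ p = 1 - x ^ p + of_nat p * t"
proof -
  obtain t where t: "algebraic_int t" "(1 + - x) ^ p = 1 ^ p + (- x) ^ p + of_nat p * t"
    using freshman_dream[OF p, of 1 "- x"] x by auto
  show ?thesis
  proof (cases "p = 2")
    case True
    \<comment> \<open>For \<open>p = 2\<close> the power of \<open>- x\<close> has the wrong sign;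
      the correction \<open>2 * x ^ 2\<close> is absorbed into the multiple of
      \<open>p\<close>.\<close>
    have "(1 - x) ^ p = 1 - x ^ p + of_nat p * (t + x ^ 2)"
      using t(2) by (simp add: True algebra_simps)
    from that[OF _ this] show ?thesis using t(1) x by (simp add: algebraic_int_add algebraic_int_power)
  next
    case False
    hence "odd p" using p prime_odd_nat prime_ge_2_nat[OF p] by (metis le_neq_implies_less)
    hence "(1 - x) ^ p = 1 - x ^ p + of_nat p * t" using t(2) by simp
    from that[OF t(1) this] show ?thesis .
  qed
qed

lemma one_minus_power_prime_power:
  fixes x :: complex and p :: nat
  assumes p: "Factorial_Ring.prime p" and x: "algebraic_int x"
  shows "\<exists>t. algebraic_int t \<and> (1 - x) ^ (p ^ k) = 1 - x ^ (p ^ k) + of_nat p * t"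
proof (induction k)
  case (Suc k)
  then obtain t where t: "algebraic_int t" "(1 - x) ^ (p ^ k) = 1 - x ^ (p ^ k) + of_nat p * t" by blast
  let ?y = "x ^ (p ^ k)"
  have y: "algebraic_int ?y" using x by (rule algebraic_int_power)
  obtain s where s: "algebraic_int s" "((1 - ?y) + of_nat p * t) ^ p = (1 - ?y) ^ p + (of_nat p * t) ^ p + of_nat p * s"
    by (rule freshman_dream[OF p, of "1 - ?y" "of_nat p * t"])
      (use y t in \<open>auto intro!: algebraic_int_diff algebraic_int_mult algebraic_int_of_nat\<close>)
  obtain r where r: "algebraic_int r" "(1 - ?y) ^ p = 1 - ?y ^ p + of_nat p * r"
    by (rule one_minus_power_prime[OF p y])
  have "(of_nat p * t) ^ p = of_nat p * (of_nat p ^ (p - 1) * t ^ p)"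
    using prime_gt_0_nat[OF p] by (cases p) (simp_all add: power_mult_distrib)
  hence "((1 - ?y) + of_nat p * t) ^ p = 1 - ?y ^ p + of_nat p * (of_nat p ^ (p - 1) * t ^ p + s + r)"
    unfolding s(2) r(2) by (simp only: distrib_left) (simp only: ac_simps)
  moreover have "a ^ (p ^ Suc k) = (a ^ (p ^ k)) ^ p" for a :: complex
    by (simp only: power_Suc power_mult[symmetric] mult.commute)
  ultimately have "(1 - x) ^ (p ^ Suc k) = 1 - x ^ (p ^ Suc k) + of_nat p * (of_nat p ^ (p - 1) * t ^ p + s + r)"
    by (simp only: t(2))
  moreover have "algebraic_int (of_nat p ^ (p - 1) * t ^ p + s + r)"
    using s r t by (intro algebraic_int_add algebraic_int_mult algebraic_int_power algebraic_int_of_nat)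
  ultimately show ?case by blast
qed (intro exI[of _ 0]; simp)

text \<open>With \<open>n = p ^ k\<close>, the power \<open>(1 - \<zeta> n) ^ n\<close> is congruent
  to \<open>1 - \<zeta> n ^ n = 0\<close> modulo \<open>p\<close>. A unit would therefore make
  \<open>1 / p\<close> an algebraic integer, hence an integer.\<close>

lemma one_minus_\<zeta>_not_unit:
  assumes "primepow (n :: nat)"
  shows "\<not> algebraic_int (inverse (1 - \<zeta> n))"
proof
  assume unit: "algebraic_int (inverse (1 - \<zeta> n))"
  obtain p k where p: "Factorial_Ring.prime p" "k > 0" "n = p ^ k"
    using assms by (auto simp: primepow_def)
  have n: "n > 1" using p(2) prime_gt_1_nat[OF p(1)] unfolding p(3) by (intro one_less_power)
  obtain t where t: "algebraic_int t" "(1 - \<zeta> n) ^ n = of_nat p * t"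
    using one_minus_power_prime_power[OF p(1) algebraic_int_\<zeta>[of n], of k] n \<zeta>_root[of n]
    by (auto simp flip: p(3))
  have "\<zeta> n \<noteq> 1" using \<zeta>_power_eq_one[of n 1] n by auto
  hence "1 = (1 - \<zeta> n) ^ n * inverse (1 - \<zeta> n) ^ n" by (simp flip: power_mult_distrib)
  also have "\<dots> = of_nat p * (t * inverse (1 - \<zeta> n) ^ n)" by (simp add: t(2))
  finally have "inverse (of_nat p) = t * inverse (1 - \<zeta> n) ^ n" by (metis inverse_unique)
  hence "algebraic_int (inverse (of_nat p) :: complex)"
    using unit t by (simp only: algebraic_int_mult algebraic_int_power)
  hence "inverse (of_nat p) \<in> (\<int> :: complex set)"
    by (rule rational_algebraic_int_is_int) (simp add: Rats_inverse)
  then obtain m :: int where "inverse (of_nat p :: complex) = of_int m" by (auto simp: Ints_def)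
  hence "(of_int (m * int p) :: complex) = of_int 1"
    using prime_gt_0_nat[OF p(1)] by (metis left_inverse of_int_1 of_int_mult of_int_of_nat_eq of_nat_eq_0_iff less_numeral_extra(3))
  hence "m * int p = 1" by (simp only: of_int_eq_iff)
  hence "int p dvd 1" by (metis dvd_triv_right)
  thus False using prime_gt_1_nat[OF p(1)] by simp
qed

section \<open>Rank two modules spanned by 1 and a root of unity\<close>

text \<open>For the nonreal roots of unity \<open>z\<close> with trace in \<open>K\<close>, this is
  the quadratic extension \<open>K(z)\<close> if \<open>A = K\<close>; the choice
  \<open>A = \<O>\<close> gives the lattices.\<close>

definition span2 :: "real set \<Rightarrow> complex \<Rightarrow> complex set"
  where "span2 A z = {of_real a + of_real b * z | a b. a \<in> A \<and> b \<in> A}"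

context real_subring
begin

lemma span2I: "a \<in> A \<Longrightarrow> b \<in> A \<Longrightarrow> of_real a + of_real b * z \<in> span2 A z"
  by (auto simp: span2_def)

lemma span2_add: "x \<in> span2 A z \<Longrightarrow> y \<in> span2 A z \<Longrightarrow> x + y \<in> span2 A z"
  unfolding span2_def
proof safe
  fix a b a' b' assume "a \<in> A" "b \<in> A" "a' \<in> A" "b' \<in> A"
  thus "\<exists>c d. complex_of_real a + complex_of_real b * z + (complex_of_real a' + complex_of_real b' * z) =
      complex_of_real c + complex_of_real d * z \<and> c \<in> A \<and> d \<in> A"
    by (intro exI[of _ "a + a'"] exI[of _ "b + b'"]) (simp add: A_add algebra_simps)
qed

lemma span2_smult: "a \<in> A \<Longrightarrow> x \<in> span2 A z \<Longrightarrow> of_real a * x \<in> span2 A z"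
  unfolding span2_def
proof safe
  fix b c assume "a \<in> A" "b \<in> A" "c \<in> A"
  thus "\<exists>d e. complex_of_real a * (complex_of_real b + complex_of_real c * z) =
      complex_of_real d + complex_of_real e * z \<and> d \<in> A \<and> e \<in> A"
    by (intro exI[of _ "a * b"] exI[of _ "a * c"]) (simp add: A_mult algebra_simps)
qed

lemma span2_one: "1 \<in> span2 A z" using span2I[OF A_one A_zero] by simp
lemma span2_base: "z \<in> span2 A z" using span2I[OF A_zero A_one, of z] by simp
lemma span2_zero: "0 \<in> span2 A z" using span2I[OF A_zero A_zero, of z] by simp
lemma span2_of_real: "a \<in> A \<Longrightarrow> of_real a \<in> span2 A z" using span2I[OF _ A_zero, of a z] by simp
lemma span2_minus: "x \<in> span2 A z \<Longrightarrow> - x \<in> span2 A z"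
  using span2_smult[OF A_minus[OF A_one], of x z] by simp
lemma span2_mult_aux:
  assumes "x \<in> span2 A z" "z * y \<in> span2 A z" "y \<in> span2 A z"
  shows "x * y \<in> span2 A z"
proof -
  obtain a b where "a \<in> A" "b \<in> A" "x = of_real a + of_real b * z" using assms(1) by (auto simp: span2_def)
  thus ?thesis using assms(2,3) span2_add span2_smult by (simp add: distrib_right mult.assoc)
qed

end

text \<open>Trace \<open>c\<close> and norm 1 make \<open>z\<close> a root of
  \<open>X^2 - c X + 1\<close>, so the span is a ring; it is stable under conjugation because
  \<open>cnj z = c - z\<close>.\<close>

locale quadratic_span = real_subring +
  fixes z :: complex and c :: real
  assumes norm_z: "norm z = 1" and c: "c \<in> A" and trace: "z + cnj z = of_real c"
begin

lemma z_square: "z * z = of_real (- 1) + of_real c * z"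
  using trace unit_mult_cnj[OF norm_z] by (simp flip: trace add: algebra_simps)

lemma span2_mult: "x \<in> span2 A z \<Longrightarrow> y \<in> span2 A z \<Longrightarrow> x * y \<in> span2 A z"
proof (rule span2_mult_aux)
  assume "y \<in> span2 A z"
  have "z * z \<in> span2 A z" unfolding z_square by (intro span2I A_minus A_one c)
  hence "y * z \<in> span2 A z" using \<open>y \<in> span2 A z\<close> span2_base by (intro span2_mult_aux[of y z z]) auto
  thus "z * y \<in> span2 A z" by (simp add: mult.commute)
qed

lemma span2_power: "x \<in> span2 A z \<Longrightarrow> x ^ n \<in> span2 A z"
  by (induction n) (auto intro: span2_one span2_mult)

lemma cnj_z: "cnj z \<in> span2 A z"
proof -
  have "cnj z = of_real c + of_real (- 1) * z" using trace by (simp add: algebra_simps)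
  thus ?thesis using span2I[OF c A_minus[OF A_one]] by metis
qed

lemma span2_cnj: "x \<in> span2 A z \<Longrightarrow> cnj x \<in> span2 A z"
  using span2_add[OF span2_of_real span2_smult[OF _ cnj_z]] by (auto simp: span2_def[of A z])

lemma span2_powi: "x \<in> span2 A z \<Longrightarrow> norm x = 1 \<Longrightarrow> x powi k \<in> span2 A z"
  by (cases "k \<ge> 0") (auto simp: power_int_def span2_power span2_cnj simp flip: unit_cnj)

lemma span2_trace:
  assumes "x \<in> span2 A z"
  shows "2 * Re x \<in> A"
proof -
  obtain a b where ab: "a \<in> A" "b \<in> A" "x = of_real a + of_real b * z" using assms(1) by (auto simp: span2_def)
  have "2 * Re z = c" using arg_cong[OF trace, of Re] by simp
  hence eq: "2 * Re x = a + a + b * c" using ab(3) by auto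
  show ?thesis unfolding eq by (intro A_add A_mult ab c)
qed

end

context real_subring
begin

lemma quadratic_spanI: "norm z = 1 \<Longrightarrow> 2 * Re z \<in> A \<Longrightarrow> quadratic_span A z (2 * Re z)"
  by unfold_locales (auto simp: complex_eq_iff)

end

lemma Re_\<zeta>_double: "Re (\<zeta> (2 * n)) = cos (pi / real n)"
  by (simp add: \<zeta>_double)

lemma Im_\<zeta>_double_pos: "n > 1 \<Longrightarrow> Im (\<zeta> (2 * n)) > 0"
  unfolding \<zeta>_double by (simp add: sin_gt_zero field_simps)

lemma \<zeta>_double_square: "\<zeta> (2 * n) * \<zeta> (2 * n) = \<zeta> n"
  by (simp add: \<zeta>_def cis_mult)

lemma \<zeta>_double_trace: "\<zeta> (2 * n) + cnj (\<zeta> (2 * n)) = of_real (2 * cos (pi / real n))"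
  by (simp add: \<zeta>_double complex_eq_iff)

lemma Q_vertices_iff: "n \<in> Q_vertices K \<longleftrightarrow> n > 1 \<and> 2 * cos (pi / real n) \<in> K"
proof -
  have "\<zeta> (2 * n) + inverse (\<zeta> (2 * n)) = of_real (2 * cos (pi / real n))"
    using \<zeta>_double_trace unit_cnj[OF norm_\<zeta>] by simp
  thus ?thesis unfolding Q_vertices_def by (simp only: mem_Collect_eq) (metis (no_types, lifting) image_iff of_real_eq_iff)
qed

lemma (in real_subring) span2_real:
  assumes "Im z \<noteq> 0" "of_real r \<in> span2 A z"
  shows "r \<in> A"
proof -
  obtain a b where ab: "a \<in> A" "b \<in> A" "of_real r = of_real a + of_real b * z" using assms(2) by (auto simp: span2_def)
  have "b * Im z = 0" using arg_cong[OF ab(3), of Im] by simp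
  hence "r = a" using assms(1) arg_cong[OF ab(3), of Re] by simp
  thus ?thesis using ab(1) by simp
qed

text \<open>Meant for Bezout coefficients \<open>u\<close>, \<open>v\<close> with \<open>m\<close>
  the least common multiple of \<open>a\<close> and \<open>b\<close>: with \<open>r = pi\<close>,
  the angle \<open>pi / m\<close> is an integral combination of \<open>pi / a\<close> and
  \<open>pi / b\<close>.\<close>

lemma sum_fractions_eq:
  fixes a b u v m :: real
  assumes "a \<noteq> 0" "b \<noteq> 0" "m \<noteq> 0" "(u * b + v * a) * m = a * b"
  shows "u * (r / a) + v * (r / b) = r / m"
proof -
  have "u / a + v / b = (u * b + v * a) / (a * b)" using assms by (simp add: add_frac_eq)
  also have "\<dots> = 1 / m" using assms by (simp add: frac_eq_eq)
  finally have "r * (u / a + v / b) = r * (1 / m)" by simp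
  thus ?thesis by (simp add: distrib_left mult.commute)
qed

text \<open>Subtracting the conjugate eliminates \<open>a\<close>, so that \<open>b\<close> can be
  read off as a quotient.\<close>

lemma minus_cnj_affine:
  "x = of_real a + of_real b * z \<Longrightarrow> x - cnj x = of_real b * (z - cnj z)"
  by (simp add: algebra_simps)

context totally_real
begin

abbreviation "Q \<equiv> Q_vertices K"
abbreviation "\<Lambda> n \<equiv> span2 \<O> (\<zeta> (2 * n))"

lemma Q_gt_1: "n \<in> Q \<Longrightarrow> n > 1" by (simp add: Q_vertices_iff)

lemma Q_pos: "n \<in> Q \<Longrightarrow> n > 0" using Q_gt_1 by fastforce

lemma Q_trace_O: assumes "n \<in> Q" shows "2 * Re (\<zeta> (2 * n)) \<in> \<O>"
proof (rule OI)
  show "2 * Re (\<zeta> (2 * n)) \<in> K" using assms by (simp add: Q_vertices_iff Re_\<zeta>_double)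
  have "algebraic_int (\<zeta> (2 * n) + cnj (\<zeta> (2 * n)))"
    using algebraic_int_\<zeta>[of "2 * n"] Q_gt_1[OF assms] by (intro algebraic_int_add) auto
  thus "algebraic_int (complex_of_real (2 * Re (\<zeta> (2 * n))))"
    unfolding \<zeta>_double_trace Re_\<zeta>_double .
qed

lemma Q_span_K: "n \<in> Q \<Longrightarrow> quadratic_span K (\<zeta> (2 * n)) (2 * Re (\<zeta> (2 * n)))"
  by (intro K_ring.quadratic_spanI O_K Q_trace_O) auto

lemma Q_span_O: "n \<in> Q \<Longrightarrow> quadratic_span \<O> (\<zeta> (2 * n)) (2 * Re (\<zeta> (2 * n)))"
  by (intro O_ring.quadratic_spanI Q_trace_O) auto

lemmas span_K_mult = quadratic_span.span2_mult[OF Q_span_K]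
lemmas span_K_power = quadratic_span.span2_power[OF Q_span_K]
lemmas span_K_powi = quadratic_span.span2_powi[OF Q_span_K]
lemmas span_K_trace = quadratic_span.span2_trace[OF Q_span_K]
lemmas \<Lambda>_mult = quadratic_span.span2_mult[OF Q_span_O]
lemmas \<Lambda>_cnj = quadratic_span.span2_cnj[OF Q_span_O]
lemmas \<Lambda>_trace = quadratic_span.span2_trace[OF Q_span_O]

text \<open>The root \<open>\<zeta> (2 * m)\<close> is a power of \<open>\<zeta> (2 * n)\<close>,
  hence lies in the span over \<open>K\<close>, all of whose elements have trace in
  \<open>K\<close>.\<close>

lemma Q_dvd:
  assumes "n \<in> Q" "m dvd n" "m > 1"
  shows "m \<in> Q"
proof -
  obtain k where k: "n = m * k" using assms(2) by blast
  have "k > 0" using Q_gt_1[OF assms(1)] k by (cases k) auto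
  hence "\<zeta> (2 * m) = \<zeta> (2 * n) ^ k" using \<zeta>_mult_power[of k "2 * m"] k by (simp add: mult.assoc)
  hence "\<zeta> (2 * m) \<in> span2 K (\<zeta> (2 * n))" using span_K_power[OF assms(1) K_ring.span2_base] by simp
  hence "2 * Re (\<zeta> (2 * m)) \<in> K" by (rule span_K_trace[OF assms(1)])
  thus ?thesis using assms(3) by (simp add: Q_vertices_iff Re_\<zeta>_double)
qed

text \<open>Adjoining either root gives a quadratic extension of \<open>K\<close>, and one contains
  the other. Concretely, the relation expressing \<open>\<zeta> (2 * n)\<close> by the finer root is
  solved for the latter; its coefficient is nonzero because \<open>\<zeta> (2 * n)\<close> is not
  real.\<close>

lemma multiple_in_span_K:
  assumes n: "n \<in> Q" and nk: "n * k \<in> Q"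
  shows "\<zeta> (2 * (n * k)) \<in> span2 K (\<zeta> (2 * n))"
proof -
  let ?z = "\<zeta> (2 * n)" and ?x = "\<zeta> (2 * (n * k))"
  have "k > 0" using Q_gt_1[OF nk] by (cases k) auto
  hence "?z = ?x ^ k" using \<zeta>_mult_power[of k "2 * n"] by (simp add: mult.assoc)
  hence "?z \<in> span2 K ?x" using span_K_power[OF nk K_ring.span2_base] by simp
  then obtain a b where ab: "a \<in> K" "b \<in> K" "?z = of_real a + of_real b * ?x" by (auto simp: span2_def)
  have "b \<noteq> 0" using arg_cong[OF ab(3), of Im] Im_\<zeta>_double_pos[OF Q_gt_1[OF n]] by auto
  moreover have "x = of_real (- a / b) + of_real (inverse b) * z"
    if "b \<noteq> 0" "z = of_real a + of_real b * x" for x z :: complex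
    using that by (simp add: add_divide_distrib flip: divide_inverse_commute)
  ultimately have "?x = of_real (- a / b) + of_real (inverse b) * ?z" using ab(3) by blast
  thus ?thesis using K_ring.span2I ab K_divide K_minus K_inverse by metis
qed

text \<open>The left side is a square root of the discriminant of the basis
  \<open>1, \<zeta> (2 * n)\<close>; this identity ties it to the cyclotomic numbers
  \<open>1 - \<zeta> n\<close>.\<close>

lemma \<zeta>_double_minus_cnj: "\<zeta> (2 * n) - cnj (\<zeta> (2 * n)) = - cnj (\<zeta> (2 * n)) * (1 - \<zeta> n)"
proof -
  let ?w = "\<zeta> (2 * n)"
  have "- cnj ?w * (1 - ?w * ?w) = (?w * cnj ?w) * ?w - cnj ?w" by (simp add: right_diff_distrib)
  thus ?thesis by (simp only: \<zeta>_double_square unit_mult_cnj[OF norm_\<zeta>] mult_1_left)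
qed

text \<open>When \<open>n\<close> is not a prime power the discriminant of \<open>\<Lambda> n\<close> is a unit, so \<open>\<Lambda> n\<close> absorbs all
  larger roots of unity.\<close>

lemma multiple_in_\<Lambda>:
  assumes n: "n \<in> Q" and nk: "n * k \<in> Q" and not_pp: "\<not> primepow n"
  shows "\<zeta> (2 * (n * k)) \<in> \<Lambda> n"
proof -
  let ?z = "\<zeta> (2 * n)" and ?x = "\<zeta> (2 * (n * k))"
  have z_int: "algebraic_int ?z" using algebraic_int_\<zeta>[of "2 * n"] Q_gt_1[OF n] by auto
  have x_int: "algebraic_int ?x" using algebraic_int_\<zeta>[of "2 * (n * k)"] Q_pos[OF nk] by auto
  obtain a b where ab: "a \<in> K" "b \<in> K" "?x = of_real a + of_real b * ?z"
    using multiple_in_span_K[OF n nk] by (auto simp: span2_def)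
  have ne: "?z - cnj ?z \<noteq> 0" using Im_\<zeta>_double_pos[OF Q_gt_1[OF n]] by (auto simp: complex_eq_iff)
  have "inverse (?z - cnj ?z) = inverse (- cnj ?z * (1 - \<zeta> n))"
    by (simp only: \<zeta>_double_minus_cnj)
  also have "\<dots> = - ?z * inverse (1 - \<zeta> n)" unfolding unit_cnj[OF norm_\<zeta>] by simp
  finally have "inverse (?z - cnj ?z) = - ?z * inverse (1 - \<zeta> n)" .
  hence inv_int: "algebraic_int (inverse (?z - cnj ?z))"
    using one_minus_\<zeta>_unit[OF Q_gt_1[OF n] not_pp] z_int algebraic_int_mult by simp
  \<comment> \<open>The coordinate \<open>b\<close> is a quotient of algebraic integers whose
    denominator is a unit; integrality of \<open>a\<close> follows.\<close>
  have "?x - cnj ?x = of_real b * (?z - cnj ?z)" by (rule minus_cnj_affine[OF ab(3)])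
  hence "of_real b = (?x - cnj ?x) * inverse (?z - cnj ?z)" using ne by (simp add: field_simps)
  hence b_int: "algebraic_int (complex_of_real b)"
    using inv_int x_int by (simp only: algebraic_int_mult algebraic_int_diff algebraic_int_cnj_iff)
  have "of_real a = ?x - of_real b * ?z" by (simp add: ab(3))
  hence a_int: "algebraic_int (complex_of_real a)"
    using b_int x_int z_int by (simp only: algebraic_int_mult algebraic_int_diff)
  show ?thesis unfolding ab(3) by (intro O_ring.span2I OI ab a_int b_int)
qed

text \<open>Membership would give \<open>1 - \<zeta> (n * q) = \<beta> * (1 - \<zeta> n)\<close>
  with integral \<open>\<beta>\<close>. If \<open>n * q\<close> is no prime power, the left side is
  a unit and so is \<open>1 - \<zeta> n\<close>. If it is one, then \<open>1 - \<zeta> n\<close> is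
  divisible by the square of \<open>1 - \<zeta> (n * q)\<close>, which becomes a unit. Both are
  impossible.\<close>

lemma prime_multiple_notin_\<Lambda>:
  assumes n: "n \<in> Q" and pp: "primepow n" and q: "Factorial_Ring.prime q"
  shows "\<zeta> (2 * (n * q)) \<notin> \<Lambda> n"
proof
  let ?z = "\<zeta> (2 * n)" and ?x = "\<zeta> (2 * (n * q))"
  assume "?x \<in> \<Lambda> n"
  then obtain a b where ab: "a \<in> \<O>" "b \<in> \<O>" "?x = of_real a + of_real b * ?z" by (auto simp: span2_def)
  have n1: "n > 1" and q1: "q > 1" using Q_gt_1[OF n] prime_gt_1_nat[OF q] by auto
  have nq1: "n * q > 1" using less_1_mult[OF n1 q1] .
  have z_int: "algebraic_int ?z" using algebraic_int_\<zeta>[of "2 * n"] n1 by auto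
  have x_int: "algebraic_int ?x" using algebraic_int_\<zeta>[of "2 * (n * q)"] n1 q1 by auto
  \<comment> \<open>The factors \<open>?x\<close> and \<open>cnj ?z\<close> compensate the roots of
    unity by which the two square roots of discriminants differ from
    \<open>1 - \<zeta> (n * q)\<close> and \<open>1 - \<zeta> n\<close>.\<close>
  define \<beta> where "\<beta> = of_real b * ?x * cnj ?z"
  have \<beta>_int: "algebraic_int \<beta>"
    unfolding \<beta>_def using O_algebraic_int[OF ab(2)] z_int x_int by (intro algebraic_int_mult) auto
  have "?x - cnj ?x = of_real b * (?z - cnj ?z)" by (rule minus_cnj_affine[OF ab(3)])
  hence *: "- cnj ?x * (1 - \<zeta> (n * q)) = of_real b * (- cnj ?z * (1 - \<zeta> n))"
    by (simp only: \<zeta>_double_minus_cnj)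
  have "1 - \<zeta> (n * q) = (?x * cnj ?x) * (1 - \<zeta> (n * q))"
    by (simp only: unit_mult_cnj[OF norm_\<zeta>] mult_1_left)
  also have "\<dots> = - ?x * (- cnj ?x * (1 - \<zeta> (n * q)))" by simp
  also have "\<dots> = \<beta> * (1 - \<zeta> n)" unfolding * \<beta>_def by simp
  finally have eq: "1 - \<zeta> (n * q) = \<beta> * (1 - \<zeta> n)" .
  have not_unit: "\<not> algebraic_int (inverse (1 - \<zeta> n))" by (rule one_minus_\<zeta>_not_unit[OF pp])
  have ne: "1 - \<zeta> (n * q) \<noteq> 0" using \<zeta>_power_eq_one[of "n * q" 1] n1 q1 by auto
  show False
  proof (cases "primepow (n * q)")
    case False
    have "\<beta> \<noteq> 0" using ne eq by auto
    hence "inverse (1 - \<zeta> n) = \<beta> * inverse (1 - \<zeta> (n * q))"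
      unfolding eq inverse_mult_distrib by simp
    thus False using not_unit algebraic_int_mult[OF \<beta>_int one_minus_\<zeta>_unit[OF nq1 False]] by simp
  next
    case True
    let ?w = "\<zeta> (n * q)"
    have w_int: "algebraic_int ?w" using algebraic_int_\<zeta>[of "n * q"] n1 q1 by auto
    define v where "v = (\<Sum>j<q. ?w ^ j)"
    have "?w ^ q = \<zeta> n" using \<zeta>_mult_power[of q n] q1 by simp
    hence "1 - \<zeta> n = (1 - ?w) * v" using one_diff_power_eq[of ?w q] by (simp add: v_def)
    hence "(1 - ?w) * (\<beta> * v) = (1 - ?w) * 1" using eq by simp
    hence \<beta>v: "\<beta> * v = 1" using ne by simp
    obtain s where s: "algebraic_int s" "of_nat q = (1 - ?w) * s"
      by (rule one_minus_root_dvd_nat[of "n * q" n q]) (use n1 q1 in auto)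
    \<comment> \<open>Modulo \<open>1 - ?w\<close> every power of \<open>?w\<close> is 1, so
      \<open>v\<close> is congruent to \<open>q\<close>, which is itself a multiple of
      \<open>1 - ?w\<close>.\<close>
    have "v = of_nat q - (\<Sum>j<q. 1 - ?w ^ j)" by (simp add: v_def sum_subtractf)
    also have "\<dots> = (1 - ?w) * (s - (\<Sum>j<q. \<Sum>i<j. ?w ^ i))"
      unfolding s(2) by (simp add: one_diff_power_eq sum_distrib_left right_diff_distrib)
    finally have "(1 - ?w) * (\<beta> * (s - (\<Sum>j<q. \<Sum>i<j. ?w ^ i))) = 1" using \<beta>v by (simp add: ac_simps)
    hence "inverse (1 - ?w) = \<beta> * (s - (\<Sum>j<q. \<Sum>i<j. ?w ^ i))" by (rule inverse_unique)
    hence "algebraic_int (inverse (1 - ?w))"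
      using \<beta>_int s(1) w_int by (simp only: algebraic_int_mult algebraic_int_diff algebraic_int_sum algebraic_int_power)
    thus False using one_minus_\<zeta>_not_unit[OF True] by blast
  qed
qed

section \<open>Components of the graph\<close>

text \<open>The common divisor \<open>x\<close> in \<open>Q\<close> places both roots in one
  quadratic extension of \<open>K\<close>; by Bezout their powers produce
  \<open>\<zeta> (2 * lcm l y)\<close> there, whose trace is then in \<open>K\<close>. Without such
  an \<open>x\<close> this fails: over the rationals 2 and 3 are vertices but 6 is not.\<close>

lemma lcm_in_Q:
  assumes x: "x \<in> Q" and l: "l \<in> Q" "x dvd l" and y: "y \<in> Q" "x dvd y"
  shows "lcm l y \<in> Q"
proof -
  have pos: "l > 0" "y > 0" using l y Q_pos by auto
  have in_span: "\<zeta> (2 * l) \<in> span2 K (\<zeta> (2 * x))" "\<zeta> (2 * y) \<in> span2 K (\<zeta> (2 * x))"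
    using multiple_in_span_K[OF x] l y by (auto elim!: dvdE)
  obtain u v where uv: "u * int y + v * int l = gcd (int y) (int l)" using bezout_int by blast
  have prod: "int (gcd l y) * int (lcm l y) = int l * int y"
    using prod_gcd_lcm_nat[of l y] by (metis of_nat_mult)
  have lcm0: "lcm l y > 0" using pos by (simp add: lcm_pos_nat)
  have "real_of_int u * real y + real_of_int v * real l = real (gcd l y)"
    using arg_cong[OF uv, of real_of_int] by (simp add: gcd.commute)
  moreover have "real (gcd l y) * real (lcm l y) = real l * real y"
    using arg_cong[OF prod, of real_of_int] by simp
  ultimately have "(real_of_int u * real y + real_of_int v * real l) * real (lcm l y) = real l * real y" by simp
  hence "real_of_int u * (pi / real l) + real_of_int v * (pi / real y) = pi / real (lcm l y)"
    using pos lcm0 by (intro sum_fractions_eq) auto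
  hence "\<zeta> (2 * l) powi u * \<zeta> (2 * y) powi v = \<zeta> (2 * lcm l y)"
    unfolding \<zeta>_double by (simp only: cis_power_int cis_mult)
  moreover have "\<zeta> (2 * l) powi u * \<zeta> (2 * y) powi v \<in> span2 K (\<zeta> (2 * x))"
    using in_span by (intro span_K_mult span_K_powi x) auto
  ultimately have "2 * Re (\<zeta> (2 * lcm l y)) \<in> K" using span_K_trace[OF x] by simp
  moreover have "lcm l y > 1" using Q_gt_1[OF l(1)] dvd_imp_le[OF dvd_lcm1 lcm0] by linarith
  ultimately show ?thesis by (simp add: Q_vertices_iff Re_\<zeta>_double)
qed

abbreviation "connected_rel \<equiv> (Q_edges K \<union> (Q_edges K)\<inverse>)\<^sup>*"

lemma path_dvd: "(n, m) \<in> (Q_edges K)\<^sup>* \<Longrightarrow> n dvd m"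
  by (induction rule: rtrancl_induct) (auto simp: Q_edges_def intro: dvd_trans)

text \<open>On \<open>Q\<close> the path order is plain divisibility: a prime can be stripped off
  \<open>m\<close> as long as \<open>m\<close> differs from \<open>n\<close>, and the result stays
  in \<open>Q\<close>, being a divisor of \<open>m\<close> greater than 1.\<close>

lemma dvd_path:
  assumes "n \<in> Q" "m \<in> Q" "n dvd m"
  shows "(n, m) \<in> (Q_edges K)\<^sup>*"
  using assms(2,3)
proof (induction m rule: less_induct)
  case (less m)
  show ?case
  proof (cases "m = n")
    case False
    obtain k where k: "m = n * k" using less.prems by blast
    have k1: "k \<noteq> 1" "k > 0" using False k Q_pos[OF less.prems(1)] by (auto intro: Nat.gr0I)
    then obtain q where q: "Factorial_Ring.prime q" "q dvd k" using prime_factor_nat by blast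
    then obtain j where j: "k = q * j" by blast
    have m: "m = n * j * q" using k j by simp
    have "j > 0" using j k1 by (auto intro: Nat.gr0I)
    have "n * 1 \<le> n * j" using \<open>j > 0\<close> by (intro mult_le_mono) auto
    hence "n * j > 1" using Q_gt_1[OF assms(1)] by linarith
    hence nj: "n * j \<in> Q" using Q_dvd[OF less.prems(1), of "n * j"] m by simp
    have "m > n * j" using m prime_gt_1_nat[OF q(1)] Q_pos[OF nj] by simp
    hence "(n, n * j) \<in> (Q_edges K)\<^sup>*" using less.IH nj by simp
    moreover have "(n * j, m) \<in> Q_edges K"
      using nj less.prems(1) q(1) m Q_pos[OF nj] by (auto simp: Q_edges_def)
    ultimately show ?thesis by (rule rtrancl_into_rtrancl)
  qed simp
qed

lemma dvd_connected: "n \<in> Q \<Longrightarrow> m \<in> Q \<Longrightarrow> n dvd m \<Longrightarrow> (n, m) \<in> connected_rel"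
  using dvd_path rtrancl_mono[of "Q_edges K" "Q_edges K \<union> (Q_edges K)\<inverse>"] by blast

text \<open>The invariant \<open>lcm n m \<in> Q\<close> is carried along a path. On an upward edge
  from \<open>m\<close>, the vertex \<open>m\<close> is a common divisor of \<open>lcm n m\<close>
  and the new vertex; on a downward edge the new least common multiple divides the old one.\<close>

lemma connected_lcm:
  assumes "(n, m) \<in> connected_rel" "n \<in> Q"
  shows "m \<in> Q \<and> lcm n m \<in> Q"
  using assms(1)
proof (induction rule: rtrancl_induct)
  case base
  thus ?case using assms(2) by simp
next
  case (step m m')
  hence IH: "m \<in> Q" "lcm n m \<in> Q" by auto
  from step.hyps(2) show ?case
  proof
    assume "(m, m') \<in> Q_edges K"
    hence m': "m' \<in> Q" "m dvd m'" by (auto simp: Q_edges_def)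
    have "lcm (lcm n m) m' \<in> Q" by (rule lcm_in_Q[OF IH(1,2) dvd_lcm2 m'])
    moreover have "lcm (lcm n m) m' = lcm n m'" using m'(2) by (simp add: lcm.assoc lcm_proj2_if_dvd)
    ultimately show ?thesis using m'(1) by simp
  next
    assume "(m, m') \<in> (Q_edges K)\<inverse>"
    hence m': "m' \<in> Q" "m' dvd m" by (auto simp: Q_edges_def)
    have "lcm n m' dvd lcm n m" using m'(2) by (auto intro: dvd_trans)
    moreover have "m' \<le> lcm n m'" using Q_pos[OF m'(1)] Q_pos[OF assms(2)] by (intro dvd_imp_le) (auto simp: lcm_pos_nat)
    ultimately show ?thesis using Q_dvd[OF IH(2)] Q_gt_1[OF m'(1)] m'(1) by (meson less_le_trans)
  qed
qed

end

section \<open>Groups of roots of unity\<close>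

lemma carrier_roots_of_unity: "carrier roots_of_unity = {z. \<exists>n>0. z ^ n = 1}"
  by (simp add: roots_of_unity_def)

lemma mult_roots_of_unity [simp]: "x \<otimes>\<^bsub>roots_of_unity\<^esub> y = x * y"
  by (simp add: roots_of_unity_def)

lemma one_roots_of_unity [simp]: "\<one>\<^bsub>roots_of_unity\<^esub> = 1"
  by (simp add: roots_of_unity_def)

lemma roots_of_unity_mult:
  "x \<in> carrier roots_of_unity \<Longrightarrow> y \<in> carrier roots_of_unity \<Longrightarrow> x * y \<in> carrier roots_of_unity"
proof -
  assume "x \<in> carrier roots_of_unity" "y \<in> carrier roots_of_unity"
  then obtain m n where "m > 0" "n > 0" "x ^ m = 1" "y ^ n = 1" by (auto simp: carrier_roots_of_unity)
  hence "m * n > 0" "(x * y) ^ (m * n) = 1"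
    by (auto simp: power_mult_distrib power_mult) (metis mult.commute power_mult power_one)
  thus ?thesis unfolding carrier_roots_of_unity by blast
qed

lemma roots_of_unity_one: "1 \<in> carrier roots_of_unity"
  unfolding carrier_roots_of_unity by (auto intro: exI[of _ 1])

lemma roots_of_unity_inverse: "x \<in> carrier roots_of_unity \<Longrightarrow> inverse x \<in> carrier roots_of_unity"
  by (auto simp: carrier_roots_of_unity power_inverse)

lemma roots_of_unity_nonzero: "x \<in> carrier roots_of_unity \<Longrightarrow> x \<noteq> 0"
  by (auto simp: carrier_roots_of_unity power_0_left)

lemma roots_of_unity_norm: "x \<in> carrier roots_of_unity \<Longrightarrow> norm x = 1"
  using root_of_unity_norm by (auto simp: carrier_roots_of_unity)

interpretation roots_of_unity: comm_group roots_of_unity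
proof (rule comm_groupI)
  fix x assume "x \<in> carrier roots_of_unity"
  thus "\<exists>y\<in>carrier roots_of_unity. y \<otimes>\<^bsub>roots_of_unity\<^esub> x = \<one>\<^bsub>roots_of_unity\<^esub>"
    using roots_of_unity_inverse roots_of_unity_nonzero by (intro bexI[of _ "inverse x"]) auto
qed (auto intro: roots_of_unity_mult roots_of_unity_one simp: mult_ac)

lemma inv_roots_of_unity: "x \<in> carrier roots_of_unity \<Longrightarrow> inv\<^bsub>roots_of_unity\<^esub> x = inverse x"
  using roots_of_unity_inverse roots_of_unity_nonzero by (intro roots_of_unity.inv_equality) auto

lemma generate_roots_of_unity_subset:
  assumes "S \<subseteq> T" "T \<subseteq> carrier roots_of_unity" "1 \<in> T"
    and mult: "\<And>x y. x \<in> T \<Longrightarrow> y \<in> T \<Longrightarrow> x * y \<in> T" and inverse: "\<And>x. x \<in> T \<Longrightarrow> inverse x \<in> T"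
  shows "generate roots_of_unity S \<subseteq> T"
proof
  fix x assume "x \<in> generate roots_of_unity S"
  thus "x \<in> T"
  proof induction
    case (inv h)
    hence "h \<in> T" "h \<in> carrier roots_of_unity" using assms(1,2) by auto
    thus ?case using inverse inv_roots_of_unity by simp
  qed (use assms in auto)
qed

lemma generate_roots_of_unity_power:
  assumes "x \<in> generate roots_of_unity S"
  shows "x ^ k \<in> generate roots_of_unity S"
proof (induction k)
  case 0
  show ?case using generate.one[of roots_of_unity S] by simp
next
  case (Suc k)
  thus ?case using generate.eng[OF assms Suc] by simp
qed

lemma root_in_mu_set:
  assumes "n \<in> C" "n > 0" "z ^ (2 * n) = 1"
  shows "z \<in> mu_set C"
proof -
  obtain k where "z = \<zeta> (2 * n) ^ k"
    by (rule root_of_unity_\<zeta>_power[OF _ assms(3)]) (use assms(2) in auto)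
  moreover have "\<zeta> (2 * n) \<in> mu_set C" unfolding mu_set_def using assms(1) by (intro generate.incl) auto
  ultimately show ?thesis unfolding mu_set_def using generate_roots_of_unity_power by simp
qed

lemma mu_set_singleton:
  assumes "q > 0"
  shows "mu_set {q} = {z. z ^ (2 * q) = 1}"
proof (intro equalityI subsetI)
  show "z \<in> mu_set {q}" if "z \<in> {z. z ^ (2 * q) = 1}" for z
    using root_in_mu_set[of q "{q}" z] that assms by simp
  have "mu_set {q} \<subseteq> {z. z ^ (2 * q) = 1}"
    unfolding mu_set_def
  proof (rule generate_roots_of_unity_subset)
    show "(\<lambda>n. \<zeta> (2 * n)) ` {q} \<subseteq> {z. z ^ (2 * q) = 1}" using \<zeta>_root[of "2 * q"] assms by auto
    show "{z. z ^ (2 * q) = 1} \<subseteq> carrier roots_of_unity"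
      using assms unfolding carrier_roots_of_unity by (auto intro!: exI[of _ "2 * q"])
  qed (auto simp: power_mult_distrib power_inverse)
  thus "z \<in> {z. z ^ (2 * q) = 1}" if "z \<in> mu_set {q}" for z using that by blast
qed

text \<open>The exponents of a set of roots of unity closed under reflections form a subset of the integers
  closed under \<open>(i, j) \<mapsto> 2i - j\<close>; such a set consists of the multiples of its least positive element.\<close>

lemma reflection_closed_roots:
  fixes H :: "complex set" and M :: nat
  assumes one: "1 \<in> H" and minus_one: "- 1 \<in> H" and M: "M > 0"
    and refl: "\<And>g h. g \<in> H \<Longrightarrow> h \<in> H \<Longrightarrow> g ^ 2 * cnj h \<in> H"
  obtains m where "m > 0" "m dvd M" "{z \<in> H. z ^ (2 * M) = 1} = {z. z ^ (2 * m) = 1}"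
proof -
  \<comment> \<open>The exponents of those elements of \<open>H\<close> that are powers of
    \<open>cis (pi / M)\<close>, a primitive root of unity of order \<open>2 * M\<close>.\<close>
  define E where "E j \<longleftrightarrow> cis (of_int j * (pi / real M)) \<in> H" for j :: int
  have E_refl: "E (2 * i - j)" if "E i" "E j" for i j
  proof -
    have "cis (of_int i * (pi / real M)) ^ 2 * cnj (cis (of_int j * (pi / real M))) =
      cis (of_int (2 * i - j) * (pi / real M))"
      by (simp add: power2_eq_square cis_mult cis_cnj algebra_simps)
    thus ?thesis using refl that unfolding E_def by metis
  qed
  have E0: "E 0" using one by (simp add: E_def)
  have EM: "E (int M)" using minus_one M by (simp add: E_def)
  have E_minus: "E (- j)" if "E j" for j using E_refl[OF E0 that] by simp
  \<comment> \<open>Reflection at 0 followed by reflection at \<open>i\<close> is the translation by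
    \<open>2 * i\<close>.\<close>
  have E_add: "E (j + 2 * i)" if "E i" "E j" for i j
    using E_refl[OF that(1) E_minus[OF that(2)]] by (simp add: add.commute)
  define d where "d = (LEAST d. d > 0 \<and> E (int d))"
  have d: "d > 0" "E (int d)" using LeastI[of "\<lambda>d. d > 0 \<and> E (int d)" M] M EM by (auto simp: d_def)
  have d_min: "\<not> E (int e)" if "e > 0" "e < d" for e
    using not_less_Least[of e "\<lambda>d. d > 0 \<and> E (int d)"] that by (auto simp: d_def)
  have E_nat: "E (int k * int d)" for k
  proof (induction k rule: less_induct)
    case (less k)
    consider "k = 0" | "k = 1" | j where "k = Suc (Suc j)" by (metis One_nat_def old.nat.exhaust)
    thus ?case
    proof cases
      case 3
      hence "E (int j * int d + 2 * int d)" using less.IH[of j] E_add[OF d(2)] by simp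
      thus ?thesis using 3 by (simp add: algebra_simps)
    qed (use E0 d in auto)
  qed
  have E_int: "E (k * int d)" for k
    using E_nat[of "nat \<bar>k\<bar>"] E_minus[OF E_nat[of "nat \<bar>k\<bar>"]] by (cases "k \<ge> 0") auto
  have E_dvd: "int d dvd j" if "E j" for j
  proof -
    \<comment> \<open>Translations by even multiples of \<open>d\<close> are available, hence
      reduction modulo \<open>2 * d\<close>. A remainder strictly between \<open>d\<close> and
      \<open>2 * d\<close> is reflected at \<open>d\<close> into the range below \<open>d\<close>,
      against minimality.\<close>
    define r where "r = j mod (2 * int d)"
    have r: "0 \<le> r" "r < 2 * int d" using d(1) by (auto simp: r_def)
    have "r = j + 2 * (- (j div (2 * int d)) * int d)"
      unfolding r_def by (simp add: minus_mult_div_eq_mod[symmetric])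
    hence Er: "E r" using E_add[OF E_int that] by metis
    have "r = 0 \<or> r = int d"
    proof (rule ccontr)
      assume "\<not> (r = 0 \<or> r = int d)"
      then consider "0 < r" "r < int d" | "int d < r" "r < 2 * int d" using r by linarith
      thus False
      proof cases
        case 1
        thus False using d_min[of "nat r"] Er by (simp add: nat_less_iff)
      next
        case 2
        thus False using d_min[of "nat (2 * int d - r)"] E_refl[OF d(2) Er] by (simp add: nat_less_iff)
      qed
    qed
    hence "int d dvd r" by auto
    moreover have "int d dvd 2 * int d * (j div (2 * int d))" by simp
    ultimately have "int d dvd 2 * int d * (j div (2 * int d)) + r" by (rule dvd_add[rotated])
    thus ?thesis by (simp add: r_def)
  qed
  \<comment> \<open>This is where \<open>- 1 \<in> H\<close> matters: its exponent is
    \<open>M\<close>, so the group found has even order \<open>2 * m\<close>.\<close>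
  have "d dvd M" using E_dvd[OF EM] by simp
  then obtain m where m: "M = d * m" by blast
  have m0: "m > 0" using m M by (auto intro: Nat.gr0I)
  have cis_pow: "cis (of_int (int k) * (pi / real M)) = \<zeta> (2 * M) ^ k" for k
    by (simp add: \<zeta>_double Complex.DeMoivre)
  have "{z \<in> H. z ^ (2 * M) = 1} = {z. z ^ (2 * m) = 1}"
  proof (intro equalityI subsetI)
    fix z assume z: "z \<in> {z \<in> H. z ^ (2 * M) = 1}"
    obtain k where k: "z = \<zeta> (2 * M) ^ k"
      by (rule root_of_unity_\<zeta>_power[of "2 * M" z]) (use M z in auto)
    hence "E (int k)" using z cis_pow by (simp add: E_def)
    hence "d dvd k" using E_dvd by fastforce
    then obtain j where "k = d * j" by blast
    hence "2 * M dvd k * (2 * m)" by (simp add: m)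
    hence "\<zeta> (2 * M) ^ (k * (2 * m)) = 1" using \<zeta>_power_eq_one[of "2 * M"] M by simp
    thus "z \<in> {z. z ^ (2 * m) = 1}" by (simp add: k power_mult)
  next
    fix z :: complex assume "z \<in> {z. z ^ (2 * m) = 1}"
    hence z: "z ^ (2 * m) = 1" by simp
    obtain k where k: "z = \<zeta> (2 * m) ^ k"
      by (rule root_of_unity_\<zeta>_power[of "2 * m" z]) (use m0 z in auto)
    have "\<zeta> (2 * m) = \<zeta> (2 * M) ^ d" using \<zeta>_mult_power[of d "2 * m"] d(1) by (simp add: m mult_ac)
    hence "z = \<zeta> (2 * M) ^ (k * d)" by (simp add: k power_mult[symmetric] mult.commute)
    hence "z \<in> H" using E_nat[of k] cis_pow[of "k * d"] by (simp add: E_def)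
    moreover have "z ^ (2 * M) = (z ^ (2 * m)) ^ d" by (simp add: m power_mult[symmetric] mult_ac)
    hence "z ^ (2 * M) = 1" using z by simp
    ultimately show "z \<in> {z \<in> H. z ^ (2 * M) = 1}" by simp
  qed
  thus ?thesis using that[of m] m0 m by simp
qed

section \<open>Roots of unity contained in the rings\<close>

context totally_real
begin

definition U :: "nat \<Rightarrow> complex set"
  where "U n = \<Lambda> n \<inter> carrier roots_of_unity"

lemma U_one: "1 \<in> U n" by (simp add: U_def O_ring.span2_one roots_of_unity_one)

lemma U_mult: "n \<in> Q \<Longrightarrow> x \<in> U n \<Longrightarrow> y \<in> U n \<Longrightarrow> x * y \<in> U n"
  by (simp add: U_def \<Lambda>_mult roots_of_unity_mult)

lemma U_power: "n \<in> Q \<Longrightarrow> x \<in> U n \<Longrightarrow> x ^ k \<in> U n"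
  by (induction k) (auto intro: U_one U_mult)

lemma U_norm: "x \<in> U n \<Longrightarrow> norm x = 1" by (simp add: U_def roots_of_unity_norm)

lemma U_inverse: "n \<in> Q \<Longrightarrow> x \<in> U n \<Longrightarrow> inverse x \<in> U n"
  using \<Lambda>_cnj[of n x] unit_cnj[OF U_norm, of x n] by (simp add: U_def roots_of_unity_inverse)

lemma U_cnj: "n \<in> Q \<Longrightarrow> x \<in> U n \<Longrightarrow> cnj x \<in> U n"
  using U_inverse[of n x] unit_cnj[OF U_norm, of x n] by simp

lemma \<zeta>_roots_of_unity: "n > 0 \<Longrightarrow> \<zeta> n \<in> carrier roots_of_unity"
  using \<zeta>_root by (auto simp: carrier_roots_of_unity)

lemma U_base: "n \<in> Q \<Longrightarrow> \<zeta> (2 * n) \<in> U n"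
  using Q_pos[of n] by (simp add: U_def O_ring.span2_base \<zeta>_roots_of_unity)

lemma U_minus_one: "n \<in> Q \<Longrightarrow> - 1 \<in> U n"
  unfolding U_def carrier_roots_of_unity
  using O_ring.span2_minus[OF O_ring.span2_one] by (auto intro: exI[of _ 2])

text \<open>Elements of \<open>U n\<close> of bounded order form a finite cyclic group, say of order
  \<open>2 * m\<close>; as it contains \<open>\<zeta> (2 * n)\<close>, the number \<open>m\<close>
  is a multiple of \<open>n\<close>, and its generator has trace in \<open>K\<close>.\<close>

lemma U_elem:
  assumes n: "n \<in> Q" and z: "z \<in> U n"
  obtains m where "m \<in> Q" "n dvd m" "z ^ (2 * m) = 1" "\<zeta> (2 * m) \<in> U n"
proof -
  obtain N where N: "N > 0" "z ^ N = 1" using z by (auto simp: U_def carrier_roots_of_unity)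
  \<comment> \<open>The level \<open>n * N\<close> captures both \<open>z\<close>, of order dividing
    \<open>N\<close>, and \<open>\<zeta> (2 * n)\<close>.\<close>
  have pos: "n * N > 0" using N(1) Q_pos[OF n] by simp
  obtain m where m: "m > 0" "m dvd n * N" "{z \<in> U n. z ^ (2 * (n * N)) = 1} = {z. z ^ (2 * m) = 1}"
    by (rule reflection_closed_roots[OF U_one U_minus_one[OF n] pos])
      (use n in \<open>auto intro!: U_mult U_power U_cnj\<close>)
  have "z ^ (2 * (n * N)) = (z ^ N) ^ (2 * n)" by (simp add: power_mult[symmetric] mult_ac)
  hence "z ^ (2 * m) = 1" using m(3) z N(2) by auto
  moreover have "\<zeta> (2 * m) \<in> U n" using m(1,3) \<zeta>_root[of "2 * m"] by auto
  moreover have "n dvd m"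
  proof -
    have "\<zeta> (2 * n) ^ (2 * (n * N)) = (\<zeta> (2 * n) ^ (2 * n)) ^ N" by (simp add: power_mult[symmetric] mult_ac)
    also have "\<dots> = 1" using \<zeta>_root[of "2 * n"] Q_pos[OF n] by simp
    finally have "\<zeta> (2 * n) ^ (2 * m) = 1" using U_base[OF n] m(3) by blast
    hence "2 * n dvd 2 * m" using \<zeta>_power_eq_one[of "2 * n"] Q_pos[OF n] by simp
    thus ?thesis by simp
  qed
  moreover have "m \<in> Q"
  proof -
    have "2 * Re (\<zeta> (2 * m)) \<in> \<O>" using \<open>\<zeta> (2 * m) \<in> U n\<close> \<Lambda>_trace[OF n] by (simp add: U_def)
    moreover have "m > 1" using dvd_imp_le[OF \<open>n dvd m\<close> m(1)] Q_gt_1[OF n] by linarith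
    ultimately show ?thesis using O_K by (simp add: Q_vertices_iff Re_\<zeta>_double)
  qed
  ultimately show ?thesis using that by blast
qed

text \<open>Any further root of unity would produce a proper multiple \<open>m\<close> of
  \<open>n\<close>, and a power of \<open>\<zeta> (2 * m)\<close> is
  \<open>\<zeta> (2 * (n * q))\<close> for a prime \<open>q\<close>, which
  \<open>\<Lambda> n\<close> does not contain.\<close>

lemma U_primepow:
  assumes n: "n \<in> Q" and pp: "primepow n"
  shows "U n = {z. z ^ (2 * n) = 1}"
proof (intro equalityI subsetI)
  fix z assume "z \<in> U n"
  then obtain m where m: "m \<in> Q" "n dvd m" "z ^ (2 * m) = 1" "\<zeta> (2 * m) \<in> U n" using U_elem[OF n] by blast
  have "m = n"
  proof (rule ccontr)
    assume "m \<noteq> n"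
    obtain k where k: "m = n * k" using m(2) by blast
    have k1: "k \<noteq> 1" "k > 0" using \<open>m \<noteq> n\<close> k Q_pos[OF m(1)] by (auto intro: Nat.gr0I)
    then obtain q where q: "Factorial_Ring.prime q" "q dvd k" using prime_factor_nat by blast
    then obtain j where j: "k = q * j" by blast
    have "j > 0" using j k1 by (auto intro: Nat.gr0I)
    hence "\<zeta> (2 * (n * q)) = \<zeta> (2 * m) ^ j" using \<zeta>_mult_power[of j "2 * (n * q)"] by (simp add: k j mult_ac)
    hence "\<zeta> (2 * (n * q)) \<in> U n" using U_power[OF n m(4)] by simp
    thus False using prime_multiple_notin_\<Lambda>[OF n pp q(1)] by (simp add: U_def)
  qed
  thus "z \<in> {z. z ^ (2 * n) = 1}" using m(3) by simp
next
  fix z :: complex assume "z \<in> {z. z ^ (2 * n) = 1}"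
  then obtain k where "z = \<zeta> (2 * n) ^ k"
    using root_of_unity_\<zeta>_power[of "2 * n" z] Q_pos[OF n] by auto
  thus "z \<in> U n" using U_power[OF n U_base[OF n]] by simp
qed

lemma component_eq:
  assumes "C \<in> Q_components K" "n \<in> C"
  shows "n \<in> Q" "C = connected_rel `` {n}"
proof -
  obtain x where x: "x \<in> Q" "C = connected_rel `` {x}"
    using assms(1) unfolding Q_components_def by (auto elim: quotientE)
  hence xn: "(x, n) \<in> connected_rel" using assms(2) by simp
  thus "n \<in> Q" using connected_lcm[OF _ x(1)] by blast
  have sym: "sym connected_rel" by (intro sym_rtrancl sym_Un_converse)
  have "(n, x) \<in> connected_rel" using xn sym by (auto dest: symD)
  thus "C = connected_rel `` {n}" unfolding x(2) using xn by (auto intro: rtrancl_trans)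
qed

text \<open>A root of unity in \<open>\<Lambda> n\<close> has a level that is a multiple of
  \<open>n\<close> in \<open>Q\<close>, hence in \<open>C\<close>. Conversely, a vertex
  \<open>m\<close> of \<open>C\<close> need not be a multiple of \<open>n\<close>, but
  \<open>lcm n m\<close> is one and lies in \<open>Q\<close>, so its root is absorbed and
  \<open>\<zeta> (2 * m)\<close> is a power of it.\<close>

lemma U_not_primepow:
  assumes C: "C \<in> Q_components K" "n \<in> C" and npp: "\<not> primepow n"
  shows "U n = mu_set C"
proof (intro equalityI subsetI)
  have n: "n \<in> Q" and Cn: "C = connected_rel `` {n}" using component_eq[OF C] by auto
  {
    fix z assume "z \<in> U n"
    then obtain m where m: "m \<in> Q" "n dvd m" "z ^ (2 * m) = 1" using U_elem[OF n] by blast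
    have "m \<in> C" using dvd_connected[OF n m(1,2)] by (simp add: Cn)
    thus "z \<in> mu_set C" using root_in_mu_set m Q_pos by blast
  }
  have "mu_set C \<subseteq> U n"
    unfolding mu_set_def
  proof (rule generate_roots_of_unity_subset)
    show "(\<lambda>n. \<zeta> (2 * n)) ` C \<subseteq> U n"
    proof safe
      fix m assume "m \<in> C"
      hence m: "m \<in> Q" "lcm n m \<in> Q" using connected_lcm[OF _ n] by (auto simp: Cn)
      obtain k where k: "lcm n m = n * k" by (metis dvd_lcm1 dvdE)
      obtain j where j: "lcm n m = m * j" by (metis dvd_lcm2 dvdE)
      have "j > 0" using j Q_pos[OF m(2)] by (auto intro: Nat.gr0I)
      have "\<zeta> (2 * lcm n m) \<in> \<Lambda> n" using multiple_in_\<Lambda>[OF n _ npp, of k] m(2) k by simp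
      hence "\<zeta> (2 * lcm n m) \<in> U n" using \<zeta>_roots_of_unity[of "2 * lcm n m"] Q_pos[OF m(2)] by (simp add: U_def)
      moreover have "\<zeta> (2 * m) = \<zeta> (2 * lcm n m) ^ j"
        using \<zeta>_mult_power[of j "2 * m"] \<open>j > 0\<close> by (simp add: j mult.assoc)
      ultimately show "\<zeta> (2 * m) \<in> U n" using U_power[OF n] by simp
    qed
    show "U n \<subseteq> carrier roots_of_unity" by (auto simp: U_def)
  qed (use n in \<open>auto intro: U_one U_mult U_inverse\<close>)
  thus "z \<in> U n" if "z \<in> mu_set C" for z using that by blast
qed

lemma U_in_family:
  assumes n: "n \<in> Q"
  shows "\<exists>C \<in> P_family K \<union> R_family K. U n = mu_set C"
proof (cases "primepow n")
  case True
  hence "U n = mu_set {n}" using U_primepow[OF n] mu_set_singleton[OF Q_pos[OF n]] by simp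
  thus ?thesis using True n by (auto simp: P_family_def)
next
  case False
  let ?C = "connected_rel `` {n}"
  have "?C \<in> Q_components K" "n \<in> ?C" using n by (auto simp: Q_components_def intro: quotientI)
  thus ?thesis using U_not_primepow[of ?C n] False unfolding R_family_def by blast
qed

lemma family_is_U:
  assumes "C \<in> P_family K \<union> R_family K"
  shows "\<exists>n\<in>Q. mu_set C = U n"
  using assms
proof
  assume "C \<in> P_family K"
  then obtain q where "C = {q}" "q \<in> Q" "primepow q" by (auto simp: P_family_def)
  thus ?thesis using U_primepow[of q] mu_set_singleton[of q] Q_pos[of q] by auto
next
  assume "C \<in> R_family K"
  then obtain n where "C \<in> Q_components K" "n \<in> C" "\<not> primepow n" by (auto simp: R_family_def)
  thus ?thesis using U_not_primepow component_eq(1) by metis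
qed

lemma \<Lambda>_subset: "m \<in> Q \<Longrightarrow> \<zeta> (2 * n) \<in> \<Lambda> m \<Longrightarrow> \<Lambda> n \<subseteq> \<Lambda> m"
  by (auto simp: span2_def[of _ "\<zeta> (2 * n)"] intro!: O_ring.span2_add O_ring.span2_of_real O_ring.span2_smult)

lemma U_eq_imp_\<Lambda>_eq:
  assumes "n \<in> Q" "m \<in> Q" "U n = U m"
  shows "\<Lambda> n = \<Lambda> m"
  using \<Lambda>_subset[of m n] \<Lambda>_subset[of n m] U_base[of n] U_base[of m] assms unfolding U_def by blast

end

section \<open>Rank two root lattices\<close>

text \<open>Replaces unique coefficient functions by unique pairs of coefficients. It serves the
  lattices over \<open>\<O>\<close> as well as the scalar extension over \<open>K\<close>; for the
  latter its hypotheses are much less work than the module axioms.\<close>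

lemma finite_basis_pair_iff:
  fixes R (structure) and M (structure)
  assumes "abelian_monoid M" "e \<noteq> f" and e: "e \<in> carrier M" and f: "f \<in> carrier M"
    and smult: "\<And>a. a \<in> carrier R \<Longrightarrow> a \<odot>\<^bsub>M\<^esub> e \<in> carrier M" "\<And>a. a \<in> carrier R \<Longrightarrow> a \<odot>\<^bsub>M\<^esub> f \<in> carrier M"
  shows "finite_basis R M {e, f} \<longleftrightarrow>
    (\<forall>x\<in>carrier M. \<exists>a\<in>carrier R. \<exists>b\<in>carrier R. x = a \<odot>\<^bsub>M\<^esub> e \<oplus>\<^bsub>M\<^esub> b \<odot>\<^bsub>M\<^esub> f \<and>
      (\<forall>a'\<in>carrier R. \<forall>b'\<in>carrier R. x = a' \<odot>\<^bsub>M\<^esub> e \<oplus>\<^bsub>M\<^esub> b' \<odot>\<^bsub>M\<^esub> f \<longrightarrow> a' = a \<and> b' = b))"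
proof -
  interpret M: abelian_monoid M by fact
  have sum: "finsum M (\<lambda>b. c b \<odot>\<^bsub>M\<^esub> b) {e, f} = c e \<odot>\<^bsub>M\<^esub> e \<oplus>\<^bsub>M\<^esub> c f \<odot>\<^bsub>M\<^esub> f"
    if "c e \<in> carrier R" "c f \<in> carrier R" for c
    using that assms by (subst M.finsum_insert) (auto simp: M.finsum_insert)
  have "(\<exists>!c. c \<in> {e, f} \<rightarrow>\<^sub>E carrier R \<and> x = finsum M (\<lambda>b. c b \<odot>\<^bsub>M\<^esub> b) {e, f}) \<longleftrightarrow>
    (\<exists>a\<in>carrier R. \<exists>b\<in>carrier R. x = a \<odot>\<^bsub>M\<^esub> e \<oplus>\<^bsub>M\<^esub> b \<odot>\<^bsub>M\<^esub> f \<and>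
      (\<forall>a'\<in>carrier R. \<forall>b'\<in>carrier R. x = a' \<odot>\<^bsub>M\<^esub> e \<oplus>\<^bsub>M\<^esub> b' \<odot>\<^bsub>M\<^esub> f \<longrightarrow> a' = a \<and> b' = b))"
    (is "?L \<longleftrightarrow> ?R") for x
  proof
    assume ?L
    then obtain c where c: "c \<in> {e, f} \<rightarrow>\<^sub>E carrier R" "x = finsum M (\<lambda>b. c b \<odot>\<^bsub>M\<^esub> b) {e, f}"
      and uniq: "\<And>c'. c' \<in> {e, f} \<rightarrow>\<^sub>E carrier R \<Longrightarrow> x = finsum M (\<lambda>b. c' b \<odot>\<^bsub>M\<^esub> b) {e, f} \<Longrightarrow> c' = c"
      by blast
    have cc: "c e \<in> carrier R" "c f \<in> carrier R" using c(1) by auto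
    show ?R
    proof (rule bexI[OF _ cc(1)], rule bexI[OF _ cc(2)], intro conjI ballI impI)
      show "x = c e \<odot>\<^bsub>M\<^esub> e \<oplus>\<^bsub>M\<^esub> c f \<odot>\<^bsub>M\<^esub> f" using c(2) sum[OF cc] by simp
    next
      fix a' b' assume ab: "a' \<in> carrier R" "b' \<in> carrier R" "x = a' \<odot>\<^bsub>M\<^esub> e \<oplus>\<^bsub>M\<^esub> b' \<odot>\<^bsub>M\<^esub> f"
      \<comment> \<open>The value \<open>undefined\<close> off the pair makes the function
        extensional, as membership in the extensional function space requires.\<close>
      define c' where "c' = (\<lambda>v. if v = e then a' else if v = f then b' else undefined)"
      have c'v: "c' e = a'" "c' f = b'" using \<open>e \<noteq> f\<close> by (auto simp: c'_def)
      have "c' \<in> {e, f} \<rightarrow>\<^sub>E carrier R" using ab by (auto simp: c'_def PiE_def extensional_def)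
      hence "c' = c" using uniq sum[of c'] c'v ab by simp
      thus "a' = c e" "b' = c f" using c'v by auto
    qed
  next
    assume ?R
    then obtain a b where ab: "a \<in> carrier R" "b \<in> carrier R" "x = a \<odot>\<^bsub>M\<^esub> e \<oplus>\<^bsub>M\<^esub> b \<odot>\<^bsub>M\<^esub> f"
      and uniq: "\<And>a' b'. a' \<in> carrier R \<Longrightarrow> b' \<in> carrier R \<Longrightarrow> x = a' \<odot>\<^bsub>M\<^esub> e \<oplus>\<^bsub>M\<^esub> b' \<odot>\<^bsub>M\<^esub> f \<Longrightarrow> a' = a \<and> b' = b"
      by blast
    define c where "c = (\<lambda>v. if v = e then a else if v = f then b else undefined)"
    have cv: "c e = a" "c f = b" using \<open>e \<noteq> f\<close> by (auto simp: c_def)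
    show ?L
    proof (rule ex1I[of _ c], intro conjI)
      show "c \<in> {e, f} \<rightarrow>\<^sub>E carrier R" using ab by (auto simp: c_def PiE_def extensional_def)
      show "x = finsum M (\<lambda>b. c b \<odot>\<^bsub>M\<^esub> b) {e, f}" using sum[of c] cv ab by simp
    next
      fix c' assume c': "c' \<in> {e, f} \<rightarrow>\<^sub>E carrier R \<and> x = finsum M (\<lambda>b. c' b \<odot>\<^bsub>M\<^esub> b) {e, f}"
      hence cc: "c' e \<in> carrier R" "c' f \<in> carrier R" by auto
      have "c' e = a \<and> c' f = b" using uniq[OF cc] c' sum[OF cc] by simp
      moreover have "c' v = undefined" if "v \<noteq> e" "v \<noteq> f" for v
        using c' that by (auto simp: PiE_def extensional_def)
      ultimately show "c' = c" by (auto simp: c_def)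
    qed
  qed
  thus ?thesis using e f by (simp add: finite_basis_def)
qed

lemma ring_of_type_algebra_simps [simp]:
  "x \<oplus>\<^bsub>ring_of_type_algebra\<^esub> y = x + y" "x \<otimes>\<^bsub>ring_of_type_algebra\<^esub> y = x * y"
  "\<zero>\<^bsub>ring_of_type_algebra\<^esub> = 0" "\<one>\<^bsub>ring_of_type_algebra\<^esub> = 1"
  by (simp_all add: ring_of_type_algebra_def)

lemma ring_on_simps [simp]:
  "carrier (ring_on S) = S" "x \<oplus>\<^bsub>ring_on S\<^esub> y = x + y" "x \<otimes>\<^bsub>ring_on S\<^esub> y = x * y"
  "\<zero>\<^bsub>ring_on S\<^esub> = 0" "\<one>\<^bsub>ring_on S\<^esub> = 1"
  by (simp_all add: ring_of_type_algebra_def)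

lemma (in real_subring) cring_ring_on: "cring (ring_on A)"
proof (rule cringI)
  show "abelian_group (ring_on A)"
    by (rule abelian_groupI) (auto intro: A_add A_zero bexI[of _ "- x" for x] A_minus simp: algebra_simps)
  show "comm_monoid (ring_on A)"
    by (rule comm_monoidI) (auto intro: A_mult A_one simp: algebra_simps)
qed (auto simp: algebra_simps)

lemma id_embedding: "id \<in> embeddings K"
  by (simp add: embeddings_iff)

section \<open>Products of roots and the Cauchy-Schwarz bound\<close>

locale o_lattice = totally_real K for K +
  fixes L :: "'a form_module"
  assumes L: "O_lattice K L"
begin

sublocale md: module "ring_on \<O>" L
  using L by (simp add: O_lattice_def)

lemma smult_in: "a \<in> \<O> \<Longrightarrow> x \<in> carrier L \<Longrightarrow> a \<odot>\<^bsub>L\<^esub> x \<in> carrier L"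
  using md.smult_closed by simp

lemma form_sym: "x \<in> carrier L \<Longrightarrow> y \<in> carrier L \<Longrightarrow> form L x y = form L y x"
  and form_O: "x \<in> carrier L \<Longrightarrow> y \<in> carrier L \<Longrightarrow> form L x y \<in> \<O>"
  and form_add: "x \<in> carrier L \<Longrightarrow> y \<in> carrier L \<Longrightarrow> z \<in> carrier L \<Longrightarrow> form L (x \<oplus>\<^bsub>L\<^esub> y) z = form L x z + form L y z"
  and form_smult: "a \<in> \<O> \<Longrightarrow> x \<in> carrier L \<Longrightarrow> z \<in> carrier L \<Longrightarrow> form L (a \<odot>\<^bsub>L\<^esub> x) z = a * form L x z"
  and form_pos: "\<tau> \<in> embeddings K \<Longrightarrow> x \<in> carrier L \<Longrightarrow> x \<noteq> \<zero>\<^bsub>L\<^esub> \<Longrightarrow> (\<tau> (form L x x) :: real) > 0"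
  and carrier_ne: "carrier L \<noteq> {\<zero>\<^bsub>L\<^esub>}"
  using L by (auto simp: O_lattice_def)

lemma form_add_right: "x \<in> carrier L \<Longrightarrow> y \<in> carrier L \<Longrightarrow> z \<in> carrier L \<Longrightarrow> form L z (x \<oplus>\<^bsub>L\<^esub> y) = form L z x + form L z y"
  using form_sym form_add by simp
lemma form_smult_right: "a \<in> \<O> \<Longrightarrow> x \<in> carrier L \<Longrightarrow> z \<in> carrier L \<Longrightarrow> form L z (a \<odot>\<^bsub>L\<^esub> x) = a * form L z x"
  using form_sym[of z] form_smult smult_in by simp

lemma form_comb:
  assumes "a \<in> \<O>" "b \<in> \<O>" "c \<in> \<O>" "d \<in> \<O>" "x \<in> carrier L" "y \<in> carrier L"
  shows "form L (a \<odot>\<^bsub>L\<^esub> x \<oplus>\<^bsub>L\<^esub> b \<odot>\<^bsub>L\<^esub> y) (c \<odot>\<^bsub>L\<^esub> x \<oplus>\<^bsub>L\<^esub> d \<odot>\<^bsub>L\<^esub> y) =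
    a * c * form L x x + (a * d + b * c) * form L x y + b * d * form L y y"
  using assms form_sym[of y x]
  by (simp add: form_add form_add_right form_smult form_smult_right smult_in algebra_simps)

lemma form_zero: "form L \<zero>\<^bsub>L\<^esub> \<zero>\<^bsub>L\<^esub> = 0"
  using form_add[of "\<zero>\<^bsub>L\<^esub>" "\<zero>\<^bsub>L\<^esub>" "\<zero>\<^bsub>L\<^esub>"] by simp

lemma form_nonneg: "\<tau> \<in> embeddings K \<Longrightarrow> x \<in> carrier L \<Longrightarrow> (\<tau> (form L x x) :: real) \<ge> 0"
proof (cases "x = \<zero>\<^bsub>L\<^esub>")
  case True
  assume "\<tau> \<in> embeddings K"
  thus ?thesis using True form_zero embedding_zero[of \<tau>] by simp
qed (use form_pos in fastforce)

lemma root_carrier: "x \<in> roots L \<Longrightarrow> x \<in> carrier L"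
  by (simp add: roots_def)

text \<open>The Cauchy-Schwarz inequality for the form transported by \<open>\<tau>\<close>, applied
  to two vectors of square 2.\<close>

lemma embedding_form_le_2:
  assumes "r \<in> roots L" "s \<in> roots L" and \<tau>: "\<tau> \<in> embeddings K"
  shows "\<bar>\<tau> (form L r s) :: real\<bar> \<le> 2"
proof -
  let ?c = "form L r s"
  have rs: "r \<in> carrier L" "s \<in> carrier L" "form L r r = 2" "form L s s = 2" using assms by (auto simp: roots_def)
  have c: "?c \<in> \<O>" using rs form_O by simp
  note hom = embedding_add[OF \<tau>] embedding_mult[OF \<tau>] embedding_minus[OF \<tau>]
  have s2: "\<tau> 2 = 2" using embedding_of_nat[OF \<tau>, of 2] by simp
  \<comment> \<open>Up to the factor \<open>- 2\<close> this is the component of \<open>s\<close>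
    orthogonal to \<open>r\<close>, scaled to have coefficients in \<open>\<O>\<close>; its square
    is \<open>2 * (4 - c^2)\<close>.\<close>
  let ?y = "?c \<odot>\<^bsub>L\<^esub> r \<oplus>\<^bsub>L\<^esub> (- 2) \<odot>\<^bsub>L\<^esub> s"
  have m2: "- 2 \<in> \<O>" using O_minus[OF O_two] .
  have "form L ?y ?y = ?c * ?c * 2 + (?c * (- 2) + (- 2) * ?c) * ?c + (- 2) * (- 2) * 2"
    unfolding form_comb[OF c m2 c m2 rs(1,2)] rs(3,4) ..
  also have "\<dots> = 2 * (2 * 2 + - (?c * ?c))" by (simp add: algebra_simps)
  finally have eq: "form L ?y ?y = 2 * (2 * 2 + - (?c * ?c))" .
  have cK: "?c \<in> K" using O_K[OF c] .
  have twoK: "2 \<in> K" using O_K[OF O_two] .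
  have "\<tau> (2 * (2 * 2 + - (?c * ?c))) = 2 * (2 * 2 + - (\<tau> ?c * \<tau> ?c))"
    using cK twoK by (simp only: hom K_mult K_add K_minus s2)
  moreover have "?y \<in> carrier L" using rs c m2 smult_in by simp
  ultimately have "2 * (2 * 2 + - (\<tau> ?c * \<tau> ?c)) \<ge> 0" using form_nonneg[OF \<tau>, of ?y] eq by simp
  hence "(\<tau> ?c)\<^sup>2 \<le> 2\<^sup>2" by (simp add: power2_eq_square)
  thus ?thesis using abs_le_square_iff[of "\<tau> ?c" 2] by simp
qed

lemma root_form_kronecker:
  assumes "r \<in> roots L" "s \<in> roots L"
  obtains w where "w \<in> carrier roots_of_unity" "w + inverse w = of_real (form L r s)"
proof -
  have c: "form L r s \<in> \<O>" using assms form_O root_carrier by simp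
  show ?thesis
  proof (rule O_kronecker[OF c])
    show "\<bar>\<tau> (form L r s)\<bar> \<le> 2" if "\<tau> \<in> embeddings K" for \<tau> :: "real \<Rightarrow> real"
      using embedding_form_le_2[OF assms that] .
  next
    fix w :: complex and N :: nat
    assume "N > 0" "w ^ N = 1" "w + inverse w = of_real (form L r s)"
    thus ?thesis by (intro that[of w]) (auto simp: carrier_roots_of_unity)
  qed
qed

lemma finsum_span:
  assumes "finite F" "F \<subseteq> carrier L" "c \<in> F \<rightarrow> \<O>"
    and S: "\<zero>\<^bsub>L\<^esub> \<in> S" "\<And>x y. x \<in> S \<Longrightarrow> y \<in> S \<Longrightarrow> x \<in> carrier L \<Longrightarrow> y \<in> carrier L \<Longrightarrow> x \<oplus>\<^bsub>L\<^esub> y \<in> S"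
      "\<And>a x. a \<in> \<O> \<Longrightarrow> x \<in> F \<Longrightarrow> a \<odot>\<^bsub>L\<^esub> x \<in> S"
  shows "finsum L (\<lambda>v. c v \<odot>\<^bsub>L\<^esub> v) F \<in> S"
  using assms(1,2,3,6)
proof (induction F)
  case empty
  thus ?case using S(1) by simp
next
  case (insert v F)
  have c: "c v \<in> \<O>" "c \<in> F \<rightarrow> \<O>" using insert.prems by auto
  have closed: "(\<lambda>v. c v \<odot>\<^bsub>L\<^esub> v) \<in> F \<rightarrow> carrier L" "c v \<odot>\<^bsub>L\<^esub> v \<in> carrier L"
    using insert.prems by (auto intro!: smult_in)
  have "finsum L (\<lambda>v. c v \<odot>\<^bsub>L\<^esub> v) F \<in> S" using insert.IH insert.prems c by auto
  moreover have "c v \<odot>\<^bsub>L\<^esub> v \<in> S" using insert.prems c by auto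
  ultimately show ?case
    using closed insert.hyps by (simp add: S(2))
qed

end

text \<open>With this normalisation of the form, the roots are precisely the elements sent to the
  unit circle.\<close>

definition realises :: "real set \<Rightarrow> 'a form_module \<Rightarrow> ('a \<Rightarrow> complex) \<Rightarrow> bool"
  where "realises K L \<phi> \<longleftrightarrow> inj_on \<phi> (carrier L) \<and>
    (\<forall>x\<in>carrier L. \<forall>y\<in>carrier L. \<phi> (x \<oplus>\<^bsub>L\<^esub> y) = \<phi> x + \<phi> y) \<and>
    (\<forall>a\<in>integers_of K. \<forall>x\<in>carrier L. \<phi> (a \<odot>\<^bsub>L\<^esub> x) = of_real a * \<phi> x) \<and>
    (\<forall>x\<in>carrier L. \<forall>y\<in>carrier L. form L x y = 2 * Re (\<phi> x * cnj (\<phi> y)))"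

lemma Re_mult_cnj_self: "Re (z * cnj z) = (norm z)\<^sup>2"
  by (simp only: complex_norm_square[symmetric] Re_complex_of_real)

lemma unit_eq_Re_imp:
  assumes "norm w = 1" "norm g = 1" "Re w = Re g"
  shows "g = w \<or> g = cnj w"
proof -
  have "(Re w)\<^sup>2 + (Im w)\<^sup>2 = (Re g)\<^sup>2 + (Im g)\<^sup>2" using assms(1,2) by (metis cmod_power2)
  hence "Im g = Im w \<or> Im g = - Im w" using assms(3) by (auto simp: power2_eq_iff)
  thus ?thesis using assms(3) by (auto simp: complex_eq_iff)
qed

lemma realises_rotate:
  assumes "realises K L \<phi>" "norm u = 1"
  shows "realises K L (\<lambda>x. \<phi> x * u)"
proof -
  have u: "u \<noteq> 0" using assms(2) by auto
  have *: "x * u * cnj (y * u) = x * cnj y" for x y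
  proof -
    have "x * u * cnj (y * u) = x * cnj y * (u * cnj u)" by simp
    thus ?thesis unfolding unit_mult_cnj[OF assms(2)] by simp
  qed
  have "inj_on (\<lambda>x. \<phi> x * u) (carrier L)"
    using assms(1) u unfolding realises_def inj_on_def by simp
  thus ?thesis
    using assms(1) unfolding realises_def * by (simp add: distrib_right)
qed

lemma exists_common_order:
  assumes "finite S" "S \<subseteq> carrier roots_of_unity"
  shows "\<exists>N>0. \<forall>z\<in>S. z ^ N = 1"
  using assms
proof (induction S)
  case (insert z S)
  then obtain N M where N: "N > 0" "\<forall>z\<in>S. z ^ N = 1" and M: "M > 0" "z ^ M = 1"
    by (auto simp: carrier_roots_of_unity)
  have "w ^ (N * M) = 1" if "w \<in> S" for w using N that by (simp add: power_mult)
  moreover have "z ^ (N * M) = 1" using M by (simp add: mult.commute[of N] power_mult)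
  ultimately show ?case using N M by (intro exI[of _ "N * M"]) auto
qed (auto intro: exI[of _ 1])

locale rank2_root_lattice = totally_real K for K +
  fixes L :: "'a form_module"
  assumes L2: "L \<in> rank2_root_lattices K"
begin

sublocale o_lattice K L
  using L2 by unfold_locales (simp add: rank2_root_lattices_def root_lattice_def)

lemma rank2_basis:
  "\<exists>e\<in>carrier L. \<exists>f\<in>carrier L.
    (\<forall>x\<in>carrier L. \<exists>a\<in>\<O>. \<exists>b\<in>\<O>. x = a \<odot>\<^bsub>L\<^esub> e \<oplus>\<^bsub>L\<^esub> b \<odot>\<^bsub>L\<^esub> f) \<and>
    (\<forall>a\<in>\<O>. \<forall>b\<in>\<O>. \<forall>a'\<in>\<O>. \<forall>b'\<in>\<O>.
      a \<odot>\<^bsub>L\<^esub> e \<oplus>\<^bsub>L\<^esub> b \<odot>\<^bsub>L\<^esub> f = a' \<odot>\<^bsub>L\<^esub> e \<oplus>\<^bsub>L\<^esub> b' \<odot>\<^bsub>L\<^esub> f \<longrightarrow> a = a' \<and> b = b')"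
proof -
  obtain B where B: "finite_basis (ring_on \<O>) L B" "card B = 2"
    using L2 by (auto simp: rank2_root_lattices_def has_rank_def)
  then obtain e f where ef: "B = {e, f}" "e \<noteq> f" by (auto simp: card_2_iff)
  have c: "e \<in> carrier L" "f \<in> carrier L" using B(1) by (auto simp: finite_basis_def ef)
  have fb: "\<forall>x\<in>carrier L. \<exists>a\<in>\<O>. \<exists>b\<in>\<O>. x = a \<odot>\<^bsub>L\<^esub> e \<oplus>\<^bsub>L\<^esub> b \<odot>\<^bsub>L\<^esub> f \<and>
      (\<forall>a'\<in>\<O>. \<forall>b'\<in>\<O>. x = a' \<odot>\<^bsub>L\<^esub> e \<oplus>\<^bsub>L\<^esub> b' \<odot>\<^bsub>L\<^esub> f \<longrightarrow> a' = a \<and> b' = b)"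
    using B(1) finite_basis_pair_iff[OF md.abelian_monoid_axioms ef(2) c, of "ring_on \<O>"] c smult_in
    unfolding ef(1) by simp
  show ?thesis
  proof (rule bexI[OF _ c(1)], rule bexI[OF _ c(2)], intro conjI ballI impI)
    show "\<exists>a\<in>\<O>. \<exists>b\<in>\<O>. x = a \<odot>\<^bsub>L\<^esub> e \<oplus>\<^bsub>L\<^esub> b \<odot>\<^bsub>L\<^esub> f" if "x \<in> carrier L" for x
      using fb that by blast
  next
    fix a b a' b'
    assume ab: "a \<in> \<O>" "b \<in> \<O>" "a' \<in> \<O>" "b' \<in> \<O>" "a \<odot>\<^bsub>L\<^esub> e \<oplus>\<^bsub>L\<^esub> b \<odot>\<^bsub>L\<^esub> f = a' \<odot>\<^bsub>L\<^esub> e \<oplus>\<^bsub>L\<^esub> b' \<odot>\<^bsub>L\<^esub> f"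
    let ?x = "a \<odot>\<^bsub>L\<^esub> e \<oplus>\<^bsub>L\<^esub> b \<odot>\<^bsub>L\<^esub> f"
    have "?x \<in> carrier L" using ab c smult_in by simp
    then obtain p q where "\<forall>a'\<in>\<O>. \<forall>b'\<in>\<O>. ?x = a' \<odot>\<^bsub>L\<^esub> e \<oplus>\<^bsub>L\<^esub> b' \<odot>\<^bsub>L\<^esub> f \<longrightarrow> a' = p \<and> b' = q"
      using fb by blast
    thus "a = a'" "b = b'" using ab by metis+
  qed
qed

lemma exists_root: "roots L \<noteq> {}"
proof
  assume "roots L = {}"
  hence "generates (ring_on \<O>) L {}" using L2 by (simp add: rank2_root_lattices_def root_lattice_def)
  hence "carrier L \<subseteq> {\<zero>\<^bsub>L\<^esub>}" by (auto simp: generates_def)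
  thus False using carrier_ne by auto
qed

text \<open>Cholesky decomposition of the Gram matrix of a basis, positive definite under the
  identity embedding. The last conclusion says that the two basis vectors are not sent to one real
  line.\<close>

lemma exists_realisation:
  obtains \<phi> e f where "realises K L \<phi>" "e \<in> carrier L" "f \<in> carrier L"
    "\<forall>x\<in>carrier L. \<exists>a\<in>\<O>. \<exists>b\<in>\<O>. x = a \<odot>\<^bsub>L\<^esub> e \<oplus>\<^bsub>L\<^esub> b \<odot>\<^bsub>L\<^esub> f"
    "Im (\<phi> e * cnj (\<phi> f)) \<noteq> 0"
proof -
  obtain e f where ef: "e \<in> carrier L" "f \<in> carrier L"
    and ex: "\<And>x. x \<in> carrier L \<Longrightarrow> \<exists>a\<in>\<O>. \<exists>b\<in>\<O>. x = a \<odot>\<^bsub>L\<^esub> e \<oplus>\<^bsub>L\<^esub> b \<odot>\<^bsub>L\<^esub> f"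
    and uniq: "\<And>a b a' b'. a \<in> \<O> \<Longrightarrow> b \<in> \<O> \<Longrightarrow> a' \<in> \<O> \<Longrightarrow> b' \<in> \<O> \<Longrightarrow>
      a \<odot>\<^bsub>L\<^esub> e \<oplus>\<^bsub>L\<^esub> b \<odot>\<^bsub>L\<^esub> f = a' \<odot>\<^bsub>L\<^esub> e \<oplus>\<^bsub>L\<^esub> b' \<odot>\<^bsub>L\<^esub> f \<Longrightarrow> a = a' \<and> b = b'"
    using rank2_basis by blast
  define A where "A = form L e e"
  define B where "B = form L e f"
  define D where "D = form L f f"
  have ABD: "A \<in> \<O>" "B \<in> \<O>" "D \<in> \<O>" using ef form_O by (auto simp: A_def B_def D_def)
  have zero_comb: "0 \<odot>\<^bsub>L\<^esub> e \<oplus>\<^bsub>L\<^esub> 0 \<odot>\<^bsub>L\<^esub> f = \<zero>\<^bsub>L\<^esub>" using ef md.smult_l_null by simp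
  have nz: "a \<odot>\<^bsub>L\<^esub> e \<oplus>\<^bsub>L\<^esub> b \<odot>\<^bsub>L\<^esub> f \<noteq> \<zero>\<^bsub>L\<^esub>" if "a \<in> \<O>" "b \<in> \<O>" "a \<noteq> 0 \<or> b \<noteq> 0" for a b
    using uniq[OF that(1,2) O_zero O_zero] zero_comb that(3) by auto
  have pos: "a * a * A + (a * b + b * a) * B + b * b * D > 0" if "a \<in> \<O>" "b \<in> \<O>" "a \<noteq> 0 \<or> b \<noteq> 0" for a b
    using form_pos[OF id_embedding _ nz[OF that]] form_comb[OF that(1,2) that(1,2) ef] ef that(1,2) smult_in
    by (simp add: A_def B_def D_def)
  have A: "A > 0" using pos[OF O_one O_zero] by simp
  \<comment> \<open>The square of the vector \<open>B e - A f\<close>, which needs no division,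
    equals \<open>A * (A * D - B * B)\<close>.\<close>
  have "B * B * A + (B * - A + - A * B) * B + - A * - A * D > 0"
    using pos[OF ABD(2) O_minus[OF ABD(1)]] A by simp
  hence "A * (A * D - B * B) > 0" by (simp add: algebra_simps)
  hence disc: "A * D - B * B > 0" using A by (simp add: zero_less_mult_iff)
  \<comment> \<open>The images \<open>u\<close> of \<open>e\<close> and \<open>v\<close> of
    \<open>f\<close> are determined by \<open>2 * u^2 = A\<close>, \<open>2 * u * Re v = B\<close>
    and \<open>2 * norm v ^ 2 = D\<close>, up to the sign of \<open>Im v\<close>.\<close>
  define u where "u = sqrt (A / 2)"
  define s where "s = sqrt (D / 2 - (B / (2 * u))\<^sup>2)"
  define v where "v = Complex (B / (2 * u)) s"
  have u: "u > 0" "u * u = A / 2" using A by (auto simp: u_def)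
  have "(B / (2 * u))\<^sup>2 = B * B / (2 * A)" using u A by (simp add: power2_eq_square)
  moreover have "D / 2 - B * B / (2 * A) = (A * D - B * B) / (2 * A)" using A by (simp add: field_simps)
  ultimately have "D / 2 - (B / (2 * u))\<^sup>2 > 0" using disc A by simp
  hence s: "s > 0" "s * s = D / 2 - (B / (2 * u))\<^sup>2" by (auto simp: s_def)
  have gram: "2 * Re ((of_real a * of_real u + of_real b * v) * cnj (of_real c * of_real u + of_real d * v)) =
      a * c * A + (a * d + b * c) * B + b * d * D" for a b c d :: real
  proof -
    define t where "t = B / (2 * u)"
    have t: "2 * (u * t) = B" using u by (simp add: t_def)
    have s': "s * s = D / 2 - t * t" using s(2) by (simp add: t_def power2_eq_square)
    have "2 * Re ((of_real a * of_real u + of_real b * v) * cnj (of_real c * of_real u + of_real d * v)) =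
      2 * (a * c * (u * u) + b * d * (s * s + t * t)) + (a * d + b * c) * (2 * (u * t))"
      unfolding v_def t_def[symmetric] by (simp add: algebra_simps)
    also have "\<dots> = a * c * A + (a * d + b * c) * B + b * d * D"
      unfolding u(2) t s' by (simp add: algebra_simps)
    finally show ?thesis .
  qed
  define ca where "ca x = (SOME a. a \<in> \<O> \<and> (\<exists>b\<in>\<O>. x = a \<odot>\<^bsub>L\<^esub> e \<oplus>\<^bsub>L\<^esub> b \<odot>\<^bsub>L\<^esub> f))" for x
  define cb where "cb x = (SOME b. b \<in> \<O> \<and> (\<exists>a\<in>\<O>. x = a \<odot>\<^bsub>L\<^esub> e \<oplus>\<^bsub>L\<^esub> b \<odot>\<^bsub>L\<^esub> f))" for x
  have coord: "ca (a \<odot>\<^bsub>L\<^esub> e \<oplus>\<^bsub>L\<^esub> b \<odot>\<^bsub>L\<^esub> f) = a" "cb (a \<odot>\<^bsub>L\<^esub> e \<oplus>\<^bsub>L\<^esub> b \<odot>\<^bsub>L\<^esub> f) = b"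
    if "a \<in> \<O>" "b \<in> \<O>" for a b
  proof -
    let ?x = "a \<odot>\<^bsub>L\<^esub> e \<oplus>\<^bsub>L\<^esub> b \<odot>\<^bsub>L\<^esub> f"
    have "ca ?x \<in> \<O> \<and> (\<exists>b\<in>\<O>. ?x = ca ?x \<odot>\<^bsub>L\<^esub> e \<oplus>\<^bsub>L\<^esub> b \<odot>\<^bsub>L\<^esub> f)"
      unfolding ca_def by (rule someI[of _ a]) (use that in blast)
    thus "ca ?x = a" using uniq[OF that] by metis
    have "cb ?x \<in> \<O> \<and> (\<exists>a\<in>\<O>. ?x = a \<odot>\<^bsub>L\<^esub> e \<oplus>\<^bsub>L\<^esub> cb ?x \<odot>\<^bsub>L\<^esub> f)"
      unfolding cb_def by (rule someI[of _ b]) (use that in blast)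
    thus "cb ?x = b" using uniq[OF that] by metis
  qed
  define \<phi> where "\<phi> x = of_real (ca x) * of_real u + of_real (cb x) * v" for x
  have \<phi>: "\<phi> (a \<odot>\<^bsub>L\<^esub> e \<oplus>\<^bsub>L\<^esub> b \<odot>\<^bsub>L\<^esub> f) = of_real a * of_real u + of_real b * v" if "a \<in> \<O>" "b \<in> \<O>" for a b
    unfolding \<phi>_def coord[OF that] ..
  have "realises K L \<phi>"
    unfolding realises_def
  proof (intro conjI ballI)
    show "inj_on \<phi> (carrier L)"
    proof (rule inj_onI)
      fix x y assume xy: "x \<in> carrier L" "y \<in> carrier L" "\<phi> x = \<phi> y"
      obtain a b where x: "a \<in> \<O>" "b \<in> \<O>" "x = a \<odot>\<^bsub>L\<^esub> e \<oplus>\<^bsub>L\<^esub> b \<odot>\<^bsub>L\<^esub> f" using ex[OF xy(1)] by blast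
      obtain c d where y: "c \<in> \<O>" "d \<in> \<O>" "y = c \<odot>\<^bsub>L\<^esub> e \<oplus>\<^bsub>L\<^esub> d \<odot>\<^bsub>L\<^esub> f" using ex[OF xy(2)] by blast
      have eq: "of_real a * of_real u + of_real b * v = of_real c * of_real u + of_real d * v"
        using xy(3) x y \<phi> by simp
      have "b * s = d * s" using arg_cong[OF eq, of Im] by (simp add: v_def)
      hence "b = d" using s by simp
      hence "a * u = c * u" using arg_cong[OF eq, of Re] by simp
      thus "x = y" using u \<open>b = d\<close> x y by simp
    qed
  next
    fix x y assume xy: "x \<in> carrier L" "y \<in> carrier L"
    obtain a b where x: "a \<in> \<O>" "b \<in> \<O>" "x = a \<odot>\<^bsub>L\<^esub> e \<oplus>\<^bsub>L\<^esub> b \<odot>\<^bsub>L\<^esub> f" using ex[OF xy(1)] by blast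
    obtain c d where y: "c \<in> \<O>" "d \<in> \<O>" "y = c \<odot>\<^bsub>L\<^esub> e \<oplus>\<^bsub>L\<^esub> d \<odot>\<^bsub>L\<^esub> f" using ex[OF xy(2)] by blast
    have "x \<oplus>\<^bsub>L\<^esub> y = (a \<odot>\<^bsub>L\<^esub> e \<oplus>\<^bsub>L\<^esub> c \<odot>\<^bsub>L\<^esub> e) \<oplus>\<^bsub>L\<^esub> (b \<odot>\<^bsub>L\<^esub> f \<oplus>\<^bsub>L\<^esub> d \<odot>\<^bsub>L\<^esub> f)"
      unfolding x(3) y(3) using x y ef by (simp add: smult_in md.M.add.m_ac)
    also have "\<dots> = (a + c) \<odot>\<^bsub>L\<^esub> e \<oplus>\<^bsub>L\<^esub> (b + d) \<odot>\<^bsub>L\<^esub> f"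
      using x y ef md.smult_l_distr[of a c e] md.smult_l_distr[of b d f] by simp
    finally show "\<phi> (x \<oplus>\<^bsub>L\<^esub> y) = \<phi> x + \<phi> y"
      using x y \<phi> O_add by (simp add: algebra_simps)
    show "form L x y = 2 * Re (\<phi> x * cnj (\<phi> y))"
      unfolding x(3) y(3) \<phi>[OF x(1,2)] \<phi>[OF y(1,2)] gram form_comb[OF x(1,2) y(1,2) ef]
      by (simp add: A_def B_def D_def)
  next
    fix k x assume k: "k \<in> \<O>" and xc: "x \<in> carrier L"
    obtain a b where x: "a \<in> \<O>" "b \<in> \<O>" "x = a \<odot>\<^bsub>L\<^esub> e \<oplus>\<^bsub>L\<^esub> b \<odot>\<^bsub>L\<^esub> f" using ex[OF xc] by blast
    have "k \<odot>\<^bsub>L\<^esub> x = (k * a) \<odot>\<^bsub>L\<^esub> e \<oplus>\<^bsub>L\<^esub> (k * b) \<odot>\<^bsub>L\<^esub> f"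
      unfolding x(3) using k x ef md.smult_r_distr[of k] md.smult_assoc1[of k a e] md.smult_assoc1[of k b f] smult_in by simp
    thus "\<phi> (k \<odot>\<^bsub>L\<^esub> x) = of_real k * \<phi> x" using x \<phi> k O_mult by (simp add: algebra_simps)
  qed
  moreover have "e = 1 \<odot>\<^bsub>L\<^esub> e \<oplus>\<^bsub>L\<^esub> 0 \<odot>\<^bsub>L\<^esub> f" "f = 0 \<odot>\<^bsub>L\<^esub> e \<oplus>\<^bsub>L\<^esub> 1 \<odot>\<^bsub>L\<^esub> f"
    using ef md.smult_l_null md.smult_one by auto
  hence "\<phi> e = of_real u" "\<phi> f = v" using \<phi>[OF O_one O_zero] \<phi>[OF O_zero O_one] by simp_all
  hence "Im (\<phi> e * cnj (\<phi> f)) \<noteq> 0" using u s by (simp add: v_def)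
  ultimately show ?thesis using that ef ex by blast
qed

end

locale realised_lattice = o_lattice K L for K and L :: "'a form_module" +
  fixes \<phi> :: "'a \<Rightarrow> complex"
  assumes realises: "realises K L \<phi>"
begin

lemma \<phi>_inj: "x \<in> carrier L \<Longrightarrow> y \<in> carrier L \<Longrightarrow> \<phi> x = \<phi> y \<Longrightarrow> x = y"
  and \<phi>_add: "x \<in> carrier L \<Longrightarrow> y \<in> carrier L \<Longrightarrow> \<phi> (x \<oplus>\<^bsub>L\<^esub> y) = \<phi> x + \<phi> y"
  and \<phi>_smult: "a \<in> \<O> \<Longrightarrow> x \<in> carrier L \<Longrightarrow> \<phi> (a \<odot>\<^bsub>L\<^esub> x) = of_real a * \<phi> x"
  and \<phi>_form: "x \<in> carrier L \<Longrightarrow> y \<in> carrier L \<Longrightarrow> form L x y = 2 * Re (\<phi> x * cnj (\<phi> y))"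
  using realises by (auto simp: realises_def inj_on_def)

lemma \<phi>_zero: "\<phi> \<zero>\<^bsub>L\<^esub> = 0"
  using \<phi>_add[of "\<zero>\<^bsub>L\<^esub>" "\<zero>\<^bsub>L\<^esub>"] by simp

lemma \<phi>_norm: "x \<in> carrier L \<Longrightarrow> form L x x = 2 * (norm (\<phi> x))\<^sup>2"
  using \<phi>_form[of x x] by (simp only: Re_mult_cnj_self)

lemma \<phi>_roots: "\<phi> ` roots L = {z \<in> \<phi> ` carrier L. norm z = 1}"
proof -
  have "form L x x = 2 \<longleftrightarrow> norm (\<phi> x) = 1" if "x \<in> carrier L" for x
    using \<phi>_norm[OF that] norm_ge_zero[of "\<phi> x"] by (auto simp: power2_eq_1_iff simp del: norm_ge_zero)
  thus ?thesis by (auto simp: roots_def)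
qed

lemma image_add: "z \<in> \<phi> ` carrier L \<Longrightarrow> w \<in> \<phi> ` carrier L \<Longrightarrow> z + w \<in> \<phi> ` carrier L"
  by (auto simp flip: \<phi>_add)

lemma image_smult: "a \<in> \<O> \<Longrightarrow> z \<in> \<phi> ` carrier L \<Longrightarrow> of_real a * z \<in> \<phi> ` carrier L"
  by (auto simp: smult_in simp flip: \<phi>_smult)

lemma image_trace: "z \<in> \<phi> ` carrier L \<Longrightarrow> w \<in> \<phi> ` carrier L \<Longrightarrow> 2 * Re (z * cnj w) \<in> \<O>"
  using form_O by (force simp only: \<phi>_form[symmetric] image_iff)

text \<open>The reflection in the root \<open>g\<close>, followed by \<open>-1\<close>, maps \<open>h\<close> to \<open>g\<^sup>2 h\<^sup>*\<close>.\<close>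

lemma image_reflect:
  assumes "g \<in> \<phi> ` roots L" "h \<in> \<phi> ` roots L"
  shows "g ^ 2 * cnj h \<in> \<phi> ` roots L"
proof -
  have gh: "g \<in> \<phi> ` carrier L" "norm g = 1" "h \<in> \<phi> ` carrier L" "norm h = 1"
    using assms unfolding \<phi>_roots by auto
  have tr: "of_real (2 * Re (h * cnj g)) = h * cnj g + cnj h * g"
    using complex_add_cnj[of "h * cnj g"] by simp
  have "h * cnj g * g = h" using unit_mult_cnj[OF gh(2)] by (simp add: mult.assoc mult.commute[of "cnj g"])
  hence "g ^ 2 * cnj h = of_real (2 * Re (h * cnj g)) * g + of_real (- 1) * h"
    unfolding tr by (simp add: algebra_simps power2_eq_square)
  also have "\<dots> \<in> \<phi> ` carrier L"
    by (intro image_add image_smult image_trace gh O_minus O_one)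
  finally show ?thesis using gh unfolding \<phi>_roots by (simp add: norm_mult norm_power)
qed

end

context rank2_root_lattice
begin

lemma exists_normalised_realisation:
  obtains \<phi> \<alpha> e f where "realises K L \<phi>" "\<alpha> \<in> roots L" "\<phi> \<alpha> = 1" "e \<in> carrier L" "f \<in> carrier L"
    "\<forall>x\<in>carrier L. \<exists>a\<in>\<O>. \<exists>b\<in>\<O>. x = a \<odot>\<^bsub>L\<^esub> e \<oplus>\<^bsub>L\<^esub> b \<odot>\<^bsub>L\<^esub> f"
    "Im (\<phi> e * cnj (\<phi> f)) \<noteq> 0"
proof -
  obtain \<phi> e f where \<phi>: "realises K L \<phi>" and ef: "e \<in> carrier L" "f \<in> carrier L"
    "\<forall>x\<in>carrier L. \<exists>a\<in>\<O>. \<exists>b\<in>\<O>. x = a \<odot>\<^bsub>L\<^esub> e \<oplus>\<^bsub>L\<^esub> b \<odot>\<^bsub>L\<^esub> f"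
    "Im (\<phi> e * cnj (\<phi> f)) \<noteq> 0"
    by (rule exists_realisation)
  interpret realised_lattice K L \<phi> by unfold_locales (rule \<phi>)
  obtain \<alpha> where \<alpha>: "\<alpha> \<in> roots L" using exists_root by blast
  hence "\<phi> \<alpha> \<in> \<phi> ` roots L" by blast
  hence n: "norm (\<phi> \<alpha>) = 1" unfolding \<phi>_roots by simp
  let ?u = "cnj (\<phi> \<alpha>)"
  have "realises K L (\<lambda>x. \<phi> x * ?u)" by (rule realises_rotate[OF \<phi>]) (use n in simp)
  moreover have "\<phi> \<alpha> * ?u = 1" by (rule unit_mult_cnj[OF n])
  moreover have "\<phi> e * ?u * cnj (\<phi> f * ?u) = \<phi> e * cnj (\<phi> f)"
  proof -
    have "\<phi> e * ?u * cnj (\<phi> f * ?u) = \<phi> e * cnj (\<phi> f) * (\<phi> \<alpha> * ?u)" by simp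
    thus ?thesis by (simp only: unit_mult_cnj[OF n] mult_1_right)
  qed
  hence "Im (\<phi> e * ?u * cnj (\<phi> f * ?u)) \<noteq> 0" using ef(4) by (simp only: simp_thms)
  ultimately show ?thesis using that[of "\<lambda>x. \<phi> x * ?u" \<alpha> e f] \<alpha> ef(1,2,3) by blast
qed

text \<open>The quotient of the two images has modulus 1 and real part half the product of the
  roots, which Kronecker's theorem identifies with the real part of a root of unity; so it is that
  root of unity or its conjugate.\<close>

lemma root_difference_root_of_unity:
  assumes "realises K L \<phi>" "r \<in> roots L" "s \<in> roots L"
  shows "\<phi> r * cnj (\<phi> s) \<in> carrier roots_of_unity"
proof -
  interpret realised_lattice K L \<phi> by unfold_locales (rule assms)
  let ?g = "\<phi> r * cnj (\<phi> s)"
  have "\<phi> r \<in> \<phi> ` roots L" "\<phi> s \<in> \<phi> ` roots L" using assms by auto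
  hence g: "norm ?g = 1" unfolding \<phi>_roots by (simp add: norm_mult)
  obtain w where w: "w \<in> carrier roots_of_unity" "w + inverse w = of_real (form L r s)"
    by (rule root_form_kronecker[OF assms(2,3)])
  have nw: "norm w = 1" using roots_of_unity_norm[OF w(1)] .
  have "2 * Re w = form L r s"
    using arg_cong[OF w(2), of Re] unit_cnj[OF nw, symmetric] by simp
  hence "Re w = Re ?g" using \<phi>_form[of r s] root_carrier assms(2,3) by simp
  hence "?g = w \<or> ?g = cnj w" by (rule unit_eq_Re_imp[OF nw g])
  moreover have "cnj w \<in> carrier roots_of_unity"
    unfolding unit_cnj[OF nw] by (rule roots_of_unity_inverse[OF w(1)])
  ultimately show ?thesis using w(1) by (elim disjE) (simp_all only:)
qed

theorem realisation_structure:
  obtains n \<phi> where "n \<in> Q" "realises K L \<phi>" "\<phi> ` carrier L = \<Lambda> n"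
proof -
  obtain \<phi> \<alpha> e f where \<phi>: "realises K L \<phi>" and \<alpha>: "\<alpha> \<in> roots L" "\<phi> \<alpha> = 1"
    and ef: "e \<in> carrier L" "f \<in> carrier L"
    and ex: "\<forall>x\<in>carrier L. \<exists>a\<in>\<O>. \<exists>b\<in>\<O>. x = a \<odot>\<^bsub>L\<^esub> e \<oplus>\<^bsub>L\<^esub> b \<odot>\<^bsub>L\<^esub> f"
    and indep: "Im (\<phi> e * cnj (\<phi> f)) \<noteq> 0"
    by (rule exists_normalised_realisation)
  interpret realised_lattice K L \<phi> by unfold_locales (rule \<phi>)
  define H where "H = \<phi> ` roots L"
  have one: "1 \<in> H" using \<alpha> unfolding H_def by force
  have H_carrier: "H \<subseteq> \<phi> ` carrier L" unfolding H_def \<phi>_roots by auto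
  have "- 1 \<in> \<phi> ` carrier L"
    using image_smult[OF O_minus[OF O_one], of 1] one H_carrier by auto
  hence minus_one: "- 1 \<in> H" unfolding H_def \<phi>_roots by simp
  have H_unity: "H \<subseteq> carrier roots_of_unity"
    using root_difference_root_of_unity[OF \<phi> _ \<alpha>(1)] \<alpha>(2) by (auto simp: H_def)
  have gen: "generates (ring_on \<O>) L (roots L)" using L2 by (simp add: rank2_root_lattices_def root_lattice_def)
  \<comment> \<open>The set \<open>H\<close> may be infinite, but the two basis vectors involve
    finitely many roots; a common order \<open>M\<close> of their images leads to a finite cyclic
    group.\<close>
  obtain F c where F: "finite F" "F \<subseteq> roots L" "c \<in> F \<rightarrow> \<O>" "e = finsum L (\<lambda>v. c v \<odot>\<^bsub>L\<^esub> v) F"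
    using gen ef(1) unfolding generates_def by auto
  obtain F' c' where F': "finite F'" "F' \<subseteq> roots L" "c' \<in> F' \<rightarrow> \<O>" "f = finsum L (\<lambda>v. c' v \<odot>\<^bsub>L\<^esub> v) F'"
    using gen ef(2) unfolding generates_def by auto
  have "\<phi> ` (F \<union> F') \<subseteq> carrier roots_of_unity" using F(2) F'(2) H_unity by (auto simp: H_def)
  then obtain M where M: "M > 0" "\<forall>z \<in> \<phi> ` (F \<union> F'). z ^ M = 1"
    using exists_common_order[of "\<phi> ` (F \<union> F')"] F(1) F'(1) by blast
  obtain m where m: "m > 0" "m dvd M" "{z \<in> H. z ^ (2 * M) = 1} = {z. z ^ (2 * m) = 1}"
    by (rule reflection_closed_roots[OF one minus_one M(1)]) (auto simp: H_def intro: image_reflect)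
  let ?z = "\<zeta> (2 * m)"
  have z: "?z \<in> H" using m(1,3) \<zeta>_root[of "2 * m"] by auto
  have tr: "2 * Re ?z \<in> \<O>" using image_trace[of ?z 1] z one H_carrier by auto
  interpret S: quadratic_span \<O> ?z "2 * Re ?z" by (rule O_ring.quadratic_spanI[OF norm_\<zeta> tr])
  have roots_in: "\<phi> v \<in> span2 \<O> ?z" if "v \<in> F \<union> F'" for v
  proof -
    have "\<phi> v \<in> H" using that F(2) F'(2) by (auto simp: H_def)
    moreover have "\<phi> v ^ (2 * M) = 1" using M(2) that by (simp add: mult.commute[of 2] power_mult)
    ultimately have pow: "\<phi> v ^ (2 * m) = 1" using m(3) by blast
    obtain k where "\<phi> v = ?z ^ k"
      by (rule root_of_unity_\<zeta>_power[OF _ pow]) (use m(1) in auto)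
    thus ?thesis using S.span2_power[OF O_ring.span2_base] by simp
  qed
  have span_comb: "finsum L (\<lambda>v. d v \<odot>\<^bsub>L\<^esub> v) G \<in> {x. \<phi> x \<in> span2 \<O> ?z}"
    if "finite G" "G \<subseteq> roots L" "d \<in> G \<rightarrow> \<O>" "G \<subseteq> F \<union> F'" for G d
  proof (rule finsum_span[OF that(1) _ that(3)])
    show "G \<subseteq> carrier L" using that(2) root_carrier by blast
    show "\<zero>\<^bsub>L\<^esub> \<in> {x. \<phi> x \<in> span2 \<O> ?z}" by (simp add: \<phi>_zero O_ring.span2_zero)
    show "x \<oplus>\<^bsub>L\<^esub> y \<in> {x. \<phi> x \<in> span2 \<O> ?z}"
      if "x \<in> {x. \<phi> x \<in> span2 \<O> ?z}" "y \<in> {x. \<phi> x \<in> span2 \<O> ?z}" "x \<in> carrier L" "y \<in> carrier L" for x y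
      using that by (simp add: \<phi>_add O_ring.span2_add)
    show "a \<odot>\<^bsub>L\<^esub> x \<in> {x. \<phi> x \<in> span2 \<O> ?z}" if "a \<in> \<O>" "x \<in> G" for a x
    proof -
      have "x \<in> carrier L" "\<phi> x \<in> span2 \<O> ?z"
        using that(2) \<open>G \<subseteq> roots L\<close> root_carrier roots_in \<open>G \<subseteq> F \<union> F'\<close> by auto
      thus ?thesis using that(1) by (simp add: \<phi>_smult O_ring.span2_smult)
    qed
  qed
  have e_in: "\<phi> e \<in> span2 \<O> ?z" and f_in: "\<phi> f \<in> span2 \<O> ?z"
    using span_comb[OF F(1-3)] span_comb[OF F'(1-3)] F(4) F'(4) by auto
  have image: "\<phi> ` carrier L = \<Lambda> m"
  proof (intro equalityI subsetI)
    fix y assume "y \<in> \<phi> ` carrier L"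
    then obtain x where x: "x \<in> carrier L" "y = \<phi> x" by blast
    obtain a b where "a \<in> \<O>" "b \<in> \<O>" "x = a \<odot>\<^bsub>L\<^esub> e \<oplus>\<^bsub>L\<^esub> b \<odot>\<^bsub>L\<^esub> f" using bspec[OF ex x(1)] by blast
    thus "y \<in> \<Lambda> m" unfolding x(2) using e_in f_in ef by (simp add: \<phi>_add \<phi>_smult smult_in O_ring.span2_add O_ring.span2_smult)
  next
    fix y assume "y \<in> \<Lambda> m"
    then obtain a b where ab: "a \<in> \<O>" "b \<in> \<O>" "y = of_real a * 1 + of_real b * ?z" by (auto simp: span2_def)
    have mem: "1 \<in> \<phi> ` carrier L" "?z \<in> \<phi> ` carrier L" using one z H_carrier by auto
    show "y \<in> \<phi> ` carrier L" unfolding ab(3) by (intro image_add image_smult ab mem)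
  qed
  \<comment> \<open>For \<open>m = 1\<close> the root is \<open>- 1\<close>, and the images of both
    basis vectors would be real.\<close>
  have "m \<noteq> 1"
  proof
    assume "m = 1"
    hence "Im ?z = 0" by (simp add: \<zeta>_def)
    hence "Im y = 0" if "y \<in> span2 \<O> ?z" for y using that by (auto simp: span2_def)
    hence "Im (\<phi> e) = 0" "Im (\<phi> f) = 0" using e_in f_in by blast+
    thus False using indep by simp
  qed
  hence "m \<in> Q" using m(1) O_K[OF tr] by (simp add: Q_vertices_iff Re_\<zeta>_double)
  from that[OF this \<phi> image] show ?thesis .
qed

text \<open>If \<open>z + inverse z\<close> is a product of two roots, then \<open>z\<close> or its
  conjugate is the quotient of their images, an element of the ring \<open>\<Lambda> n\<close>.
  Conversely, each \<open>z\<close> in \<open>U n\<close> is the image of a root, to be paired with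
  the root sent to 1. The generating set is thus already a group.\<close>

lemma mu_lattice_eq_U:
  assumes n: "n \<in> Q" and \<phi>: "realises K L \<phi>" and im: "\<phi> ` carrier L = \<Lambda> n"
  shows "mu_lattice L = U n"
proof -
  interpret realised_lattice K L \<phi> by unfold_locales (rule \<phi>)
  let ?T = "{z \<in> carrier roots_of_unity. \<exists>\<alpha>\<in>roots L. \<exists>\<beta>\<in>roots L. z + inverse z = complex_of_real (form L \<alpha> \<beta>)}"
  have "?T \<subseteq> U n"
  proof safe
    fix z \<alpha> \<beta>
    assume z: "z \<in> carrier roots_of_unity" and ab: "\<alpha> \<in> roots L" "\<beta> \<in> roots L"
      and eq: "z + inverse z = complex_of_real (form L \<alpha> \<beta>)"
    let ?g = "\<phi> \<alpha> * cnj (\<phi> \<beta>)"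
    have nz: "norm z = 1" using roots_of_unity_norm[OF z] .
    have "\<phi> \<alpha> \<in> \<phi> ` roots L" "\<phi> \<beta> \<in> \<phi> ` roots L" using ab by auto
    hence mem: "norm (\<phi> \<alpha>) = 1" "norm (\<phi> \<beta>) = 1" "\<phi> \<alpha> \<in> \<Lambda> n" "\<phi> \<beta> \<in> \<Lambda> n"
      unfolding \<phi>_roots im by auto
    have g: "norm ?g = 1" using mem(1,2) by (simp add: norm_mult)
    have gL: "?g \<in> \<Lambda> n" by (intro \<Lambda>_mult[OF n] \<Lambda>_cnj[OF n] mem)
    have "2 * Re z = form L \<alpha> \<beta>" using arg_cong[OF eq, of Re] unit_cnj[OF nz, symmetric] by simp
    hence "Re ?g = Re z" using \<phi>_form[of \<alpha> \<beta>] root_carrier ab by simp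
    hence "z = ?g \<or> z = cnj ?g" by (rule unit_eq_Re_imp[OF g nz])
    hence "z \<in> \<Lambda> n" using gL \<Lambda>_cnj[OF n gL] by metis
    thus "z \<in> U n" using z by (simp add: U_def)
  qed
  moreover have "U n \<subseteq> ?T"
  proof
    fix z assume z: "z \<in> U n"
    have nz: "norm z = 1" using U_norm[OF z] .
    have "z \<in> \<phi> ` roots L" "1 \<in> \<phi> ` roots L"
      unfolding \<phi>_roots im using z nz O_ring.span2_one by (auto simp: U_def)
    then obtain \<alpha> \<beta> where ab: "\<alpha> \<in> roots L" "\<phi> \<alpha> = z" "\<beta> \<in> roots L" "\<phi> \<beta> = 1" by (metis imageE)
    have "form L \<alpha> \<beta> = 2 * Re z" using \<phi>_form[of \<alpha> \<beta>] root_carrier ab by simp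
    hence "z + inverse z = complex_of_real (form L \<alpha> \<beta>)"
      using complex_add_cnj[of z] unit_cnj[OF nz] by simp
    thus "z \<in> ?T" using z ab by (auto simp: U_def)
  qed
  ultimately have T: "?T = U n" by blast
  have "generate roots_of_unity (U n) \<subseteq> U n"
    by (rule generate_roots_of_unity_subset)
      (use n in \<open>auto simp: U_one U_mult U_inverse\<close>, auto simp: U_def)
  moreover have "U n \<subseteq> generate roots_of_unity (U n)" by (auto intro: generate.incl)
  ultimately show ?thesis unfolding mu_lattice_def T by blast
qed

end

section \<open>Construction of the lattices\<close>

lemma countable_algebraic: "countable {x :: real. Polynomial.algebraic x}"
proof (rule countable_subset)
  let ?R = "\<lambda>xs :: int list. if Poly xs = 0 then {} else {x :: real. poly (map_poly of_int (Poly xs)) x = 0}"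
  show "countable (\<Union>xs. ?R xs)"
    by (intro countable_UN) (auto intro!: countable_finite poly_roots_finite)
  show "{x :: real. Polynomial.algebraic x} \<subseteq> (\<Union>xs. ?R xs)"
  proof safe
    fix x :: real assume "Polynomial.algebraic x"
    then obtain p :: "int poly" where "poly (map_poly of_int p) x = 0" "p \<noteq> 0" by (auto elim: algebraicE')
    thus "x \<in> (\<Union>xs. ?R xs)" by (intro UN_I[of "coeffs p"]) auto
  qed
qed

context totally_real
begin

lemma countable_\<Lambda>: "countable (\<Lambda> n)"
proof -
  have "\<O> \<subseteq> {x. Polynomial.algebraic x}" using O_algebraic_int by auto
  hence "countable \<O>" using countable_subset countable_algebraic by blast
  moreover have "\<Lambda> n = (\<lambda>(a, b). of_real a + of_real b * \<zeta> (2 * n)) ` (\<O> \<times> \<O>)" by (auto simp: span2_def)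
  ultimately show ?thesis by simp
qed

text \<open>This is what definiteness of the form at \<open>\<tau>\<close> comes down to. The
  equation \<open>cheb (2 * n) = 2\<close> at the trace \<open>c\<close> has integer coefficients
  and survives \<open>\<tau>\<close>, so \<open>\<tau> c = w + 1/w\<close> with a root of unity
  \<open>w\<close>. The values 2 and -2 are excluded by injectivity of
  \<open>\<tau>\<close>.\<close>

lemma embedding_trace_less_2:
  fixes \<tau> :: "real \<Rightarrow> real"
  assumes n: "n \<in> Q" and \<tau>: "\<tau> \<in> embeddings K"
  shows "\<bar>\<tau> (2 * Re (\<zeta> (2 * n)))\<bar> < 2"
proof -
  let ?z = "\<zeta> (2 * n)" and ?N = "2 * n"
  define c where "c = 2 * Re ?z"
  have cK: "c \<in> K" unfolding c_def using O_K Q_trace_O n by blast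
  have of_real_poly: "complex_of_real (poly (map_poly of_int p) x) = poly (map_poly of_int p) (of_real x)" for p :: "int poly" and x
    by (induction p) (auto simp: map_poly_pCons)
  have nz: "?z \<noteq> 0" by (metis norm_\<zeta> norm_zero zero_neq_one)
  have "?z + inverse ?z = of_real c" unfolding c_def using complex_add_cnj[of ?z] unit_cnj[OF norm_\<zeta>] by simp
  hence "complex_of_real (poly (map_poly of_int (cheb ?N)) c) = 2"
    unfolding of_real_poly using poly_cheb_sum_inverse[OF nz, of ?N] \<zeta>_root[of ?N] Q_pos[OF n]
    by (simp add: power_inverse)
  hence "poly (map_poly of_int (cheb ?N)) c = 2" by (metis of_real_eq_iff of_real_numeral)
  moreover have \<tau>2: "\<tau> 2 = 2" using embedding_of_nat[OF \<tau>, of 2] by simp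
  ultimately have cheb2: "poly (map_poly of_int (cheb ?N)) (\<tau> c) = 2"
    using embedding_int_poly[OF \<tau> cK, of "cheb ?N"] by simp
  let ?t = "complex_of_real (\<tau> c)"
  \<comment> \<open>A solution of \<open>w + 1/w = \<tau> c\<close>, a priori anywhere in the
    complex plane.\<close>
  define w where "w = (?t + csqrt (?t\<^sup>2 - 4)) / 2"
  have "w * (?t - w) = (?t\<^sup>2 - (csqrt (?t\<^sup>2 - 4))\<^sup>2) / 4"
    unfolding w_def by (simp add: power2_eq_square field_simps)
  hence w1: "w * (?t - w) = 1" by simp
  hence w0: "w \<noteq> 0" and winv: "inverse w = ?t - w" by (auto intro: inverse_unique)
  have "poly (map_poly of_int (cheb ?N)) ?t = 2" using cheb2 of_real_poly[of "cheb ?N" "\<tau> c"] by simp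
  hence "w ^ ?N + inverse w ^ ?N = 2" using poly_cheb_sum_inverse[OF w0, of ?N] winv by simp
  \<comment> \<open>Multiplied by \<open>w ^ ?N\<close>, the equation
    \<open>w ^ ?N + w ^ - ?N = 2\<close> becomes a vanishing square.\<close>
  hence "w ^ ?N * (w ^ ?N + inverse (w ^ ?N)) = w ^ ?N * 2" by (simp only: power_inverse)
  hence "(w ^ ?N - 1)\<^sup>2 = 0" using w0 by (simp add: distrib_left power2_eq_square algebra_simps)
  hence "w ^ ?N = 1" by simp
  hence nw: "norm w = 1" using root_of_unity_norm[of ?N] Q_pos[OF n] by simp
  have "w + cnj w = ?t" using winv unit_cnj[OF nw] by simp
  from arg_cong[OF this, of Re] have "\<tau> c = 2 * Re w" by simp
  hence le: "\<bar>\<tau> c\<bar> \<le> 2" using abs_Re_le_cmod[of w] nw by simp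
  have c2: "\<bar>c\<bar> < 2"
  proof -
    have "(Re ?z)\<^sup>2 + (Im ?z)\<^sup>2 = 1" using cmod_power2[of ?z] by simp
    moreover have "(Im ?z)\<^sup>2 > 0" using Im_\<zeta>_double_pos[OF Q_gt_1[OF n]] by simp
    ultimately have "(Re ?z)\<^sup>2 < 1" by linarith
    hence "\<bar>Re ?z\<bar> < 1" by (simp only: abs_square_less_1)
    thus ?thesis by (simp add: c_def abs_mult)
  qed
  have twoK: "2 \<in> K" by (rule O_K[OF O_two])
  have "\<tau> (c + - 2) = \<tau> c + - 2" "\<tau> (c + 2) = \<tau> c + 2"
    using cK twoK by (simp_all only: embedding_add[OF \<tau>] embedding_minus[OF \<tau>] K_minus \<tau>2)
  hence "\<tau> c \<noteq> 2" "\<tau> c \<noteq> - 2"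
    using embedding_eq_0[OF \<tau> K_add[OF cK K_minus[OF twoK]]] embedding_eq_0[OF \<tau> K_add[OF cK twoK]] c2 by auto
  thus ?thesis using le unfolding c_def by linarith
qed

end

text \<open>A copy of \<open>\<Lambda> n\<close> on another type. The assumptions merely transport
  the operations along the bijection; the module and lattice axioms are then pulled back from the
  complex numbers.\<close>

locale lambda_lattice = totally_real K for K +
  fixes L :: "'a form_module" and \<phi> :: "'a \<Rightarrow> complex" and n :: nat
  assumes n: "n \<in> Q"
    and bij: "bij_betw \<phi> (carrier L) (\<Lambda> n)"
    and zero_in: "\<zero>\<^bsub>L\<^esub> \<in> carrier L" and \<phi>_zero: "\<phi> \<zero>\<^bsub>L\<^esub> = 0"
    and add_in: "x \<in> carrier L \<Longrightarrow> y \<in> carrier L \<Longrightarrow> x \<oplus>\<^bsub>L\<^esub> y \<in> carrier L"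
    and smult_in: "a \<in> \<O> \<Longrightarrow> x \<in> carrier L \<Longrightarrow> a \<odot>\<^bsub>L\<^esub> x \<in> carrier L"
    and \<phi>_add: "x \<in> carrier L \<Longrightarrow> y \<in> carrier L \<Longrightarrow> \<phi> (x \<oplus>\<^bsub>L\<^esub> y) = \<phi> x + \<phi> y"
    and \<phi>_smult: "a \<in> \<O> \<Longrightarrow> x \<in> carrier L \<Longrightarrow> \<phi> (a \<odot>\<^bsub>L\<^esub> x) = of_real a * \<phi> x"
    and \<phi>_form: "x \<in> carrier L \<Longrightarrow> y \<in> carrier L \<Longrightarrow> form L x y = 2 * Re (\<phi> x * cnj (\<phi> y))"
begin

lemma \<phi>_inj: "x \<in> carrier L \<Longrightarrow> y \<in> carrier L \<Longrightarrow> \<phi> x = \<phi> y \<Longrightarrow> x = y"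
  using bij by (auto simp: bij_betw_def inj_on_def)

lemma \<phi>_in: "x \<in> carrier L \<Longrightarrow> \<phi> x \<in> \<Lambda> n"
  using bij by (auto simp: bij_betw_def)

lemma module_L: "module (ring_on \<O>) L"
proof (rule moduleI)
  show "abelian_group L"
  proof (rule abelian_groupI)
    fix x assume x: "x \<in> carrier L"
    have m1: "- 1 \<in> \<O>" by (intro O_minus O_one)
    have "(- 1) \<odot>\<^bsub>L\<^esub> x \<oplus>\<^bsub>L\<^esub> x = \<zero>\<^bsub>L\<^esub>"
      using x m1 by (intro \<phi>_inj) (simp_all add: add_in smult_in zero_in \<phi>_add \<phi>_smult \<phi>_zero)
    thus "\<exists>y\<in>carrier L. y \<oplus>\<^bsub>L\<^esub> x = \<zero>\<^bsub>L\<^esub>" using smult_in[OF m1 x] by blast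
  qed (auto intro!: \<phi>_inj simp: add_in zero_in \<phi>_add \<phi>_zero)
qed (auto intro!: \<phi>_inj O_ring.cring_ring_on
  simp: add_in smult_in \<phi>_add \<phi>_smult O_add O_mult O_one distrib_left distrib_right)

lemma realises_\<phi>: "realises K L \<phi>"
  using bij \<phi>_add \<phi>_smult \<phi>_form unfolding realises_def bij_betw_def by blast

lemma norm_affine:
  "(norm (of_real a + of_real b * \<zeta> (2 * n)))\<^sup>2 = a * a + b * b + a * b * (2 * Re (\<zeta> (2 * n)))"
proof -
  let ?z = "\<zeta> (2 * n)"
  have "(Re ?z)\<^sup>2 + (Im ?z)\<^sup>2 = 1" using cmod_power2[of ?z] by simp
  hence im: "(Im ?z)\<^sup>2 = 1 - (Re ?z)\<^sup>2" by simp
  have "(norm (of_real a + of_real b * ?z))\<^sup>2 = a * a + 2 * a * b * Re ?z + b * b * ((Re ?z)\<^sup>2 + (Im ?z)\<^sup>2)"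
    unfolding cmod_power2 by (simp add: power2_eq_square algebra_simps)
  thus ?thesis unfolding im by simp
qed

lemma form_positive:
  fixes \<tau> :: "real \<Rightarrow> real"
  assumes \<tau>: "\<tau> \<in> embeddings K" and x: "x \<in> carrier L" "x \<noteq> \<zero>\<^bsub>L\<^esub>"
  shows "\<tau> (form L x x) > 0"
proof -
  define c where "c = 2 * Re (\<zeta> (2 * n))"
  obtain a b where ab: "a \<in> \<O>" "b \<in> \<O>" "\<phi> x = of_real a + of_real b * \<zeta> (2 * n)"
    using \<phi>_in[OF x(1)] by (auto simp: span2_def)
  \<comment> \<open>The factor is written \<open>1 + 1\<close> so that additivity and the value at 1
    suffice to evaluate \<open>\<tau>\<close> on it.\<close>
  have form: "form L x x = (1 + 1) * (a * a + b * b + a * b * c)"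
    using \<phi>_form[OF x(1) x(1)] unfolding Re_mult_cnj_self ab(3) norm_affine c_def by simp
  note hom = embedding_add[OF \<tau>] embedding_mult[OF \<tau>] embedding_one[OF \<tau>]
  have K: "a \<in> K" "b \<in> K" "c \<in> K" unfolding c_def using ab O_K Q_trace_O[OF n] by auto
  have eq: "\<tau> (form L x x) = 2 * (\<tau> a * \<tau> a + \<tau> b * \<tau> b + \<tau> a * \<tau> b * \<tau> c)"
    unfolding form using K by (simp only: hom K_mult K_add K_one) simp
  have "a \<noteq> 0 \<or> b \<noteq> 0"
    using \<phi>_inj[OF x(1) zero_in] x(2) ab(3) \<phi>_zero by auto
  hence ne: "\<tau> a \<noteq> 0 \<or> \<tau> b \<noteq> 0" using embedding_eq_0[OF \<tau>] K by blast
  have "\<bar>\<tau> c\<bar> < 2" unfolding c_def by (rule embedding_trace_less_2[OF n \<tau>])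
  hence "(\<tau> c)\<^sup>2 < 2\<^sup>2" using abs_square_less_1 power2_strict_mono by (metis abs_numeral)
  hence c4: "4 - (\<tau> c)\<^sup>2 > 0" by simp
  have sq: "4 * (\<tau> a * \<tau> a + \<tau> b * \<tau> b + \<tau> a * \<tau> b * \<tau> c) = (2 * \<tau> a + \<tau> b * \<tau> c)\<^sup>2 + (\<tau> b)\<^sup>2 * (4 - (\<tau> c)\<^sup>2)"
    by (simp add: power2_eq_square algebra_simps)
  have "(2 * \<tau> a + \<tau> b * \<tau> c)\<^sup>2 + (\<tau> b)\<^sup>2 * (4 - (\<tau> c)\<^sup>2) > 0"
  proof (cases "\<tau> b = 0")
    case True
    thus ?thesis using ne by simp
  next
    case False
    hence "(\<tau> b)\<^sup>2 * (4 - (\<tau> c)\<^sup>2) > 0" using c4 by simp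
    thus ?thesis by (simp add: add_nonneg_pos)
  qed
  thus ?thesis unfolding eq using sq by linarith
qed

lemma basis_pair:
  assumes ef: "e \<in> carrier L" "\<phi> e = 1" "f \<in> carrier L" "\<phi> f = \<zeta> (2 * n)"
  shows "e \<noteq> f" "finite_basis (ring_on \<O>) L {e, f}"
    "\<And>x. x \<in> carrier L \<Longrightarrow> \<exists>a\<in>\<O>. \<exists>b\<in>\<O>. x = a \<odot>\<^bsub>L\<^esub> e \<oplus>\<^bsub>L\<^esub> b \<odot>\<^bsub>L\<^esub> f"
proof -
  interpret md: module "ring_on \<O>" L by (rule module_L)
  have im: "Im (\<zeta> (2 * n)) \<noteq> 0" using Im_\<zeta>_double_pos[OF Q_gt_1[OF n]] by simp
  show "e \<noteq> f" using ef im by auto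
  have comb: "\<phi> (a \<odot>\<^bsub>L\<^esub> e \<oplus>\<^bsub>L\<^esub> b \<odot>\<^bsub>L\<^esub> f) = of_real a + of_real b * \<zeta> (2 * n)" if "a \<in> \<O>" "b \<in> \<O>" for a b
    using that ef by (simp add: \<phi>_add \<phi>_smult smult_in)
  have ex: "\<exists>a\<in>\<O>. \<exists>b\<in>\<O>. x = a \<odot>\<^bsub>L\<^esub> e \<oplus>\<^bsub>L\<^esub> b \<odot>\<^bsub>L\<^esub> f" if x: "x \<in> carrier L" for x
  proof -
    obtain a b where ab: "a \<in> \<O>" "b \<in> \<O>" "\<phi> x = of_real a + of_real b * \<zeta> (2 * n)"
      using \<phi>_in[OF x] by (auto simp: span2_def)
    have "x = a \<odot>\<^bsub>L\<^esub> e \<oplus>\<^bsub>L\<^esub> b \<odot>\<^bsub>L\<^esub> f"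
      using ab ef x by (intro \<phi>_inj) (simp_all only: add_in smult_in comb)
    thus ?thesis using ab by blast
  qed
  thus "\<And>x. x \<in> carrier L \<Longrightarrow> \<exists>a\<in>\<O>. \<exists>b\<in>\<O>. x = a \<odot>\<^bsub>L\<^esub> e \<oplus>\<^bsub>L\<^esub> b \<odot>\<^bsub>L\<^esub> f" .
  have uniq: "a' = a \<and> b' = b"
    if "a \<in> \<O>" "b \<in> \<O>" "a' \<in> \<O>" "b' \<in> \<O>" "a \<odot>\<^bsub>L\<^esub> e \<oplus>\<^bsub>L\<^esub> b \<odot>\<^bsub>L\<^esub> f = a' \<odot>\<^bsub>L\<^esub> e \<oplus>\<^bsub>L\<^esub> b' \<odot>\<^bsub>L\<^esub> f" for a b a' b'
  proof -
    have eq: "of_real a + of_real b * \<zeta> (2 * n) = of_real a' + of_real b' * \<zeta> (2 * n)"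
      using arg_cong[OF that(5), of \<phi>] comb that(1-4) by simp
    have "b * Im (\<zeta> (2 * n)) = b' * Im (\<zeta> (2 * n))" using arg_cong[OF eq, of Im] by simp
    hence "b = b'" using im by simp
    thus ?thesis using arg_cong[OF eq, of Re] by simp
  qed
  show "finite_basis (ring_on \<O>) L {e, f}"
  proof (subst finite_basis_pair_iff[OF md.abelian_monoid_axioms \<open>e \<noteq> f\<close> ef(1,3)])
    show "\<forall>x\<in>carrier L. \<exists>a\<in>carrier (ring_on \<O>). \<exists>b\<in>carrier (ring_on \<O>). x = a \<odot>\<^bsub>L\<^esub> e \<oplus>\<^bsub>L\<^esub> b \<odot>\<^bsub>L\<^esub> f \<and>
      (\<forall>a'\<in>carrier (ring_on \<O>). \<forall>b'\<in>carrier (ring_on \<O>).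
        x = a' \<odot>\<^bsub>L\<^esub> e \<oplus>\<^bsub>L\<^esub> b' \<odot>\<^bsub>L\<^esub> f \<longrightarrow> a' = a \<and> b' = b)"
    proof
      fix x assume "x \<in> carrier L"
      then obtain a b where ab: "a \<in> \<O>" "b \<in> \<O>" "x = a \<odot>\<^bsub>L\<^esub> e \<oplus>\<^bsub>L\<^esub> b \<odot>\<^bsub>L\<^esub> f" using ex by blast
      have u: "x = a' \<odot>\<^bsub>L\<^esub> e \<oplus>\<^bsub>L\<^esub> b' \<odot>\<^bsub>L\<^esub> f \<longrightarrow> a' = a \<and> b' = b" if "a' \<in> \<O>" "b' \<in> \<O>" for a' b'
        using uniq[OF ab(1,2) that] unfolding ab(3) by (intro impI)
      show "\<exists>a\<in>carrier (ring_on \<O>). \<exists>b\<in>carrier (ring_on \<O>). x = a \<odot>\<^bsub>L\<^esub> e \<oplus>\<^bsub>L\<^esub> b \<odot>\<^bsub>L\<^esub> f \<and>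
      (\<forall>a'\<in>carrier (ring_on \<O>). \<forall>b'\<in>carrier (ring_on \<O>).
        x = a' \<odot>\<^bsub>L\<^esub> e \<oplus>\<^bsub>L\<^esub> b' \<odot>\<^bsub>L\<^esub> f \<longrightarrow> a' = a \<and> b' = b)"
        unfolding ring_on_simps by (rule bexI[OF _ ab(1)], rule bexI[OF _ ab(2)], intro conjI[OF ab(3)] ballI u)
    qed
  qed (use ef smult_in in auto)
qed

lemma exists_pair:
  obtains e f where "e \<in> carrier L" "\<phi> e = 1" "f \<in> carrier L" "\<phi> f = \<zeta> (2 * n)"
proof -
  have "1 \<in> \<phi> ` carrier L" "\<zeta> (2 * n) \<in> \<phi> ` carrier L"
    using bij O_ring.span2_one O_ring.span2_base by (simp_all add: bij_betw_def)
  then obtain e f where "e \<in> carrier L" "\<phi> e = 1" "f \<in> carrier L" "\<phi> f = \<zeta> (2 * n)"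
    by (elim imageE) simp
  thus ?thesis by (rule that)
qed

lemma O_lattice_L: "O_lattice K L"
proof -
  obtain e f where ef: "e \<in> carrier L" "\<phi> e = 1" "f \<in> carrier L" "\<phi> f = \<zeta> (2 * n)"
    by (rule exists_pair)
  have "e \<noteq> \<zero>\<^bsub>L\<^esub>" using ef(2) \<phi>_zero by auto
  hence ne: "carrier L \<noteq> {\<zero>\<^bsub>L\<^esub>}" using ef(1) by blast
  have form_sym: "form L x y = form L y x" if "x \<in> carrier L" "y \<in> carrier L" for x y
    using that by (simp add: \<phi>_form mult.commute)
  have form_O: "form L x y \<in> \<O>" if "x \<in> carrier L" "y \<in> carrier L" for x y
    unfolding \<phi>_form[OF that] by (intro \<Lambda>_trace[OF n] \<Lambda>_mult[OF n] \<Lambda>_cnj[OF n] \<phi>_in that)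
  have form_add: "form L (x \<oplus>\<^bsub>L\<^esub> y) z = form L x z + form L y z" if "x \<in> carrier L" "y \<in> carrier L" "z \<in> carrier L" for x y z
    using that by (simp add: \<phi>_form \<phi>_add add_in algebra_simps)
  have form_smult: "form L (a \<odot>\<^bsub>L\<^esub> x) z = a * form L x z" if "a \<in> \<O>" "x \<in> carrier L" "z \<in> carrier L" for a x z
    using that by (simp add: \<phi>_form \<phi>_smult smult_in algebra_simps)
  show ?thesis
    unfolding O_lattice_def
  proof (intro conjI ballI module_L ne exI[of _ "{e, f}"] basis_pair(2)[OF ef])
    show "form L x y = form L y x" if "x \<in> carrier L" "y \<in> carrier L" for x y
      by (rule form_sym[OF that])
  qed (use form_O form_add form_smult form_positive in auto)
qed

sublocale rl: realised_lattice K L \<phi>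
  by unfold_locales (rule O_lattice_L, rule realises_\<phi>)

lemma image_carrier: "\<phi> ` carrier L = \<Lambda> n"
  using bij by (simp add: bij_betw_def)

lemma root_iff: "x \<in> carrier L \<Longrightarrow> x \<in> roots L \<longleftrightarrow> norm (\<phi> x) = 1"
proof -
  assume x: "x \<in> carrier L"
  have "form L x x = 2 * (norm (\<phi> x))\<^sup>2" by (rule rl.\<phi>_norm[OF x])
  thus ?thesis using x norm_ge_zero[of "\<phi> x"] by (auto simp: roots_def power2_eq_1_iff simp del: norm_ge_zero)
qed

lemma in_rank2: "L \<in> rank2_root_lattices K"
proof -
  interpret md: module "ring_on \<O>" L by (rule module_L)
  obtain e f where ef: "e \<in> carrier L" "\<phi> e = 1" "f \<in> carrier L" "\<phi> f = \<zeta> (2 * n)"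
    by (rule exists_pair)
  note bp = basis_pair[OF ef]
  have "generates (ring_on \<O>) L (roots L)"
    unfolding generates_def
  proof (intro conjI ballI)
    show "roots L \<subseteq> carrier L" by (auto simp: roots_def)
    fix x assume "x \<in> carrier L"
    then obtain a b where ab: "a \<in> \<O>" "b \<in> \<O>" "x = a \<odot>\<^bsub>L\<^esub> e \<oplus>\<^bsub>L\<^esub> b \<odot>\<^bsub>L\<^esub> f" using bp(3) by blast
    define c where "c v = (if v = e then a else b)" for v
    have "finsum L (\<lambda>v. c v \<odot>\<^bsub>L\<^esub> v) {e, f} = x"
      using ab ef bp(1) smult_in by (simp add: c_def)
    moreover have "{e, f} \<subseteq> roots L" using ef root_iff by simp
    ultimately show "\<exists>F c. finite F \<and> F \<subseteq> roots L \<and> c \<in> F \<rightarrow> carrier (ring_on \<O>) \<and> x = finsum L (\<lambda>v. c v \<odot>\<^bsub>L\<^esub> v) F"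
      using ab by (intro exI[of _ "{e, f}"] exI[of _ c]) (auto simp: c_def)
  qed
  moreover have "has_rank K L 2" unfolding has_rank_def using bp(1,2) by (intro exI[of _ "{e, f}"]) simp
  ultimately show ?thesis using O_lattice_L by (simp add: rank2_root_lattices_def root_lattice_def)
qed

end

context totally_real
begin

text \<open>Since \<open>\<Lambda> n\<close> is countable, it injects into any infinite type; its
  operations are transported to the image.\<close>

lemma exists_lambda_lattice:
  assumes n: "n \<in> Q" and inf: "infinite (UNIV :: 'a set)"
  shows "\<exists>(L :: 'a form_module) \<phi>. lambda_lattice K L \<phi> n"
proof -
  obtain j :: "nat \<Rightarrow> 'a" where j: "inj j" using inf infinite_countable_subset by blast
  define g where "g = j \<circ> to_nat_on (\<Lambda> n)"
  have g: "inj_on g (\<Lambda> n)"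
    unfolding g_def using inj_on_to_nat_on[OF countable_\<Lambda>] j by (intro comp_inj_on) (auto intro: inj_on_subset)
  define h where "h = inv_into (\<Lambda> n) g"
  have hg: "h (g z) = z" if "z \<in> \<Lambda> n" for z using g that by (simp add: h_def)
  define L :: "'a form_module" where "L = \<lparr>carrier = g ` \<Lambda> n, monoid.mult = undefined, one = undefined,
    ring.zero = g 0, add = (\<lambda>x y. g (h x + h y)), smult = (\<lambda>a x. g (of_real a * h x)),
    form = (\<lambda>x y. 2 * Re (h x * cnj (h y)))\<rparr>"
  have "lambda_lattice K L h n"
  proof unfold_locales
    show "n \<in> Q" by (rule n)
    show "bij_betw h (carrier L) (\<Lambda> n)"
      unfolding h_def L_def using g by (simp add: bij_betw_inv_into bij_betw_imageI)
  qed (auto simp: L_def hg O_ring.span2_zero O_ring.span2_add O_ring.span2_smult)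
  thus ?thesis by blast
qed

section \<open>Isomorphism classes and their groups\<close>

lemma rank2_realisation:
  assumes "(L :: 'a form_module) \<in> rank2_root_lattices K"
  obtains n \<phi> where "n \<in> Q" "realises K L \<phi>" "\<phi> ` carrier L = \<Lambda> n" "mu_lattice L = U n"
proof -
  interpret rank2_root_lattice K L by unfold_locales (rule assms)
  obtain n \<phi> where *: "n \<in> Q" "realises K L \<phi>" "\<phi> ` carrier L = \<Lambda> n" by (rule realisation_structure)
  show ?thesis by (rule that[OF * mu_lattice_eq_U[OF *]])
qed

text \<open>Into the plane by \<open>\<phi>\<close> and back by the inverse of
  \<open>\<psi>\<close>; both preserve all the structure.\<close>

lemma lattice_iso_of_realisations:
  assumes L: "O_lattice K L" and M: "O_lattice K M"
    and \<phi>: "realises K L \<phi>" and \<psi>: "realises K M \<psi>" and im: "\<phi> ` carrier L = \<psi> ` carrier M"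
  shows "\<exists>f. lattice_iso K L M f"
proof -
  interpret l: realised_lattice K L \<phi> by unfold_locales (rule L, rule \<phi>)
  interpret m: realised_lattice K M \<psi> by unfold_locales (rule M, rule \<psi>)
  define f where "f = inv_into (carrier M) \<psi> \<circ> \<phi>"
  have bl: "bij_betw \<phi> (carrier L) (\<phi> ` carrier L)" using \<phi> by (simp add: realises_def bij_betw_def)
  have bm: "bij_betw \<psi> (carrier M) (\<phi> ` carrier L)" using \<psi> im by (simp add: realises_def bij_betw_def)
  have bf: "bij_betw f (carrier L) (carrier M)"
    unfolding f_def by (rule bij_betw_trans[OF bl bij_betw_inv_into[OF bm]])
  have fM: "f x \<in> carrier M" if "x \<in> carrier L" for x using bf that by (auto simp: bij_betw_def)
  have \<psi>f: "\<psi> (f x) = \<phi> x" if "x \<in> carrier L" for x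
  proof -
    have "\<phi> x \<in> \<psi> ` carrier M" using that im by blast
    thus ?thesis by (simp add: f_def f_inv_into_f)
  qed
  have "lattice_iso K L M f"
    unfolding lattice_iso_def
  proof (intro conjI ballI bf)
    fix x y assume xy: "x \<in> carrier L" "y \<in> carrier L"
    show "f (x \<oplus>\<^bsub>L\<^esub> y) = f x \<oplus>\<^bsub>M\<^esub> f y"
      using xy by (intro m.\<phi>_inj) (simp_all add: fM \<psi>f m.\<phi>_add l.\<phi>_add)
    show "form M (f x) (f y) = form L x y"
      using m.\<phi>_form[OF fM[OF xy(1)] fM[OF xy(2)]] l.\<phi>_form[OF xy] xy by (simp only: \<psi>f)
  next
    fix a x assume "a \<in> \<O>" "x \<in> carrier L"
    thus "f (a \<odot>\<^bsub>L\<^esub> x) = a \<odot>\<^bsub>M\<^esub> f x"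
      by (intro m.\<phi>_inj) (simp_all add: fM \<psi>f m.\<phi>_smult l.\<phi>_smult l.smult_in m.smult_in)
  qed
  thus ?thesis by blast
qed

lemma mu_lattice_iso:
  assumes "lattice_iso K L M f"
  shows "mu_lattice L = mu_lattice M"
proof -
  have f: "f ` carrier L = carrier M" "\<And>x y. x \<in> carrier L \<Longrightarrow> y \<in> carrier L \<Longrightarrow> form M (f x) (f y) = form L x y"
    using assms by (auto simp: lattice_iso_def bij_betw_def)
  have "roots M = f ` roots L" using f by (auto simp: roots_def simp flip: f(1))
  moreover have "form M (f x) (f y) = form L x y" if "x \<in> roots L" "y \<in> roots L" for x y
    using that f(2) by (simp add: roots_def)
  ultimately show ?thesis unfolding mu_lattice_def by simp
qed

lemma mu_lattice_respects:
  "mu_lattice respects (lattice_iso_rel K :: ('a form_module \<times> 'a form_module) set)"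
  using mu_lattice_iso by (intro congruentI) (auto simp: lattice_iso_rel_def)

lemma mu_lattice_in_family:
  assumes "(L :: 'a form_module) \<in> rank2_root_lattices K"
  shows "\<exists>C \<in> P_family K \<union> R_family K. mu_lattice L = mu_set C"
  by (rule rank2_realisation[OF assms]) (use U_in_family in metis)

lemma mu_lattice_bij:
  assumes inf: "infinite (UNIV :: 'a set)"
  shows "bij_betw (\<lambda>A. the_elem (mu_lattice ` A))
           ((rank2_root_lattices K :: 'a form_module set) // lattice_iso_rel K)
           (mu_set ` (P_family K \<union> R_family K))"
proof -
  let ?S = "rank2_root_lattices K :: 'a form_module set" and ?R = "lattice_iso_rel K :: ('a form_module \<times> 'a form_module) set"
  let ?F = "\<lambda>A :: 'a form_module set. the_elem (mu_lattice ` A)"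
  note equiv = equiv_lattice_iso_rel[of K, where 'a = 'a]
  have F: "?F (?R `` {L}) = mu_lattice L" if "L \<in> ?S" for L
  proof -
    have "L \<in> ?R `` {L}" using equiv_class_self[OF equiv that] .
    moreover have "mu_lattice M = mu_lattice L" if "M \<in> ?R `` {L}" for M
      using that mu_lattice_iso by (auto simp: lattice_iso_rel_def)
    ultimately have "mu_lattice ` (?R `` {L}) = {mu_lattice L}" by blast
    thus ?thesis by simp
  qed
  have inj: "?R `` {L} = ?R `` {M}" if LM: "L \<in> ?S" "M \<in> ?S" "mu_lattice L = mu_lattice M" for L M
  proof -
    obtain n \<phi> where n: "n \<in> Q" "realises K L \<phi>" "\<phi> ` carrier L = \<Lambda> n" "mu_lattice L = U n"
      by (rule rank2_realisation[OF LM(1)])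
    obtain m \<psi> where m: "m \<in> Q" "realises K M \<psi>" "\<psi> ` carrier M = \<Lambda> m" "mu_lattice M = U m"
      by (rule rank2_realisation[OF LM(2)])
    have "\<Lambda> n = \<Lambda> m" using U_eq_imp_\<Lambda>_eq[OF n(1) m(1)] n(4) m(4) LM(3) by simp
    moreover have "O_lattice K L" "O_lattice K M"
      using LM by (auto simp: rank2_root_lattices_def root_lattice_def)
    ultimately have "\<exists>f. lattice_iso K L M f"
      using lattice_iso_of_realisations[OF _ _ n(2) m(2)] n(3) m(3) by simp
    hence "(L, M) \<in> ?R" using LM by (auto simp: lattice_iso_rel_def)
    thus ?thesis by (rule equiv_class_eq[OF equiv])
  qed
  show ?thesis
    unfolding bij_betw_def
  proof (intro conjI inj_onI)
    fix A B assume AB: "A \<in> ?S // ?R" "B \<in> ?S // ?R" "?F A = ?F B"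
    obtain L where L: "L \<in> ?S" "A = ?R `` {L}" using AB(1) by (rule quotientE)
    obtain M where M: "M \<in> ?S" "B = ?R `` {M}" using AB(2) by (rule quotientE)
    show "A = B" unfolding L(2) M(2) by (rule inj) (use L M AB(3) F in auto)
  next
    show "?F ` (?S // ?R) = mu_set ` (P_family K \<union> R_family K)"
    proof (intro equalityI subsetI)
      fix y assume "y \<in> ?F ` (?S // ?R)"
      then obtain A where A: "A \<in> ?S // ?R" "y = ?F A" by blast
      obtain L where L: "L \<in> ?S" "A = ?R `` {L}" using A(1) by (rule quotientE)
      thus "y \<in> mu_set ` (P_family K \<union> R_family K)"
        using mu_lattice_in_family[OF L(1)] F[OF L(1)] A(2) by auto
    next
      fix y assume "y \<in> mu_set ` (P_family K \<union> R_family K)"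
      then obtain C where C: "C \<in> P_family K \<union> R_family K" "y = mu_set C" by blast
      obtain n where n: "n \<in> Q" "mu_set C = U n" using family_is_U[OF C(1)] by blast
      obtain L :: "'a form_module" and \<phi> where "lambda_lattice K L \<phi> n" using exists_lambda_lattice[OF n(1) inf] by blast
      then interpret ll: lambda_lattice K L \<phi> n .
      interpret rank2_root_lattice K L by unfold_locales (rule ll.in_rank2)
      have "y = ?F (?R `` {L})"
        using F[OF ll.in_rank2] mu_lattice_eq_U[OF n(1) ll.realises_\<phi> ll.image_carrier] C(2) n(2) by simp
      thus "y \<in> ?F ` (?S // ?R)" using quotientI[OF ll.in_rank2] by blast
    qed
  qed
qed

end

section \<open>Scalar extension\<close>

text \<open>The additive extension of \<open>h\<close> from the generators to the free abelian
  group. Functionals of this kind that vanish on the tensor relations tell cosets apart.\<close>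

definition frag_sum :: "('b \<Rightarrow> real) \<Rightarrow> ('b \<Rightarrow>\<^sub>0 int) \<Rightarrow> real"
  where "frag_sum h w = (\<Sum>k\<in>Poly_Mapping.keys w. of_int (poly_mapping.lookup w k) * h k)"

lemma frag_sum_superset:
  assumes "finite A" "Poly_Mapping.keys w \<subseteq> A"
  shows "frag_sum h w = (\<Sum>k\<in>A. of_int (poly_mapping.lookup w k) * h k)"
  unfolding frag_sum_def using assms by (intro sum.mono_neutral_left) (auto simp: in_keys_iff)

lemma frag_sum_add: "frag_sum h (v + w) = frag_sum h v + frag_sum h w"
proof -
  let ?A = "Poly_Mapping.keys v \<union> Poly_Mapping.keys w"
  have "frag_sum h (v + w) = (\<Sum>k\<in>?A. of_int (poly_mapping.lookup (v + w) k) * h k)"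
    by (rule frag_sum_superset) (auto dest: subsetD[OF Poly_Mapping.keys_add])
  also have "\<dots> = (\<Sum>k\<in>?A. of_int (poly_mapping.lookup v k) * h k) + (\<Sum>k\<in>?A. of_int (poly_mapping.lookup w k) * h k)"
    by (simp add: lookup_add algebra_simps sum.distrib)
  also have "\<dots> = frag_sum h v + frag_sum h w" by (simp add: frag_sum_superset[of ?A])
  finally show ?thesis .
qed

lemma frag_sum_minus: "frag_sum h (- w) = - frag_sum h w"
  by (simp add: frag_sum_def sum_negf)

lemma frag_sum_diff: "frag_sum h (v - w) = frag_sum h v - frag_sum h w"
  using frag_sum_add[of h v "- w"] frag_sum_minus[of h w] by simp

lemma frag_sum_of [simp]: "frag_sum h (frag_of k) = h k"
  by (simp add: frag_sum_def)

text \<open>A basis \<open>e\<close>, \<open>f\<close> given with its coordinate functions, because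
  these induce the functionals \<open>k \<otimes> x \<mapsto> k * p x\<close> and
  \<open>k \<otimes> x \<mapsto> k * q x\<close> on the scalar extension.\<close>

locale coordinates = totally_real K for K +
  fixes L :: "'a form_module" and e f :: 'a and p q :: "'a \<Rightarrow> real"
  assumes module: "module (ring_on \<O>) L"
    and ef: "e \<in> carrier L" "f \<in> carrier L"
    and pq: "x \<in> carrier L \<Longrightarrow> p x \<in> \<O>" "x \<in> carrier L \<Longrightarrow> q x \<in> \<O>"
    and comb: "x \<in> carrier L \<Longrightarrow> x = p x \<odot>\<^bsub>L\<^esub> e \<oplus>\<^bsub>L\<^esub> q x \<odot>\<^bsub>L\<^esub> f"
    and p_add: "x \<in> carrier L \<Longrightarrow> y \<in> carrier L \<Longrightarrow> p (x \<oplus>\<^bsub>L\<^esub> y) = p x + p y"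
    and q_add: "x \<in> carrier L \<Longrightarrow> y \<in> carrier L \<Longrightarrow> q (x \<oplus>\<^bsub>L\<^esub> y) = q x + q y"
    and p_smult: "x \<in> carrier L \<Longrightarrow> a \<in> \<O> \<Longrightarrow> p (a \<odot>\<^bsub>L\<^esub> x) = a * p x"
    and q_smult: "x \<in> carrier L \<Longrightarrow> a \<in> \<O> \<Longrightarrow> q (a \<odot>\<^bsub>L\<^esub> x) = a * q x"
    and p_ef: "p e = 1" "p f = 0" and q_ef: "q e = 0" "q f = 1"
begin

interpretation md: module "ring_on \<O>" L by (rule module)

abbreviation "T \<equiv> tensor_pairs K L"
abbreviation "N \<equiv> tensor_relations K L"
abbreviation "gens \<equiv>
    {frag_of (k + l, x) - frag_of (k, x) - frag_of (l, x) | k l x. k \<in> K \<and> l \<in> K \<and> x \<in> carrier L} \<union>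
    {frag_of (k, x \<oplus>\<^bsub>L\<^esub> y) - frag_of (k, x) - frag_of (k, y) | k x y. k \<in> K \<and> x \<in> carrier L \<and> y \<in> carrier L} \<union>
    {frag_of (k * a, x) - frag_of (k, a \<odot>\<^bsub>L\<^esub> x) | k a x. k \<in> K \<and> a \<in> \<O> \<and> x \<in> carrier L}"

lemma T_simps: "carrier T = {w. Poly_Mapping.keys w \<subseteq> K \<times> carrier L}" "x \<otimes>\<^bsub>T\<^esub> y = x + y" "\<one>\<^bsub>T\<^esub> = 0"
  by (auto simp: tensor_pairs_def)

lemma T_group: "comm_group T" unfolding tensor_pairs_def by (rule abelian_free_Abelian_group)

interpretation T: comm_group T by (rule T_group)

lemma frag_in_T: "k \<in> K \<Longrightarrow> x \<in> carrier L \<Longrightarrow> frag_of (k, x) \<in> carrier T"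
  by (simp add: T_simps)

lemma T_diff: "v \<in> carrier T \<Longrightarrow> w \<in> carrier T \<Longrightarrow> v - w \<in> carrier T"
  using Poly_Mapping.keys_diff[of v w] by (auto simp: T_simps)

lemma T_add: "v \<in> carrier T \<Longrightarrow> w \<in> carrier T \<Longrightarrow> v + w \<in> carrier T"
  using T.m_closed by (simp add: T_simps(2))

lemma gens_in_T: "gens \<subseteq> carrier T"
  using md.smult_closed by (auto intro!: T_diff frag_in_T K_add K_mult dest: O_K)

lemma N_def: "N = generate T gens" by (simp add: tensor_relations_def)

lemma N_subgroup: "subgroup N T" unfolding N_def by (rule T.generate_is_subgroup[OF gens_in_T])

lemma N_in_T: "w \<in> N \<Longrightarrow> w \<in> carrier T" using subgroup.subset[OF N_subgroup] by blast

lemma inv_T: "w \<in> carrier T \<Longrightarrow> inv\<^bsub>T\<^esub> w = - w" unfolding tensor_pairs_def by simp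

lemma N_zero: "0 \<in> N" using subgroup.one_closed[OF N_subgroup] by (simp add: T_simps)
lemma N_add: "v \<in> N \<Longrightarrow> w \<in> N \<Longrightarrow> v + w \<in> N" using subgroup.m_closed[OF N_subgroup, of v w] by (simp add: T_simps)
lemma N_minus: "w \<in> N \<Longrightarrow> - w \<in> N"
  using subgroup.m_inv_closed[OF N_subgroup, of w] inv_T N_in_T by simp
lemma N_diff: "v \<in> N \<Longrightarrow> w \<in> N \<Longrightarrow> v - w \<in> N" using N_add[OF _ N_minus] by fastforce

lemma N_gen: "g \<in> gens \<Longrightarrow> g \<in> N" unfolding N_def by (rule generate.incl)

lemma rel_add_left: "k \<in> K \<Longrightarrow> l \<in> K \<Longrightarrow> x \<in> carrier L \<Longrightarrow> frag_of (k + l, x) - frag_of (k, x) - frag_of (l, x) \<in> N"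
  by (intro N_gen) blast
lemma rel_add_right: "k \<in> K \<Longrightarrow> x \<in> carrier L \<Longrightarrow> y \<in> carrier L \<Longrightarrow> frag_of (k, x \<oplus>\<^bsub>L\<^esub> y) - frag_of (k, x) - frag_of (k, y) \<in> N"
  by (intro N_gen) blast
lemma rel_smult: "k \<in> K \<Longrightarrow> a \<in> \<O> \<Longrightarrow> x \<in> carrier L \<Longrightarrow> frag_of (k * a, x) - frag_of (k, a \<odot>\<^bsub>L\<^esub> x) \<in> N"
  by (intro N_gen) blast

lemma N_induct [consumes 1, case_names gen zero minus add]:
  assumes "w \<in> N" and gen: "\<And>g. g \<in> gens \<Longrightarrow> P g" and zero: "P 0"
    and minus: "\<And>v. P v \<Longrightarrow> P (- v)" and add: "\<And>v w. P v \<Longrightarrow> P w \<Longrightarrow> P (v + w)"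
  shows "P w"
  using assms(1) unfolding N_def
proof induction
  case (inv h)
  have "inv\<^bsub>T\<^esub> h = - h" using inv_T gens_in_T inv by blast
  thus ?case using gen[OF inv] minus by simp
qed (use gen zero add in \<open>auto simp: T_simps\<close>)

text \<open>For an \<open>\<O>\<close>-linear \<open>r\<close>, the map
  \<open>(k, x) \<mapsto> k * r x\<close> is balanced, so it descends to the tensor product.\<close>

lemma frag_sum_relation:
  assumes "w \<in> N" and r_add: "\<And>x y. x \<in> carrier L \<Longrightarrow> y \<in> carrier L \<Longrightarrow> r (x \<oplus>\<^bsub>L\<^esub> y) = r x + r y"
    and r_smult: "\<And>a x. x \<in> carrier L \<Longrightarrow> a \<in> \<O> \<Longrightarrow> r (a \<odot>\<^bsub>L\<^esub> x) = a * r x"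
  shows "frag_sum (\<lambda>(k, x). k * r x) w = 0"
  using assms(1)
proof (induction rule: N_induct)
  case zero
  show ?case by (simp add: frag_sum_def)
qed (auto simp: frag_sum_add frag_sum_minus frag_sum_diff r_add r_smult distrib_left distrib_right mult.assoc)

lemma frag_sum_N: "w \<in> N \<Longrightarrow> frag_sum (\<lambda>(k, x). k * p x) w = 0" "w \<in> N \<Longrightarrow> frag_sum (\<lambda>(k, x). k * q x) w = 0"
  by (erule frag_sum_relation; simp add: p_add q_add p_smult q_smult)+

lemma coset: "N #>\<^bsub>T\<^esub> w = {v + w | v. v \<in> N}"
  by (auto simp: r_coset_def T_simps)

lemma coset_eq_iff: "N #>\<^bsub>T\<^esub> v = N #>\<^bsub>T\<^esub> w \<longleftrightarrow> v - w \<in> N"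
proof
  assume "N #>\<^bsub>T\<^esub> v = N #>\<^bsub>T\<^esub> w"
  moreover have "v \<in> N #>\<^bsub>T\<^esub> v" unfolding coset using N_zero by force
  ultimately show "v - w \<in> N" unfolding coset by auto
next
  assume vw: "v - w \<in> N"
  have sub: "N #>\<^bsub>T\<^esub> a \<subseteq> N #>\<^bsub>T\<^esub> b" if "a - b \<in> N" for a b
    unfolding coset
  proof safe
    fix u assume "u \<in> N"
    hence "u + (a - b) \<in> N" using N_add that by blast
    thus "\<exists>v. u + a = v + b \<and> v \<in> N" by (intro exI[of _ "u + (a - b)"]) simp
  qed
  have "w - v \<in> N" using N_minus[OF vw] by simp
  thus "N #>\<^bsub>T\<^esub> v = N #>\<^bsub>T\<^esub> w" using sub vw by blast
qed

abbreviation "SE \<equiv> scalar_extension K L"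

lemma N_normal: "N \<lhd> T" using T.normal_iff_subgroup N_subgroup by simp

lemma SE_carrier: "carrier SE = {N #>\<^bsub>T\<^esub> w | w. w \<in> carrier T}"
  by (auto simp: scalar_extension_def FactGroup_def RCOSETS_def)

lemma SE_add: "v \<in> carrier T \<Longrightarrow> w \<in> carrier T \<Longrightarrow> (N #>\<^bsub>T\<^esub> v) \<oplus>\<^bsub>SE\<^esub> (N #>\<^bsub>T\<^esub> w) = N #>\<^bsub>T\<^esub> (v + w)"
  using normal.rcos_sum[OF N_normal, of v w] by (simp add: scalar_extension_def FactGroup_def T_simps)

lemma SE_zero: "\<zero>\<^bsub>SE\<^esub> = N #>\<^bsub>T\<^esub> 0"
proof -
  have "N #>\<^bsub>T\<^esub> 0 = N" unfolding coset by simp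
  thus ?thesis by (simp add: scalar_extension_def FactGroup_def)
qed

lemma SE_monoid: "abelian_monoid SE"
proof (rule abelian_monoidI)
  have z: "0 \<in> carrier T" by (simp add: T_simps)
  show "\<zero>\<^bsub>SE\<^esub> \<in> carrier SE" unfolding SE_zero SE_carrier using z by blast
  fix x y z assume "x \<in> carrier SE" "y \<in> carrier SE" "z \<in> carrier SE"
  then obtain u v w where uvw: "u \<in> carrier T" "v \<in> carrier T" "w \<in> carrier T"
    "x = N #>\<^bsub>T\<^esub> u" "y = N #>\<^bsub>T\<^esub> v" "z = N #>\<^bsub>T\<^esub> w" by (auto simp: SE_carrier)
  note cl = T_add[OF uvw(1,2)] T_add[OF uvw(2,3)]
  show "x \<oplus>\<^bsub>SE\<^esub> y \<oplus>\<^bsub>SE\<^esub> z = x \<oplus>\<^bsub>SE\<^esub> (y \<oplus>\<^bsub>SE\<^esub> z)"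
    unfolding uvw(4-6) by (simp only: SE_add uvw(1-3) cl add.assoc)
next
  fix x y assume "x \<in> carrier SE" "y \<in> carrier SE"
  then obtain u v where uv: "u \<in> carrier T" "v \<in> carrier T" "x = N #>\<^bsub>T\<^esub> u" "y = N #>\<^bsub>T\<^esub> v"
    by (auto simp: SE_carrier)
  show "x \<oplus>\<^bsub>SE\<^esub> y \<in> carrier SE"
    unfolding uv(3,4) SE_add[OF uv(1,2)] unfolding SE_carrier using T_add[OF uv(1,2)] by blast
  show "x \<oplus>\<^bsub>SE\<^esub> y = y \<oplus>\<^bsub>SE\<^esub> x"
    unfolding uv(3,4) SE_add[OF uv(1,2)] SE_add[OF uv(2,1)] by (simp only: add.commute)
next
  have z: "0 \<in> carrier T" by (simp add: T_simps)
  fix x assume "x \<in> carrier SE"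
  then obtain u where u: "u \<in> carrier T" "x = N #>\<^bsub>T\<^esub> u" by (auto simp: SE_carrier)
  show "\<zero>\<^bsub>SE\<^esub> \<oplus>\<^bsub>SE\<^esub> x = x" unfolding u(2) SE_zero SE_add[OF z u(1)] by simp
qed

text \<open>Each of the three kinds of relations is mapped to a relation of the same kind, so
  scalars act on cosets.\<close>

lemma extend_N:
  assumes "k \<in> K" "w \<in> N"
  shows "frag_extend (\<lambda>(l, x). frag_of (k * l, x)) w \<in> N"
  using assms(2)
proof (induction rule: N_induct)
  case (gen g)
  then consider (a) l m x where "l \<in> K" "m \<in> K" "x \<in> carrier L" "g = frag_of (l + m, x) - frag_of (l, x) - frag_of (m, x)"
    | (b) l x y where "l \<in> K" "x \<in> carrier L" "y \<in> carrier L" "g = frag_of (l, x \<oplus>\<^bsub>L\<^esub> y) - frag_of (l, x) - frag_of (l, y)"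
    | (c) l a x where "l \<in> K" "a \<in> \<O>" "x \<in> carrier L" "g = frag_of (l * a, x) - frag_of (l, a \<odot>\<^bsub>L\<^esub> x)"
    by blast
  thus ?case
  proof cases
    case a
    thus ?thesis using rel_add_left[of "k * l" "k * m" x] assms(1) K_mult
      by (simp add: frag_extend_diff distrib_left)
  next
    case b
    thus ?thesis using rel_add_right[of "k * l" x y] assms(1) K_mult
      by (simp add: frag_extend_diff)
  next
    case c
    thus ?thesis using rel_smult[of "k * l" a x] assms(1) K_mult
      by (simp add: frag_extend_diff mult.assoc)
  qed
qed (auto simp: N_zero frag_extend_minus N_minus frag_extend_add N_add)

lemma SE_smult:
  assumes "k \<in> K"
  shows "k \<odot>\<^bsub>SE\<^esub> (N #>\<^bsub>T\<^esub> frag_of (l, x)) = N #>\<^bsub>T\<^esub> frag_of (k * l, x)"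
proof -
  let ?E = "frag_extend (\<lambda>(l, x). frag_of (k * l, x))"
  have "k \<odot>\<^bsub>SE\<^esub> (N #>\<^bsub>T\<^esub> frag_of (l, x)) = {v + ?E (u + frag_of (l, x)) | v u. v \<in> N \<and> u \<in> N}"
    unfolding coset scalar_extension_def by (auto simp: set_mult_def T_simps)
  also have "\<dots> = {v + (?E u + frag_of (k * l, x)) | v u. v \<in> N \<and> u \<in> N}"
    by (simp add: frag_extend_add)
  also have "\<dots> = {v + frag_of (k * l, x) | v. v \<in> N}"
  proof (intro equalityI subsetI)
    fix y assume "y \<in> {v + (?E u + frag_of (k * l, x)) | v u. v \<in> N \<and> u \<in> N}"
    then obtain u v where uv: "u \<in> N" "v \<in> N" "y = v + (?E u + frag_of (k * l, x))" by blast
    have "v + ?E u \<in> N" by (intro N_add uv extend_N assms)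
    thus "y \<in> {v + frag_of (k * l, x) | v. v \<in> N}" unfolding uv(3) add.assoc[symmetric] by blast
  next
    fix y assume "y \<in> {v + frag_of (k * l, x) | v. v \<in> N}"
    then obtain v where v: "v \<in> N" "y = v + frag_of (k * l, x)" by blast
    hence "y = v + (?E 0 + frag_of (k * l, x))" by simp
    thus "y \<in> {v + (?E u + frag_of (k * l, x)) | v u. v \<in> N \<and> u \<in> N}" using v(1) N_zero by blast
  qed
  finally show ?thesis unfolding coset .
qed

text \<open>The spanning half: \<open>k \<otimes> x\<close> equals
  \<open>k p(x) \<otimes> e + k q(x) \<otimes> f\<close>, and such expressions are closed under
  differences.\<close>

lemma decompose:
  assumes "w \<in> carrier T"
  shows "\<exists>a\<in>K. \<exists>b\<in>K. w - (frag_of (a, e) + frag_of (b, f)) \<in> N"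
proof -
  have zero: "frag_of (0, x) \<in> N" if "x \<in> carrier L" for x
    using N_minus[OF rel_add_left[OF K_zero K_zero that]] by simp
  have "Poly_Mapping.keys w \<subseteq> K \<times> carrier L" using assms by (simp add: T_simps)
  thus ?thesis
  proof (induction w rule: frag_induction)
    case zero
    have "- (frag_of (0, e) + frag_of (0, f)) \<in> N" by (intro N_minus N_add \<open>\<And>x. x \<in> carrier L \<Longrightarrow> frag_of (0, x) \<in> N\<close> ef)
    thus ?case using K_zero by (intro bexI[of _ 0]) auto
  next
    case (one kx)
    obtain k x where kx: "kx = (k, x)" "k \<in> K" "x \<in> carrier L" using one by auto
    have cl: "p x \<odot>\<^bsub>L\<^esub> e \<in> carrier L" "q x \<odot>\<^bsub>L\<^esub> f \<in> carrier L" using pq kx(3) ef md.smult_closed by auto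
    have 1: "frag_of (k, x) - frag_of (k, p x \<odot>\<^bsub>L\<^esub> e) - frag_of (k, q x \<odot>\<^bsub>L\<^esub> f) \<in> N"
      using rel_add_right[OF kx(2) cl] comb[OF kx(3)] by simp
    have 2: "frag_of (k * p x, e) - frag_of (k, p x \<odot>\<^bsub>L\<^esub> e) \<in> N" "frag_of (k * q x, f) - frag_of (k, q x \<odot>\<^bsub>L\<^esub> f) \<in> N"
      using rel_smult kx pq ef by auto
    have "frag_of (k, x) - frag_of (k, p x \<odot>\<^bsub>L\<^esub> e) - frag_of (k, q x \<odot>\<^bsub>L\<^esub> f)
       - (frag_of (k * p x, e) - frag_of (k, p x \<odot>\<^bsub>L\<^esub> e)) - (frag_of (k * q x, f) - frag_of (k, q x \<odot>\<^bsub>L\<^esub> f)) \<in> N"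
      by (intro N_diff 1 2)
    hence "frag_of kx - (frag_of (k * p x, e) + frag_of (k * q x, f)) \<in> N" by (simp add: kx(1) algebra_simps)
    thus ?case using kx pq K_mult O_K by blast
  next
    case (diff u v)
    obtain a b where ab: "a \<in> K" "b \<in> K" "u - (frag_of (a, e) + frag_of (b, f)) \<in> N" using diff by blast
    obtain c d where cd: "c \<in> K" "d \<in> K" "v - (frag_of (c, e) + frag_of (d, f)) \<in> N" using diff by blast
    \<comment> \<open>The relations express additivity, whereas the induction proceeds by
      differences; \<open>a\<close> is therefore split as \<open>(a - c) + c\<close>, and likewise
      \<open>b\<close>.\<close>
    have 1: "frag_of (a - c + c, e) - frag_of (a - c, e) - frag_of (c, e) \<in> N"
      "frag_of (b - d + d, f) - frag_of (b - d, f) - frag_of (d, f) \<in> N"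
      by (rule rel_add_left; intro K_diff ab cd ef)+
    have "(u - (frag_of (a, e) + frag_of (b, f))) - (v - (frag_of (c, e) + frag_of (d, f)))
      + (frag_of (a - c + c, e) - frag_of (a - c, e) - frag_of (c, e))
      + (frag_of (b - d + d, f) - frag_of (b - d, f) - frag_of (d, f)) \<in> N"
      by (intro N_add N_diff[OF ab(3) cd(3)] 1)
    hence "u - v - (frag_of (a - c, e) + frag_of (b - d, f)) \<in> N" by (simp add: algebra_simps)
    thus ?case using ab cd K_diff by blast
  qed
qed

lemma pure_tensor_finite_basis: "finite_basis (ring_on K) SE (pure_tensor K L 1 ` {e, f})"
proof -
  let ?E = "N #>\<^bsub>T\<^esub> frag_of (1, e)" and ?F = "N #>\<^bsub>T\<^esub> frag_of (1, f)"
  have frag_T: "frag_of (a, e) \<in> carrier T" "frag_of (a, f) \<in> carrier T" if "a \<in> K" for a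
    using that ef frag_in_T by auto
  have sm: "a \<odot>\<^bsub>SE\<^esub> ?E = N #>\<^bsub>T\<^esub> frag_of (a, e)" "a \<odot>\<^bsub>SE\<^esub> ?F = N #>\<^bsub>T\<^esub> frag_of (a, f)" if "a \<in> K" for a
    using SE_smult[OF that, of 1] by simp_all
  have lin: "a \<odot>\<^bsub>SE\<^esub> ?E \<oplus>\<^bsub>SE\<^esub> b \<odot>\<^bsub>SE\<^esub> ?F = N #>\<^bsub>T\<^esub> (frag_of (a, e) + frag_of (b, f))" if "a \<in> K" "b \<in> K" for a b
    unfolding sm[OF that(1)] sm[OF that(2)] by (rule SE_add[OF frag_T(1)[OF that(1)] frag_T(2)[OF that(2)]])
  have uniq: "a' = a \<and> b' = b"
    if eq: "N #>\<^bsub>T\<^esub> (frag_of (a, e) + frag_of (b, f)) = N #>\<^bsub>T\<^esub> (frag_of (a', e) + frag_of (b', f))" for a b a' b'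
  proof -
    have "frag_of (a, e) + frag_of (b, f) - (frag_of (a', e) + frag_of (b', f)) \<in> N" using eq by (simp only: coset_eq_iff)
    from frag_sum_N(1)[OF this] frag_sum_N(2)[OF this] show ?thesis
      by (simp add: frag_sum_add frag_sum_diff p_ef q_ef)
  qed
  have "?E \<noteq> ?F"
  proof
    assume "?E = ?F"
    hence "frag_of (1, e) - frag_of (1, f) \<in> N" by (simp only: coset_eq_iff)
    from frag_sum_N(1)[OF this] show False by (simp add: frag_sum_diff p_ef)
  qed
  moreover have in_SE: "N #>\<^bsub>T\<^esub> w \<in> carrier SE" if "w \<in> carrier T" for w using that by (auto simp: SE_carrier)
  moreover have "\<forall>x\<in>carrier SE. \<exists>a\<in>K. \<exists>b\<in>K. x = a \<odot>\<^bsub>SE\<^esub> ?E \<oplus>\<^bsub>SE\<^esub> b \<odot>\<^bsub>SE\<^esub> ?F \<and>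
      (\<forall>a'\<in>K. \<forall>b'\<in>K. x = a' \<odot>\<^bsub>SE\<^esub> ?E \<oplus>\<^bsub>SE\<^esub> b' \<odot>\<^bsub>SE\<^esub> ?F \<longrightarrow> a' = a \<and> b' = b)"
  proof
    fix x assume "x \<in> carrier SE"
    then obtain w where w: "w \<in> carrier T" "x = N #>\<^bsub>T\<^esub> w" by (auto simp: SE_carrier)
    obtain a b where ab: "a \<in> K" "b \<in> K" "w - (frag_of (a, e) + frag_of (b, f)) \<in> N" using decompose[OF w(1)] by blast
    have x: "x = a \<odot>\<^bsub>SE\<^esub> ?E \<oplus>\<^bsub>SE\<^esub> b \<odot>\<^bsub>SE\<^esub> ?F" unfolding w(2) lin[OF ab(1,2)] using ab(3) by (simp only: coset_eq_iff)
    have "a' = a \<and> b' = b" if "a' \<in> K" "b' \<in> K" "x = a' \<odot>\<^bsub>SE\<^esub> ?E \<oplus>\<^bsub>SE\<^esub> b' \<odot>\<^bsub>SE\<^esub> ?F" for a' b'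
      using that(3) unfolding x lin[OF ab(1,2)] lin[OF that(1,2)] by (rule uniq)
    thus "\<exists>a\<in>K. \<exists>b\<in>K. x = a \<odot>\<^bsub>SE\<^esub> ?E \<oplus>\<^bsub>SE\<^esub> b \<odot>\<^bsub>SE\<^esub> ?F \<and>
      (\<forall>a'\<in>K. \<forall>b'\<in>K. x = a' \<odot>\<^bsub>SE\<^esub> ?E \<oplus>\<^bsub>SE\<^esub> b' \<odot>\<^bsub>SE\<^esub> ?F \<longrightarrow> a' = a \<and> b' = b)"
      by (intro bexI[OF _ ab(1)] bexI[OF _ ab(2)] conjI[OF x]) (intro ballI impI)
  qed
  ultimately have "finite_basis (ring_on K) SE {?E, ?F}"
    by (subst finite_basis_pair_iff[OF SE_monoid]) (use frag_T K_one sm in auto)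
  thus ?thesis by (simp add: pure_tensor_def)
qed

end

section \<open>Lattices of type \<open>I\<^sub>2(m)\<close>\<close>

text \<open>Sine increases up to the right angle and is symmetric about it. The quotients of the two
  sides will be coefficients of roots in a fundamental system, where they have to be at least
  1.\<close>

lemma sin_multiple_ge:
  fixes j m :: nat
  assumes "1 \<le> j" "j < m"
  shows "sin (pi / real m) \<le> sin (real j * (pi / real m))"
proof -
  let ?t = "pi / real m"
  have t: "?t > 0" using assms by simp
  have neg: "- (pi / 2) \<le> ?t" using t pi_gt_zero by linarith
  have m: "real m * ?t = pi" using assms by simp
  have "1 * ?t \<le> real j * ?t" using assms(1) t by (intro mult_right_mono) auto
  hence lo: "?t \<le> real j * ?t" by simp
  have "(real j + 1) * ?t \<le> real m * ?t" using assms(2) t by (intro mult_right_mono) auto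
  hence hi: "real j * ?t + ?t \<le> pi" unfolding m by (simp only: distrib_right mult_1_left)
  show ?thesis
  proof (cases "real j * ?t \<le> pi / 2")
    case True
    show ?thesis by (rule sin_monotone_2pi_le; use lo True neg in linarith)
  next
    case False
    have "sin ?t \<le> sin (pi - real j * ?t)"
      by (rule sin_monotone_2pi_le; use hi False neg in linarith)
    thus ?thesis by simp
  qed
qed

lemma sin_pi_div_less:
  assumes "m \<ge> 2" "m < y"
  shows "sin (pi / real y) < sin (pi / real m)"
proof (rule sin_monotone_2pi)
  have "pi / real y > 0" using assms by simp
  thus "- (pi / 2) \<le> pi / real y" by (simp add: less_imp_le order_trans[of _ 0])
  show "pi / real y < pi / real m" using assms by (intro divide_strict_left_mono) auto
  show "pi / real m \<le> pi / 2" using assms(1) by (intro divide_left_mono) auto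
qed

context totally_real
begin

text \<open>The level of a root of unity in \<open>\<Lambda> m\<close> is a multiple of
  \<open>m\<close> in \<open>Q\<close>, and maximality leaves \<open>m\<close> alone.\<close>

lemma U_maximal:
  assumes "Q_maximal K m"
  shows "U m = {z. z ^ (2 * m) = 1}"
proof (intro equalityI subsetI)
  have m: "m \<in> Q" using assms by (simp add: Q_maximal_def)
  {
    fix z assume "z \<in> U m"
    then obtain k where k: "k \<in> Q" "m dvd k" "z ^ (2 * k) = 1" by (rule U_elem[OF m])
    hence "Q_le K m k" using dvd_path[OF m k(1,2)] m by (simp add: Q_le_def)
    hence "k = m" using assms by (simp add: Q_maximal_def)
    thus "z \<in> {z. z ^ (2 * m) = 1}" using k by simp
  next
    fix z :: complex assume z: "z \<in> {z. z ^ (2 * m) = 1}"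
    obtain k where "z = \<zeta> (2 * m) ^ k"
      by (rule root_of_unity_\<zeta>_power[of "2 * m" z]) (use z Q_pos[OF m] in auto)
    thus "z \<in> U m" using U_power[OF m U_base[OF m]] by simp
  }
qed

text \<open>If \<open>m\<close> is neither a prime power nor maximal, then
  \<open>\<Lambda> m\<close> contains \<open>\<zeta> (2 * y)\<close> for a proper multiple
  \<open>y\<close>. This gives a root whose coefficient at \<open>\<beta>\<close> has absolute value
  \<open>sin (pi / y) / sin (pi / m)\<close>, strictly between 0 and 1.\<close>

lemma type_I2_imp:
  assumes I2: "type_I2 K m (L :: 'a form_module)" and m3: "m \<ge> 3"
  shows "m \<in> Q" "primepow m \<or> Q_maximal K m"
proof -
  have Lr: "L \<in> rank2_root_lattices K" using I2 by (simp add: type_I2_def)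
  obtain \<alpha> \<beta> where ab: "\<alpha> \<noteq> \<beta>" "fundamental_system K L {\<alpha>, \<beta>}" "form L \<alpha> \<beta> = - 2 * cos (pi / real m)"
    using I2 by (auto simp: type_I2_def)
  have roots: "\<alpha> \<in> roots L" "\<beta> \<in> roots L" using ab(2) by (auto simp: fundamental_system_def)
  interpret rank2_root_lattice K L by unfold_locales (rule Lr)
  obtain n \<phi> where n: "n \<in> Q" "realises K L \<phi>" "\<phi> ` carrier L = \<Lambda> n" by (rule realisation_structure)
  interpret realised_lattice K L \<phi> by unfold_locales (rule n)
  have car: "\<alpha> \<in> carrier L" "\<beta> \<in> carrier L" using roots root_carrier by auto
  have "- (- 2 * cos (pi / real m)) \<in> \<O>" using form_O[OF car] unfolding ab(3) by (rule O_minus)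
  hence "2 * cos (pi / real m) \<in> K" using O_K by simp
  thus m: "m \<in> Q" using m3 by (simp add: Q_vertices_iff)
  show "primepow m \<or> Q_maximal K m"
  proof (rule ccontr)
    assume "\<not> (primepow m \<or> Q_maximal K m)"
    hence npp: "\<not> primepow m" and "\<not> Q_maximal K m" by auto
    then obtain y where y: "Q_le K m y" "y \<noteq> m" using m by (auto simp: Q_maximal_def)
    have yQ: "y \<in> Q" and "m dvd y" using y(1) path_dvd by (auto simp: Q_le_def)
    then obtain k where k: "y = m * k" by blast
    have my: "m < y" using \<open>m dvd y\<close> y(2) Q_pos[OF yQ] by (metis dvd_imp_le le_neq_implies_less)
    let ?z = "\<zeta> (2 * m)"
    have "\<zeta> (2 * y) \<in> \<Lambda> m" using multiple_in_\<Lambda>[OF m _ npp, of k] yQ k by simp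
    then obtain a b where a_b: "a \<in> \<O>" "b \<in> \<O>" "\<zeta> (2 * y) = of_real a + of_real b * ?z" by (auto simp: span2_def)
    let ?u = "\<phi> \<alpha>" and ?v = "\<phi> \<beta>"
    have "?u \<in> \<phi> ` roots L" "?v \<in> \<phi> ` roots L" using roots by auto
    hence nu: "norm ?u = 1" "norm ?v = 1" unfolding \<phi>_roots by auto
    \<comment> \<open>Rotating \<open>\<alpha>\<close> to 1 sends \<open>- \<beta>\<close> to
      \<open>w\<close>, whose real part \<open>cos (pi / m)\<close> is prescribed by the product.
      The argument stays in the span of \<open>\<alpha>\<close> and \<open>\<beta>\<close>, so
      \<open>n\<close> and \<open>m\<close> need not be compared.\<close>
    define w where "w = - (?v * cnj ?u)"
    have nw: "norm w = 1" using nu by (simp add: w_def norm_mult)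
    have "form L \<beta> \<alpha> = - 2 * cos (pi / real m)" using ab(3) form_sym[OF car] by simp
    hence "Re ?z = Re w" using \<phi>_form[OF car(2,1)] by (simp add: Re_\<zeta>_double w_def)
    hence "w = ?z \<or> w = cnj ?z" by (rule unit_eq_Re_imp[OF norm_\<zeta> nw])
    \<comment> \<open>The orientation of the pair is unknown, so \<open>s\<close> is
      \<open>\<zeta> (2 * y)\<close> or its conjugate; the coefficients \<open>a\<close>,
      \<open>b\<close> are the same in both cases because they are real.\<close>
    then obtain s where s: "s = of_real a + of_real b * w" "norm s = 1" "\<bar>Im s\<bar> = \<bar>Im (\<zeta> (2 * y))\<bar>" "\<bar>Im w\<bar> = \<bar>Im ?z\<bar>"
    proof
      assume w: "w = ?z"
      have "\<zeta> (2 * y) = of_real a + of_real b * w" unfolding w by (rule a_b(3))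
      thus ?thesis by (rule that[of "\<zeta> (2 * y)"]) (simp_all add: w)
    next
      assume w: "w = cnj ?z"
      have "cnj (\<zeta> (2 * y)) = of_real a + of_real b * w" unfolding w using arg_cong[OF a_b(3), of cnj] by simp
      thus ?thesis by (rule that[of "cnj (\<zeta> (2 * y))"]) (simp_all add: w)
    qed
    have uw: "?u * w = - ?v"
    proof -
      have "?u * w = - (?v * (?u * cnj ?u))" by (simp add: w_def)
      thus ?thesis unfolding unit_mult_cnj[OF nu(1)] by simp
    qed
    have us: "?u * s = of_real a * ?u + of_real (- b) * ?v"
    proof -
      have "?u * s = of_real a * ?u + of_real b * (?u * w)" unfolding s(1) by (simp add: algebra_simps)
      thus ?thesis unfolding uw by simp
    qed
    have "?u * s \<in> \<phi> ` carrier L"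
      unfolding us by (intro image_add image_smult O_minus a_b imageI car)
    hence "?u * s \<in> \<phi> ` roots L" unfolding \<phi>_roots using nu s(2) by (simp add: norm_mult)
    then obtain \<gamma> where \<gamma>: "\<gamma> \<in> roots L" "\<phi> \<gamma> = ?u * s" by auto
    have "\<exists>c \<in> {\<alpha>, \<beta>} \<rightarrow> \<O>. \<gamma> = finsum L (\<lambda>\<beta>. c \<beta> \<odot>\<^bsub>L\<^esub> \<beta>) {\<alpha>, \<beta>} \<and>
       ((\<forall>\<beta>\<in>{\<alpha>, \<beta>}. c \<beta> \<in> {a \<in> \<O>. a \<ge> 1} \<union> {0}) \<or> (\<forall>\<beta>\<in>{\<alpha>, \<beta>}. - c \<beta> \<in> {a \<in> \<O>. a \<ge> 1} \<union> {0}))"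
      using ab(2) \<gamma>(1) unfolding fundamental_system_def by blast
    then obtain c where c: "c \<in> {\<alpha>, \<beta>} \<rightarrow> \<O>" "\<gamma> = finsum L (\<lambda>\<beta>. c \<beta> \<odot>\<^bsub>L\<^esub> \<beta>) {\<alpha>, \<beta>}"
      "c \<beta> = 0 \<or> \<bar>c \<beta>\<bar> \<ge> 1" by fastforce
    have cO: "c \<alpha> \<in> \<O>" "c \<beta> \<in> \<O>" using c(1) by auto
    have "\<gamma> = c \<alpha> \<odot>\<^bsub>L\<^esub> \<alpha> \<oplus>\<^bsub>L\<^esub> c \<beta> \<odot>\<^bsub>L\<^esub> \<beta>"
      unfolding c(2) using ab(1) car cO smult_in by simp
    hence "?u * s = of_real (c \<alpha>) * ?u + of_real (c \<beta>) * ?v"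
      using \<gamma>(2) car cO smult_in by (simp add: \<phi>_add \<phi>_smult)
    also have "?v = - (?u * w)" unfolding uw by simp
    finally have "?u * s = ?u * (of_real (c \<alpha>) - of_real (c \<beta>) * w)" by (simp add: algebra_simps)
    moreover have "?u \<noteq> 0" using nu by auto
    ultimately have "s = of_real (c \<alpha>) - of_real (c \<beta>) * w" by simp
    from arg_cong[OF this, of Im] have "Im s = - (c \<beta> * Im w)" by simp
    hence "\<bar>Im s\<bar> = \<bar>c \<beta>\<bar> * \<bar>Im w\<bar>" by (simp add: abs_mult)
    hence eq: "sin (pi / real y) = \<bar>c \<beta>\<bar> * sin (pi / real m)"
      using s(3,4) Im_\<zeta>_double_pos[OF Q_gt_1[OF m]] Im_\<zeta>_double_pos[OF Q_gt_1[OF yQ]] by (simp add: \<zeta>_double)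
    have pos: "sin (pi / real y) > 0" "sin (pi / real m) > 0"
      using Im_\<zeta>_double_pos[OF Q_gt_1[OF m]] Im_\<zeta>_double_pos[OF Q_gt_1[OF yQ]] by (simp_all add: \<zeta>_double)
    have less: "sin (pi / real y) < sin (pi / real m)" using m3 my by (intro sin_pi_div_less) auto
    from c(3) show False
    proof
      assume "c \<beta> = 0"
      thus False using eq pos by simp
    next
      assume "1 \<le> \<bar>c \<beta>\<bar>"
      hence "1 * sin (pi / real m) \<le> \<bar>c \<beta>\<bar> * sin (pi / real m)" using pos by (intro mult_right_mono) auto
      thus False using eq less by simp
    qed
  qed
qed

end

context lambda_lattice
begin

text \<open>With \<open>t = pi / n\<close>, the coefficients of \<open>\<zeta> (2 * n) ^ j\<close>
  are \<open>sin ((j + 1) * t) / sin t\<close> and \<open>sin (j * t) / sin t\<close>. For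
  \<open>j < n\<close> each is 0 or at least 1; the remaining roots are the negatives of
  these.\<close>

lemma fundamental_coefficients:
  assumes U: "U n = {z. z ^ (2 * n) = 1}" and \<gamma>: "\<gamma> \<in> roots L" and ab: "a \<in> \<O>" "b \<in> \<O>"
    and \<phi>: "\<phi> \<gamma> = of_real a + of_real b * - cnj (\<zeta> (2 * n))"
  shows "(a = 0 \<or> a \<ge> 1) \<and> (b = 0 \<or> b \<ge> 1) \<or> (- a = 0 \<or> - a \<ge> 1) \<and> (- b = 0 \<or> - b \<ge> 1)"
proof -
  interpret r2: rank2_root_lattice K L by unfold_locales (rule in_rank2)
  let ?t = "pi / real n"
  have n0: "n > 0" using Q_pos[OF n] .
  have s0: "sin ?t > 0" using Im_\<zeta>_double_pos[OF Q_gt_1[OF n]] by (simp add: \<zeta>_double)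
  obtain e where e: "e \<in> carrier L" "\<phi> e = 1" by (rule exists_pair)
  have "e \<in> roots L" using e root_iff by simp
  hence "\<phi> \<gamma> * cnj (\<phi> e) \<in> carrier roots_of_unity"
    using r2.root_difference_root_of_unity[OF realises_\<phi> \<gamma>] by blast
  hence "\<phi> \<gamma> \<in> U n" using e \<phi>_in[OF rl.root_carrier[OF \<gamma>]] by (simp add: U_def)
  hence "\<phi> \<gamma> ^ (2 * n) = 1" unfolding U by simp
  then obtain i where i: "\<phi> \<gamma> = \<zeta> (2 * n) ^ i" using root_of_unity_\<zeta>_power[of "2 * n"] n0 by auto
  define j where "j = i mod (2 * n)"
  have "\<zeta> (2 * n) ^ i = \<zeta> (2 * n) ^ (2 * n * (i div (2 * n)) + j)" by (simp add: j_def)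
  also have "\<dots> = \<zeta> (2 * n) ^ j" using \<zeta>_root[of "2 * n"] n0 by (simp add: power_add power_mult)
  finally have \<phi>j: "\<phi> \<gamma> = \<zeta> (2 * n) ^ j" using i by simp
  have j2: "j < 2 * n" using n0 by (simp add: j_def)
  have key: "(a = 0 \<or> a \<ge> 1) \<and> (b = 0 \<or> b \<ge> 1)"
    if j: "j < n" and eq: "\<zeta> (2 * n) ^ j = of_real a + of_real b * - cnj (\<zeta> (2 * n))" for a b j
  proof -
    have cis: "cis (real j * ?t) = of_real a + of_real b * - cnj (cis ?t)"
      using eq by (simp add: \<zeta>_double Complex.DeMoivre)
    have im: "sin (real j * ?t) = b * sin ?t" using arg_cong[OF cis, of Im] by simp
    have re: "cos (real j * ?t) = a - b * cos ?t" using arg_cong[OF cis, of Re] by simp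
    have "real (Suc j) * ?t = real j * ?t + ?t"
      by (simp only: of_nat_Suc distrib_right mult_1_left add.commute)
    hence "sin (real (Suc j) * ?t) = sin (real j * ?t + ?t)" by (simp only:)
    also have "\<dots> = (b * sin ?t) * cos ?t + (a - b * cos ?t) * sin ?t" unfolding sin_add im re ..
    also have "\<dots> = a * sin ?t" by (simp add: algebra_simps)
    finally have a: "sin (real (Suc j) * ?t) = a * sin ?t" .
    have bound: "x = 0 \<or> x \<ge> 1" if "k \<le> n" "sin (real k * ?t) = x * sin ?t" for k x
    proof (cases "k = 0 \<or> k = n")
      case True
      hence "sin (real k * ?t) = 0" using n0 by auto
      thus ?thesis using that(2) s0 by simp
    next
      case False
      hence "sin ?t \<le> sin (real k * ?t)" using that(1) by (intro sin_multiple_ge) auto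
      hence "1 * sin ?t \<le> x * sin ?t" using that(2) by simp
      thus ?thesis using s0 by simp
    qed
    show ?thesis using bound[of "Suc j" a] bound[of j b] a im j by auto
  qed
  show ?thesis
  proof (cases "j < n")
    case True
    show ?thesis using key[OF True \<phi>[unfolded \<phi>j]] by (rule disjI1)
  next
    case False
    have "\<zeta> (2 * n) ^ n = - 1" unfolding \<zeta>_double Complex.DeMoivre using n0 by simp
    moreover have "\<zeta> (2 * n) ^ j = \<zeta> (2 * n) ^ n * \<zeta> (2 * n) ^ (j - n)" using False by (simp flip: power_add)
    ultimately have "\<zeta> (2 * n) ^ (j - n) = - \<phi> \<gamma>" using \<phi>j by simp
    also have "\<dots> = of_real (- a) + of_real (- b) * - cnj (\<zeta> (2 * n))" unfolding \<phi> by simp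
    finally show ?thesis using key[of "j - n" "- a" "- b"] j2 False by simp
  qed
qed

lemma type_I2:
  assumes n3: "n \<ge> 3" and U: "U n = {z. z ^ (2 * n) = 1}"
  shows "type_I2 K n L"
proof -
  let ?z = "\<zeta> (2 * n)" and ?t = "- cnj (\<zeta> (2 * n))"
  have im: "Im ?z > 0" by (rule Im_\<zeta>_double_pos[OF Q_gt_1[OF n]])
  have "1 \<in> \<phi> ` carrier L" "?t \<in> \<phi> ` carrier L"
    unfolding image_carrier by (intro O_ring.span2_one O_ring.span2_minus \<Lambda>_cnj[OF n] O_ring.span2_base)+
  then obtain \<alpha> \<beta> where \<alpha>: "\<alpha> \<in> carrier L" "\<phi> \<alpha> = 1" and \<beta>: "\<beta> \<in> carrier L" "\<phi> \<beta> = ?t"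
    by (elim imageE) simp
  have roots: "\<alpha> \<in> roots L" "\<beta> \<in> roots L" using \<alpha> \<beta> root_iff by auto
  \<comment> \<open>The real solution of \<open>\<phi> x = p x - q x * cnj ?z\<close>, obtained from
    imaginary and then real parts.\<close>
  define q where "q x = Im (\<phi> x) / Im ?z" for x
  define p where "p x = Re (\<phi> x) + q x * Re ?z" for x
  have \<phi>_pq: "\<phi> x = of_real (p x) + of_real (q x) * ?t" for x
    using im by (simp add: complex_eq_iff p_def q_def)
  have pq: "p x \<in> \<O> \<and> q x \<in> \<O>" if x: "x \<in> carrier L" for x
  proof -
    obtain a b where ab: "a \<in> \<O>" "b \<in> \<O>" "\<phi> x = of_real a + of_real b * ?z"
      using \<phi>_in[OF x] by (auto simp: span2_def)
    have q: "q x = b" using im by (simp add: q_def ab(3))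
    \<comment> \<open>Change of basis by \<open>?z = 2 * Re ?z - cnj ?z\<close>, which is integral
      because the trace is.\<close>
    have "p x = a + b * (2 * Re ?z)" by (simp add: p_def q ab(3))
    thus ?thesis using q ab Q_trace_O[OF n] by (simp only: O_add O_mult)
  qed
  interpret coordinates K L \<alpha> \<beta> p q
  proof unfold_locales
    fix x assume x: "x \<in> carrier L"
    show "p x \<in> \<O>" "q x \<in> \<O>" using pq[OF x] by auto
    show "x = p x \<odot>\<^bsub>L\<^esub> \<alpha> \<oplus>\<^bsub>L\<^esub> q x \<odot>\<^bsub>L\<^esub> \<beta>"
      using x pq[OF x] \<alpha> \<beta> \<phi>_pq[of x] by (intro \<phi>_inj) (simp_all add: \<phi>_add \<phi>_smult add_in smult_in)
  next
    fix x y assume "x \<in> carrier L" "y \<in> carrier L"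
    thus "q (x \<oplus>\<^bsub>L\<^esub> y) = q x + q y" "p (x \<oplus>\<^bsub>L\<^esub> y) = p x + p y"
      by (simp_all add: p_def q_def \<phi>_add add_divide_distrib distrib_right)
  next
    fix x a assume "x \<in> carrier L" "a \<in> \<O>"
    thus "q (a \<odot>\<^bsub>L\<^esub> x) = a * q x" "p (a \<odot>\<^bsub>L\<^esub> x) = a * p x"
      by (simp_all add: p_def q_def \<phi>_smult distrib_left)
  qed (use \<alpha> \<beta> im in \<open>auto simp: p_def q_def\<close>)
  have ne: "\<alpha> \<noteq> \<beta>" using p_ef by auto
  have "form L \<alpha> \<beta> = - 2 * cos (pi / real n)"
    using \<phi>_form[OF \<alpha>(1) \<beta>(1)] \<alpha>(2) \<beta>(2) by (simp add: Re_\<zeta>_double)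
  moreover have "fundamental_system K L {\<alpha>, \<beta>}"
    unfolding fundamental_system_def
  proof (intro conjI ballI)
    show "{\<alpha>, \<beta>} \<subseteq> roots L" using roots by simp
    show "finite_basis (ring_on K) (scalar_extension K L) (pure_tensor K L 1 ` {\<alpha>, \<beta>})"
      by (rule pure_tensor_finite_basis)
    fix \<gamma> assume \<gamma>: "\<gamma> \<in> roots L"
    hence \<gamma>c: "\<gamma> \<in> carrier L" by (simp add: roots_def)
    define c where "c v = (if v = \<alpha> then p \<gamma> else q \<gamma>)" for v
    have c: "c \<alpha> = p \<gamma>" "c \<beta> = q \<gamma>" using ne by (auto simp: c_def)
    have "finsum L (\<lambda>v. c v \<odot>\<^bsub>L\<^esub> v) {\<alpha>, \<beta>} = p \<gamma> \<odot>\<^bsub>L\<^esub> \<alpha> \<oplus>\<^bsub>L\<^esub> q \<gamma> \<odot>\<^bsub>L\<^esub> \<beta>"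
      using ne \<alpha> \<beta> pq[OF \<gamma>c] smult_in by (simp add: c)
    hence sum: "\<gamma> = finsum L (\<lambda>v. c v \<odot>\<^bsub>L\<^esub> v) {\<alpha>, \<beta>}" using comb[OF \<gamma>c] by simp
    have cO: "c \<in> {\<alpha>, \<beta>} \<rightarrow> \<O>" using pq[OF \<gamma>c] by (auto simp: c_def)
    have "(p \<gamma> = 0 \<or> p \<gamma> \<ge> 1) \<and> (q \<gamma> = 0 \<or> q \<gamma> \<ge> 1) \<or> (- p \<gamma> = 0 \<or> - p \<gamma> \<ge> 1) \<and> (- q \<gamma> = 0 \<or> - q \<gamma> \<ge> 1)"
      using fundamental_coefficients[OF U \<gamma> _ _ \<phi>_pq] pq[OF \<gamma>c] by blast
    hence "(\<forall>v\<in>{\<alpha>, \<beta>}. c v \<in> {a \<in> \<O>. a \<ge> 1} \<union> {0}) \<or> (\<forall>v\<in>{\<alpha>, \<beta>}. - c v \<in> {a \<in> \<O>. a \<ge> 1} \<union> {0})"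
      using pq[OF \<gamma>c] O_minus by (auto simp: c)
    thus "\<exists>c\<in>{\<alpha>, \<beta>} \<rightarrow> \<O>. \<gamma> = finsum L (\<lambda>\<beta>. c \<beta> \<odot>\<^bsub>L\<^esub> \<beta>) {\<alpha>, \<beta>} \<and>
       ((\<forall>\<beta>\<in>{\<alpha>, \<beta>}. c \<beta> \<in> {a \<in> \<O>. a \<ge> 1} \<union> {0}) \<or> (\<forall>\<beta>\<in>{\<alpha>, \<beta>}. - c \<beta> \<in> {a \<in> \<O>. a \<ge> 1} \<union> {0}))"
      using sum cO by (intro bexI[of _ c] conjI)
  qed
  ultimately show ?thesis using in_rank2 ne unfolding type_I2_def by blast
qed

text \<open>A root \<open>h\<^sub>1 + h\<^sub>2\<close> with orthogonal \<open>h\<^sub>1, h\<^sub>2 \<noteq> 0\<close> would make \<open>|h\<^sub>1|\<^sup>2\<close> an algebraic integer all of whose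
  conjugates lie strictly between 0 and 1.\<close>

lemma root_in_summand:
  assumes h: "h1 \<in> carrier L" "h2 \<in> carrier L" "form L h1 h2 = 0" and r: "h1 \<oplus>\<^bsub>L\<^esub> h2 \<in> roots L"
  shows "h1 = \<zero>\<^bsub>L\<^esub> \<or> h2 = \<zero>\<^bsub>L\<^esub>"
proof (rule ccontr)
  assume "\<not> ?thesis"
  hence nz: "h1 \<noteq> \<zero>\<^bsub>L\<^esub>" "h2 \<noteq> \<zero>\<^bsub>L\<^esub>" by auto
  have im: "Im (\<zeta> (2 * n)) \<noteq> 0" using Im_\<zeta>_double_pos[OF Q_gt_1[OF n]] by simp
  define t where "t x = (norm (\<phi> x))\<^sup>2" for x
  \<comment> \<open>Integrality of the form yields only \<open>2 * t x\<close>; that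
    \<open>t x\<close> itself is integral uses that \<open>\<Lambda> n\<close> is a ring stable
    under conjugation.\<close>
  have tO: "t x \<in> \<O>" if x: "x \<in> carrier L" for x
  proof (rule O_ring.span2_real[OF im])
    have "complex_of_real (t x) = \<phi> x * cnj (\<phi> x)" unfolding t_def by (rule complex_norm_square)
    also have "\<dots> \<in> \<Lambda> n" by (intro \<Lambda>_mult[OF n] \<Lambda>_cnj[OF n] \<phi>_in x)
    finally show "complex_of_real (t x) \<in> \<Lambda> n" .
  qed
  have ft: "form L x x = t x + t x" if "x \<in> carrier L" for x
    using rl.\<phi>_norm[OF that] by (simp add: t_def)
  have "form L (h1 \<oplus>\<^bsub>L\<^esub> h2) (h1 \<oplus>\<^bsub>L\<^esub> h2) = form L h1 h1 + form L h2 h2"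
    using h rl.form_sym[OF h(1,2)] by (simp add: rl.form_add rl.form_add_right add_in)
  moreover have "form L (h1 \<oplus>\<^bsub>L\<^esub> h2) (h1 \<oplus>\<^bsub>L\<^esub> h2) = 2" using r by (simp add: roots_def)
  ultimately have sum: "t h1 + t h2 = 1" using ft h by simp
  have "\<bar>\<tau> (t h1)\<bar> < 1" if \<tau>: "\<tau> \<in> embeddings K" for \<tau> :: "real \<Rightarrow> real"
  proof -
    note add = embedding_add[OF \<tau>]
    have pos: "\<tau> (t x) > 0" if "x \<in> carrier L" "x \<noteq> \<zero>\<^bsub>L\<^esub>" for x
      using form_positive[OF \<tau> that] add[OF O_K[OF tO[OF that(1)]] O_K[OF tO[OF that(1)]]] by (simp add: ft[OF that(1)])
    have "\<tau> (t h1) + \<tau> (t h2) = 1"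
      using add[OF O_K[OF tO[OF h(1)]] O_K[OF tO[OF h(2)]]] sum embedding_one[OF \<tau>] by simp
    thus ?thesis using pos[OF h(1) nz(1)] pos[OF h(2) nz(2)] by simp
  qed
  hence "t h1 = 0" by (rule O_small_zero[OF tO[OF h(1)]])
  hence "\<phi> h1 = 0" by (simp add: t_def)
  thus False using \<phi>_inj[OF h(1) zero_in] \<phi>_zero nz(1) by simp
qed

text \<open>Each root lies in one of the summands. The basis roots \<open>e\<close> and
  \<open>f\<close> are not orthogonal, so they share a summand, which is then all of
  \<open>L\<close> and leaves zero for the other.\<close>

lemma not_reducible:
  assumes n3: "n \<ge> 3"
  shows "\<not> reducible_lattice K L"
proof
  assume "reducible_lattice K L"
  then obtain H1 H2 where H: "H1 \<subseteq> carrier L" "H2 \<subseteq> carrier L"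
    "O_lattice K (L\<lparr>carrier := H1\<rparr>)" "O_lattice K (L\<lparr>carrier := H2\<rparr>)"
    "H1 \<inter> H2 = {\<zero>\<^bsub>L\<^esub>}" "H1 <+>\<^bsub>L\<^esub> H2 = carrier L" "\<forall>x\<in>H1. \<forall>y\<in>H2. form L x y = 0"
    unfolding reducible_lattice_def by blast
  obtain e f where ef: "e \<in> carrier L" "\<phi> e = 1" "f \<in> carrier L" "\<phi> f = \<zeta> (2 * n)" by (rule exists_pair)
  have roots: "e \<in> roots L" "f \<in> roots L" using ef root_iff by auto
  \<comment> \<open>The bound on \<open>n\<close> enters here: for \<open>n = 2\<close> the two
    basis roots are orthogonal and the lattice splits.\<close>
  have "pi / real n < pi / 2" using n3 by (intro divide_strict_left_mono) auto
  hence "cos (pi / real n) > 0" using n3 by (intro cos_gt_zero_pi) (auto intro: less_trans[of _ 0])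
  hence ef_ne: "form L e f \<noteq> 0" using \<phi>_form[OF ef(1,3)] ef(2,4) by (simp add: Re_\<zeta>_double)
  have dich: "x \<in> H1 \<or> x \<in> H2" if x: "x \<in> roots L" for x
  proof -
    have "x \<in> H1 <+>\<^bsub>L\<^esub> H2" using x H(6) by (simp add: roots_def)
    then obtain h1 h2 where h: "h1 \<in> H1" "h2 \<in> H2" "x = h1 \<oplus>\<^bsub>L\<^esub> h2" by (auto simp: set_add_def set_mult_def)
    have c: "h1 \<in> carrier L" "h2 \<in> carrier L" using h H by auto
    have "h1 = \<zero>\<^bsub>L\<^esub> \<or> h2 = \<zero>\<^bsub>L\<^esub>" by (rule root_in_summand[OF c]) (use h H(7) x in auto)
    moreover have "x = h2" if "h1 = \<zero>\<^bsub>L\<^esub>" using c that h(3) rl.md.l_zero by simp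
    moreover have "x = h1" if "h2 = \<zero>\<^bsub>L\<^esub>" using c that h(3) rl.md.r_zero by simp
    ultimately show ?thesis using h by blast
  qed
  \<comment> \<open>Stated for an unordered pair of summands, since \<open>e\<close> may lie in
    either.\<close>
  have False
    if A: "A \<subseteq> carrier L" "O_lattice K (L\<lparr>carrier := A\<rparr>)" and B: "B \<subseteq> carrier L" "O_lattice K (L\<lparr>carrier := B\<rparr>)"
      and AB: "A \<inter> B = {\<zero>\<^bsub>L\<^esub>}" "\<forall>x\<in>A. \<forall>y\<in>B. form L x y = 0" "e \<in> A" "f \<in> A \<or> f \<in> B" for A B
  proof -
    have fA: "f \<in> A" using AB ef_ne by blast
    interpret A: o_lattice K "L\<lparr>carrier := A\<rparr>" by unfold_locales (rule A)
    interpret B: o_lattice K "L\<lparr>carrier := B\<rparr>" by unfold_locales (rule B)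
    have "carrier L \<subseteq> A"
    proof
      fix x assume "x \<in> carrier L"
      then obtain a b where ab: "a \<in> \<O>" "b \<in> \<O>" "x = a \<odot>\<^bsub>L\<^esub> e \<oplus>\<^bsub>L\<^esub> b \<odot>\<^bsub>L\<^esub> f" using basis_pair(3)[OF ef] by blast
      have "a \<odot>\<^bsub>L\<^esub> e \<in> A" "b \<odot>\<^bsub>L\<^esub> f \<in> A" using A.smult_in[of a e] A.smult_in[of b f] ab AB(3) fA by auto
      thus "x \<in> A" using A.md.a_closed[of "a \<odot>\<^bsub>L\<^esub> e" "b \<odot>\<^bsub>L\<^esub> f"] ab(3) by simp
    qed
    hence "B = {\<zero>\<^bsub>L\<^esub>}" using B AB(1) by blast
    thus False using B.carrier_ne by simp
  qed
  note * = this
  from dich[OF roots(1)] show False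
  proof
    assume "e \<in> H1"
    thus False using *[of H1 H2] H dich[OF roots(2)] by blast
  next
    assume e: "e \<in> H2"
    have "\<forall>x\<in>H2. \<forall>y\<in>H1. form L x y = 0"
    proof (intro ballI)
      fix x y assume xy: "x \<in> H2" "y \<in> H1"
      hence "form L x y = form L y x" using H(1,2) by (intro rl.form_sym) auto
      thus "form L x y = 0" using H(7) xy by simp
    qed
    moreover have "H2 \<inter> H1 = {\<zero>\<^bsub>L\<^esub>}" using H(5) by (simp only: Int_commute)
    ultimately show False using *[of H2 H1] H(1-4) dich[OF roots(2)] e by blast
  qed
qed

end

text \<open>Every isomorphism class has a representative on the infinite type \<open>'a\<close>,
  because the model lattices are countable; so quantifying over lattices on one type loses no
  class.\<close>

theorem theorem1p2:
  fixes K :: "real set"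
  assumes "totally_real_field K"
    and "infinite (UNIV :: 'a set)"
  shows "(\<forall>L \<in> (rank2_root_lattices K :: 'a form_module set).
            \<exists>C \<in> P_family K \<union> R_family K. mu_lattice L = mu_set C) \<and>
         mu_lattice respects (lattice_iso_rel K :: ('a form_module \<times> 'a form_module) set) \<and>
         bij_betw (\<lambda>A. the_elem (mu_lattice ` A))
           ((rank2_root_lattices K :: 'a form_module set) // lattice_iso_rel K)
           (mu_set ` (P_family K \<union> R_family K)) \<and>
         (finite_degree K \<longrightarrow>
           (\<forall>m\<ge>3. (2 * cos (pi / real m) \<in> K \<longleftrightarrow> m \<in> Q_vertices K) \<and>
             ((\<exists>L :: 'a form_module. root_lattice K L \<and> \<not> reducible_lattice K L \<and> type_I2 K m L) \<longleftrightarrow>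
              2 * cos (pi / real m) \<in> K \<and> (primepow m \<or> Q_maximal K m))))"
proof -
  interpret totally_real K by unfold_locales (rule assms(1))
  have Q_iff: "2 * cos (pi / real m) \<in> K \<longleftrightarrow> m \<in> Q_vertices K" if "m \<ge> 3" for m
    using that by (simp add: Q_vertices_iff)
  have I2: "(\<exists>L :: 'a form_module. root_lattice K L \<and> \<not> reducible_lattice K L \<and> type_I2 K m L) \<longleftrightarrow>
      2 * cos (pi / real m) \<in> K \<and> (primepow m \<or> Q_maximal K m)" if m: "m \<ge> 3" for m
  proof
    assume "\<exists>L :: 'a form_module. root_lattice K L \<and> \<not> reducible_lattice K L \<and> type_I2 K m L"
    thus "2 * cos (pi / real m) \<in> K \<and> (primepow m \<or> Q_maximal K m)"
      using type_I2_imp[OF _ m] Q_iff[OF m] by blast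
  next
    assume "2 * cos (pi / real m) \<in> K \<and> (primepow m \<or> Q_maximal K m)"
    \<comment> \<open>Either alternative in (ii) limits the roots of unity in
      \<open>\<Lambda> m\<close> to those of order dividing \<open>2 * m\<close>, so that no root
      falls strictly between the two walls of the fundamental system.\<close>
    hence Q: "m \<in> Q_vertices K" and U: "U m = {z. z ^ (2 * m) = 1}"
      using Q_iff[OF m] U_primepow U_maximal by blast+
    obtain L :: "'a form_module" and \<phi> where "lambda_lattice K L \<phi> m"
      using exists_lambda_lattice[OF Q assms(2)] by blast
    then interpret ll: lambda_lattice K L \<phi> m .
    show "\<exists>L :: 'a form_module. root_lattice K L \<and> \<not> reducible_lattice K L \<and> type_I2 K m L"
      using ll.in_rank2 ll.not_reducible[OF m] ll.type_I2[OF m U] by (auto simp: rank2_root_lattices_def)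
  qed
  show ?thesis
    by (intro conjI ballI impI allI mu_lattice_in_family mu_lattice_respects mu_lattice_bij assms(2) Q_iff I2)
qed

end
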